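(* A (small) coherent category $\mathcal{C}$ is semantically complete iff it is weakly Boolean and 2-valued (i.e. $|\mathrm{Sub}_{\mathcal{C}}(1)|=2$).
   Context: Coherent functors $M,N:\mathcal{C}\to\mathbf{Set}$ are elementary equivalent if for any subobjects $a\hookrightarrow x\hookleftarrow b$ in $\mathcal{C}$: $Ma\subseteq Mb$ iff $Na\subseteq Nb$. A coherent category $\mathcal{C}$ is semantically complete if it is not equivalent to the terminal category and any two coherent functors $\mathcal{C}\to\mathbf{Set}$ are elementary equivalent. $\mathcal{C}$ is weakly Boolean if for any pair of subobjects $a\hookrightarrow x\hookleftarrow b$ either $a\le b$ or there is $\emptyset\ne u\le a$ such that $u\cap b=\emptyset$ ($\emptyset$ the initial object). *)

theory Defs
  imports Main "HOL-Library.FuncSet" "HOL-Library.Equipollence"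
begin

record ('o, 'm) cat =
  Ob :: "'o set"
  Ar :: "'m set"
  Dom :: "'m \<Rightarrow> 'o"
  Cod :: "'m \<Rightarrow> 'o"
  Id :: "'o \<Rightarrow> 'm"
  Comp :: "'m \<Rightarrow> 'm \<Rightarrow> 'm"  \<comment> \<open>\<open>Comp C g f\<close> is \<open>g\<close> after \<open>f\<close>\<close>

definition hom :: "('o, 'm) cat \<Rightarrow> 'o \<Rightarrow> 'o \<Rightarrow> 'm set" where
  "hom C x y = {f \<in> Ar C. Dom C f = x \<and> Cod C f = y}"

locale category =
  fixes C :: "('o, 'm) cat"
  assumes Dom_Ob: "f \<in> Ar C \<Longrightarrow> Dom C f \<in> Ob C"
    and Cod_Ob: "f \<in> Ar C \<Longrightarrow> Cod C f \<in> Ob C"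
    and Id_hom: "x \<in> Ob C \<Longrightarrow> Id C x \<in> hom C x x"
    and Comp_hom: "f \<in> hom C x y \<Longrightarrow> g \<in> hom C y z \<Longrightarrow> Comp C g f \<in> hom C x z"
    and Comp_Id_right: "f \<in> hom C x y \<Longrightarrow> Comp C f (Id C x) = f"
    and Comp_Id_left: "f \<in> hom C x y \<Longrightarrow> Comp C (Id C y) f = f"
    and Comp_assoc: "f \<in> hom C w x \<Longrightarrow> g \<in> hom C x y \<Longrightarrow> h \<in> hom C y z \<Longrightarrow>
      Comp C h (Comp C g f) = Comp C (Comp C h g) f"

record ('o, 'm, 'p, 'n) cat_functor =
  Fo :: "'o \<Rightarrow> 'p"
  Fa :: "'m \<Rightarrow> 'n"

definition is_functor ::
    "('o, 'm) cat \<Rightarrow> ('p, 'n) cat \<Rightarrow> ('o, 'm, 'p, 'n) cat_functor \<Rightarrow> bool" where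
  "is_functor C D F \<longleftrightarrow>
     (\<forall>x\<in>Ob C. Fo F x \<in> Ob D) \<and>
     (\<forall>x y. \<forall>f\<in>hom C x y. Fa F f \<in> hom D (Fo F x) (Fo F y)) \<and>
     (\<forall>x\<in>Ob C. Fa F (Id C x) = Id D (Fo F x)) \<and>
     (\<forall>x y z. \<forall>f\<in>hom C x y. \<forall>g\<in>hom C y z. Fa F (Comp C g f) = Comp D (Fa F g) (Fa F f))"

definition id_functor :: "('o, 'm, 'o, 'm) cat_functor" where
  "id_functor = \<lparr>Fo = (\<lambda>x. x), Fa = (\<lambda>f. f)\<rparr>"

definition comp_functor ::
    "('p, 'n, 'q, 'k) cat_functor \<Rightarrow> ('o, 'm, 'p, 'n) cat_functor \<Rightarrow> ('o, 'm, 'q, 'k) cat_functor"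
  where
  "comp_functor G F = \<lparr>Fo = (\<lambda>x. Fo G (Fo F x)), Fa = (\<lambda>f. Fa G (Fa F f))\<rparr>"

definition is_iso :: "('o, 'm) cat \<Rightarrow> 'm \<Rightarrow> bool" where
  "is_iso C f \<longleftrightarrow> f \<in> Ar C \<and>
     (\<exists>g\<in>hom C (Cod C f) (Dom C f).
        Comp C g f = Id C (Dom C f) \<and> Comp C f g = Id C (Cod C f))"

definition nat_isomorphic :: "('o, 'm) cat \<Rightarrow> ('p, 'n) cat \<Rightarrow>
    ('o, 'm, 'p, 'n) cat_functor \<Rightarrow> ('o, 'm, 'p, 'n) cat_functor \<Rightarrow> bool" where
  "nat_isomorphic C D F G \<longleftrightarrow>
     (\<exists>\<eta>. (\<forall>x\<in>Ob C. \<eta> x \<in> hom D (Fo F x) (Fo G x) \<and> is_iso D (\<eta> x)) \<and>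
          (\<forall>x y. \<forall>f\<in>hom C x y. Comp D (Fa G f) (\<eta> x) = Comp D (\<eta> y) (Fa F f)))"

definition equivalent_categories :: "('o, 'm) cat \<Rightarrow> ('p, 'n) cat \<Rightarrow> bool" where
  "equivalent_categories C D \<longleftrightarrow>
     (\<exists>F G. is_functor C D F \<and> is_functor D C G \<and>
        nat_isomorphic C C (comp_functor G F) id_functor \<and>
        nat_isomorphic D D (comp_functor F G) id_functor)"

definition terminal_cat :: "(unit, unit) cat" where
  "terminal_cat = \<lparr>Ob = {()}, Ar = {()}, Dom = (\<lambda>_. ()), Cod = (\<lambda>_. ()),
     Id = (\<lambda>_. ()), Comp = (\<lambda>_ _. ())\<rparr>"

definition is_initial :: "('o, 'm) cat \<Rightarrow> 'o \<Rightarrow> bool" where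
  "is_initial C z \<longleftrightarrow> z \<in> Ob C \<and> (\<forall>x\<in>Ob C. \<exists>!f. f \<in> hom C z x)"

definition is_terminal :: "('o, 'm) cat \<Rightarrow> 'o \<Rightarrow> bool" where
  "is_terminal C t \<longleftrightarrow> t \<in> Ob C \<and> (\<forall>x\<in>Ob C. \<exists>!f. f \<in> hom C x t)"

text \<open>
  A finite diagram has a finite graph as its shape: vertices \<open>i \<in> V\<close> carry objects \<open>D i\<close>, and
  \<open>(i, f, j) \<in> E\<close> is an edge from \<open>i\<close> to \<open>j\<close> carrying the arrow \<open>f\<close>. Parallel edges carrying the
  same arrow impose the same condition on cones, so a set of triples is enough.
\<close>

definition finite_diagram ::
    "('o, 'm) cat \<Rightarrow> nat set \<Rightarrow> (nat \<Rightarrow> 'o) \<Rightarrow> (nat \<times> 'm \<times> nat) set \<Rightarrow> bool" where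
  "finite_diagram C V D E \<longleftrightarrow> finite V \<and> finite E \<and> (\<forall>i\<in>V. D i \<in> Ob C) \<and>
     (\<forall>(i, f, j)\<in>E. i \<in> V \<and> j \<in> V \<and> f \<in> hom C (D i) (D j))"

definition is_cone :: "('o, 'm) cat \<Rightarrow> nat set \<Rightarrow> (nat \<Rightarrow> 'o) \<Rightarrow> (nat \<times> 'm \<times> nat) set \<Rightarrow>
    'o \<Rightarrow> (nat \<Rightarrow> 'm) \<Rightarrow> bool" where
  "is_cone C V D E c p \<longleftrightarrow> c \<in> Ob C \<and> (\<forall>i\<in>V. p i \<in> hom C c (D i)) \<and>
     (\<forall>(i, f, j)\<in>E. Comp C f (p i) = p j)"

definition is_limit :: "('o, 'm) cat \<Rightarrow> nat set \<Rightarrow> (nat \<Rightarrow> 'o) \<Rightarrow> (nat \<times> 'm \<times> nat) set \<Rightarrow>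
    'o \<Rightarrow> (nat \<Rightarrow> 'm) \<Rightarrow> bool" where
  "is_limit C V D E c p \<longleftrightarrow> is_cone C V D E c p \<and>
     (\<forall>c' p'. is_cone C V D E c' p' \<longrightarrow>
        (\<exists>!h. h \<in> hom C c' c \<and> (\<forall>i\<in>V. Comp C (p i) h = p' i)))"

text \<open>\<open>p\<close> and \<open>q\<close> are the legs over \<open>Dom C f\<close> and \<open>Dom C g\<close> of a pullback of \<open>f\<close> and \<open>g\<close>.\<close>

definition is_pullback :: "('o, 'm) cat \<Rightarrow> 'm \<Rightarrow> 'm \<Rightarrow> 'm \<Rightarrow> 'm \<Rightarrow> bool" where
  "is_pullback C f g p q \<longleftrightarrow>
     f \<in> Ar C \<and> g \<in> Ar C \<and> Cod C f = Cod C g \<and>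
     p \<in> hom C (Dom C p) (Dom C f) \<and> q \<in> hom C (Dom C p) (Dom C g) \<and>
     Comp C f p = Comp C g q \<and>
     (\<forall>w p' q'. p' \<in> hom C w (Dom C f) \<and> q' \<in> hom C w (Dom C g) \<and> Comp C f p' = Comp C g q' \<longrightarrow>
        (\<exists>!h. h \<in> hom C w (Dom C p) \<and> Comp C p h = p' \<and> Comp C q h = q'))"

definition is_mono :: "('o, 'm) cat \<Rightarrow> 'm \<Rightarrow> bool" where
  "is_mono C m \<longleftrightarrow> m \<in> Ar C \<and>
     (\<forall>w. \<forall>f\<in>hom C w (Dom C m). \<forall>g\<in>hom C w (Dom C m). Comp C m f = Comp C m g \<longrightarrow> f = g)"

text \<open>
  Subobjects are handled through representing monomorphisms; \<open>Sub C x\<close> is the set of actual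
  subobjects, i.e. of isomorphism classes of monomorphisms into \<open>x\<close>.
\<close>

definition monos_into :: "('o, 'm) cat \<Rightarrow> 'o \<Rightarrow> 'm set" where
  "monos_into C x = {m. is_mono C m \<and> Cod C m = x}"

definition factors_through :: "('o, 'm) cat \<Rightarrow> 'm \<Rightarrow> 'm \<Rightarrow> bool" where
  "factors_through C f m \<longleftrightarrow> (\<exists>h\<in>hom C (Dom C f) (Dom C m). Comp C m h = f)"

abbreviation sub_le :: "('o, 'm) cat \<Rightarrow> 'm \<Rightarrow> 'm \<Rightarrow> bool" where
  "sub_le \<equiv> factors_through"

definition sub_equiv :: "('o, 'm) cat \<Rightarrow> 'o \<Rightarrow> ('m \<times> 'm) set" where
  "sub_equiv C x =
     {(a, b). a \<in> monos_into C x \<and> b \<in> monos_into C x \<and> sub_le C a b \<and> sub_le C b a}"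

definition Sub :: "('o, 'm) cat \<Rightarrow> 'o \<Rightarrow> 'm set set" where
  "Sub C x = monos_into C x // sub_equiv C x"

definition is_inter :: "('o, 'm) cat \<Rightarrow> 'o \<Rightarrow> 'm \<Rightarrow> 'm \<Rightarrow> 'm \<Rightarrow> bool" where
  "is_inter C x a b m \<longleftrightarrow> m \<in> monos_into C x \<and> sub_le C m a \<and> sub_le C m b \<and>
     (\<forall>n\<in>monos_into C x. sub_le C n a \<and> sub_le C n b \<longrightarrow> sub_le C n m)"

definition is_union :: "('o, 'm) cat \<Rightarrow> 'o \<Rightarrow> 'm set \<Rightarrow> 'm \<Rightarrow> bool" where
  "is_union C x S m \<longleftrightarrow> m \<in> monos_into C x \<and> (\<forall>a\<in>S. sub_le C a m) \<and>
     (\<forall>n\<in>monos_into C x. (\<forall>a\<in>S. sub_le C a n) \<longrightarrow> sub_le C m n)"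

definition is_image :: "('o, 'm) cat \<Rightarrow> 'm \<Rightarrow> 'm \<Rightarrow> bool" where
  "is_image C f m \<longleftrightarrow> m \<in> monos_into C (Cod C f) \<and> factors_through C f m \<and>
     (\<forall>n\<in>monos_into C (Cod C f). factors_through C f n \<longrightarrow> sub_le C m n)"

text \<open>\<open>m'\<close> is the inverse image of the subobject \<open>m\<close> along \<open>g\<close>.\<close>

definition is_inv_image :: "('o, 'm) cat \<Rightarrow> 'm \<Rightarrow> 'm \<Rightarrow> 'm \<Rightarrow> bool" where
  "is_inv_image C g m m' \<longleftrightarrow> (\<exists>q. is_pullback C g m m' q)"

locale coherent_category = category C for C :: "('o, 'm) cat" +
  assumes finite_limits: "finite_diagram C V D E \<Longrightarrow> \<exists>c p. is_limit C V D E c p"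
    and images: "f \<in> Ar C \<Longrightarrow> \<exists>m. is_image C f m"
    and images_stable:
      "is_image C f m \<Longrightarrow> is_pullback C g f f' q \<Longrightarrow> is_inv_image C g m m' \<Longrightarrow> is_image C f' m'"
    and finite_unions:
      "x \<in> Ob C \<Longrightarrow> finite S \<Longrightarrow> S \<subseteq> monos_into C x \<Longrightarrow> \<exists>m. is_union C x S m"
    and finite_unions_stable:
      "finite S \<Longrightarrow> S \<subseteq> monos_into C x \<Longrightarrow> is_union C x S m \<Longrightarrow> g \<in> hom C y x \<Longrightarrow>
       (\<And>a. a \<in> S \<Longrightarrow> is_inv_image C g a (P a)) \<Longrightarrow> is_inv_image C g m m' \<Longrightarrow>
       is_union C y (P ` S) m'"

definition coherent_functor ::
    "('o, 'm) cat \<Rightarrow> ('p, 'n) cat \<Rightarrow> ('o, 'm, 'p, 'n) cat_functor \<Rightarrow> bool" where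
  "coherent_functor C D F \<longleftrightarrow> is_functor C D F \<and>
     (\<forall>V X E c p. finite_diagram C V X E \<and> is_limit C V X E c p \<longrightarrow>
        is_limit D V (\<lambda>i. Fo F (X i)) ((\<lambda>(i, f, j). (i, Fa F f, j)) ` E)
          (Fo F c) (\<lambda>i. Fa F (p i))) \<and>
     (\<forall>f m. f \<in> Ar C \<and> is_image C f m \<longrightarrow> is_image D (Fa F f) (Fa F m)) \<and>
     (\<forall>x S m. x \<in> Ob C \<and> finite S \<and> S \<subseteq> monos_into C x \<and> is_union C x S m \<longrightarrow>
        is_union D (Fo F x) (Fa F ` S) (Fa F m))"

text \<open>
  The universe of sets is given by a type \<open>'u\<close>: objects are the sets with elements in \<open>'u\<close>.
  A map carries its domain and codomain, and its underlying function is extensional.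
\<close>

type_synonym 'u set_map = "'u set \<times> ('u \<Rightarrow> 'u) \<times> 'u set"

definition set_cat :: "('u set, 'u set_map) cat" where
  "set_cat = \<lparr>Ob = UNIV,
     Ar = {(A, f, B). f \<in> A \<rightarrow>\<^sub>E B},
     Dom = (\<lambda>(A, f, B). A),
     Cod = (\<lambda>(A, f, B). B),
     Id = (\<lambda>A. (A, restrict (\<lambda>a. a) A, A)),
     Comp = (\<lambda>(B, g, Z) (A, f, B'). (A, compose A g f, Z))\<rparr>"

lemma category_set_cat: "category (set_cat :: ('u set, 'u set_map) cat)"
  by unfold_locales
    (auto simp: set_cat_def hom_def Id_compose compose_Id intro!: compose_assoc,
     auto simp: compose_def PiE_iff fun_eq_iff extensional_def)

definition map_range :: "'u set_map \<Rightarrow> 'u set" where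
  "map_range = (\<lambda>(A, f, B). f ` A)"

text \<open>
  For a monomorphism \<open>a\<close> into \<open>x\<close>, the subset of \<open>M x\<close> meant by ``\<open>M a\<close>'' is the range of the
  injection \<open>Fa M a\<close>.
\<close>

definition elementary_equivalent :: "('o, 'm) cat \<Rightarrow> ('o, 'm, 'u set, 'u set_map) cat_functor \<Rightarrow>
    ('o, 'm, 'u set, 'u set_map) cat_functor \<Rightarrow> bool" where
  "elementary_equivalent C M N \<longleftrightarrow>
     (\<forall>x\<in>Ob C. \<forall>a\<in>monos_into C x. \<forall>b\<in>monos_into C x.
        map_range (Fa M a) \<subseteq> map_range (Fa M b) \<longleftrightarrow> map_range (Fa N a) \<subseteq> map_range (Fa N b))"

definition semantically_complete :: "'u itself \<Rightarrow> ('o, 'm) cat \<Rightarrow> bool" where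
  "semantically_complete U C \<longleftrightarrow>
     \<not> equivalent_categories C terminal_cat \<and>
     (\<forall>M N :: ('o, 'm, 'u set, 'u set_map) cat_functor.
        coherent_functor C set_cat M \<and> coherent_functor C set_cat N \<longrightarrow>
        elementary_equivalent C M N)"

definition weakly_boolean :: "('o, 'm) cat \<Rightarrow> bool" where
  "weakly_boolean C \<longleftrightarrow>
     (\<forall>x\<in>Ob C. \<forall>a\<in>monos_into C x. \<forall>b\<in>monos_into C x.
        sub_le C a b \<or>
        (\<exists>u\<in>monos_into C x. \<not> is_initial C (Dom C u) \<and> sub_le C u a \<and>
           (\<exists>w. is_inter C x u b w \<and> is_initial C (Dom C w))))"

definition two_valued :: "('o, 'm) cat \<Rightarrow> bool" where
  "two_valued C \<longleftrightarrow> (\<exists>t. is_terminal C t \<and> card (Sub C t) = 2)"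

text \<open>
  Smallness relative to the universe \<open>'u\<close>. The universe is infinite and has room for all the
  arrows (hence also for all the objects) of \<open>C\<close>.
\<close>

definition small_in :: "'u itself \<Rightarrow> ('o, 'm) cat \<Rightarrow> bool" where
  "small_in U C \<longleftrightarrow> infinite (UNIV :: 'u set) \<and> Ar C \<lesssim> (UNIV :: 'u set)"

end

theory Submission
  imports Defs
begin

text \<open>
  Right to left. Over a weakly Boolean, 2-valued category every coherent functor \<open>M\<close> satisfies
  \<open>M a \<subseteq> M b\<close> exactly when \<open>a \<le> b\<close>, so any two of them agree. Indeed, if \<open>a \<le> b\<close> fails, take a
  non-initial \<open>u \<le> a\<close> that is disjoint from \<open>b\<close>. The image of \<open>u\<close> in \<open>1\<close> is a nonzero subobject,
  hence all of \<open>1\<close>; since \<open>M\<close> preserves images, \<open>M u\<close> is inhabited, and its elements lie in \<open>M a\<close>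
  but not in \<open>M b\<close> (\<open>range_subset_iff_sub_le\<close>).

  Left to right. This needs a supply of coherent functors, given by \<open>ex_separating_functor\<close>: if
  \<open>a \<le> b\<close> fails, some coherent functor \<open>M\<close> has \<open>M a \<subseteq> M b\<close> false (completeness of coherent logic),
  and when \<open>b\<close> is the empty subobject this \<open>M\<close> can moreover be taken positively closed: an element
  outside \<open>M e\<close> lies in some \<open>M u\<close> with \<open>u\<close> disjoint from \<open>e\<close>. If \<open>0 < u < 1\<close>, a functor separating
  \<open>u\<close> from \<open>0\<close> and one separating \<open>1\<close> from \<open>u\<close> are not elementary equivalent, so a semantically
  complete category is 2-valued. If \<open>a \<le> b\<close> fails, it fails in some functor, hence by elementary
  equivalence in a positively closed functor \<open>N\<close>; an element of \<open>N a\<close> outside \<open>N b\<close> lies in some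
  \<open>N u\<close> with \<open>u\<close> disjoint from \<open>b\<close>, and \<open>u \<inter> a\<close> witnesses weak Booleanness.

  The functor is built by a Henkin argument. A set of named generic elements (nodes) is a diagram in
  \<open>C\<close>; it is consistent if no finite part of it forces the distinguished element of \<open>a\<close> into
  \<open>b\<close>. Zorn's lemma yields a maximal consistent set \<open>D\<close>, and \<open>M\<close> is the filtered
  colimit of the functors represented by the limits of its finite parts. The name of a node lists all equations it has to satisfy, so a
  node that is missing from \<open>D\<close> is unconstrained by \<open>D\<close>, and the only possible reason for its
  absence is inconsistency. This replaces the transfinite enumeration of witnesses. Stability of
  images and unions under pullback shows that witnesses for covers are always consistent, and that of
  the witnesses for the members of a finite cover at least one is (\<open>El_lift_cover\<close>, \<open>El_union\<close>).
\<close>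

section \<open>Subobjects, images and covers\<close>

context category
begin

abbreviation comp (infixr "\<bullet>" 75) where "g \<bullet> f \<equiv> Comp C g f"

lemma homD: "f \<in> hom C x y \<Longrightarrow> f \<in> Ar C \<and> Dom C f = x \<and> Cod C f = y"
  by (simp add: hom_def)

lemma hom_Ob: "f \<in> hom C x y \<Longrightarrow> x \<in> Ob C \<and> y \<in> Ob C"
  using Dom_Ob Cod_Ob by (auto simp: hom_def)

lemma Ar_hom: "f \<in> Ar C \<Longrightarrow> f \<in> hom C (Dom C f) (Cod C f)"
  by (simp add: hom_def)

lemma comp_eq_comp:
  assumes "f \<in> hom C x z" "p \<in> hom C v x" "g \<in> hom C y z" "q \<in> hom C v y" "f \<bullet> p = g \<bullet> q"
    "k \<in> hom C w v"
  shows "f \<bullet> (p \<bullet> k) = g \<bullet> (q \<bullet> k)"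
  using Comp_assoc[OF assms(6,2,1)] Comp_assoc[OF assms(6,4,3)] assms(5) by simp

lemma factors_through_iff:
  "f \<in> hom C w x \<Longrightarrow> m \<in> hom C y x \<Longrightarrow> factors_through C f m \<longleftrightarrow> (\<exists>h\<in>hom C w y. m \<bullet> h = f)"
  by (auto simp: factors_through_def hom_def)

lemma factors_through_refl: "f \<in> hom C x y \<Longrightarrow> factors_through C f f"
  by (metis factors_through_iff Id_hom Comp_Id_right hom_Ob)

lemma factors_through_precomp:
  assumes "factors_through C f m" "f \<in> hom C w x" "m \<in> hom C y x" "g \<in> hom C v w"
  shows "factors_through C (f \<bullet> g) m"
proof -
  obtain h where h: "h \<in> hom C w y" "m \<bullet> h = f"
    using assms(1) factors_through_iff[OF assms(2,3)] by blast
  have "m \<bullet> (h \<bullet> g) = f \<bullet> g" using Comp_assoc[OF assms(4) h(1) assms(3)] h(2) by simp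
  then show ?thesis
    using factors_through_iff[OF Comp_hom[OF assms(4,2)] assms(3)] Comp_hom[OF assms(4) h(1)] by blast
qed

lemma factors_through_trans:
  assumes "factors_through C f m" "factors_through C m n" "f \<in> hom C w x" "m \<in> hom C y x"
    "n \<in> hom C z x"
  shows "factors_through C f n"
proof -
  obtain h where h: "h \<in> hom C w y" "m \<bullet> h = f"
    using assms(1) factors_through_iff[OF assms(3,4)] by blast
  show ?thesis
    using factors_through_precomp[OF assms(2,4,5) h(1)] h(2) by simp
qed

lemma monos_into_hom: "m \<in> monos_into C x \<Longrightarrow> m \<in> hom C (Dom C m) x"
  by (simp add: monos_into_def is_mono_def hom_def)

lemma monos_into_cancel:
  "m \<in> monos_into C x \<Longrightarrow> f \<in> hom C w (Dom C m) \<Longrightarrow> g \<in> hom C w (Dom C m) \<Longrightarrow>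
    m \<bullet> f = m \<bullet> g \<Longrightarrow> f = g"
  by (auto simp: monos_into_def is_mono_def)

lemma monos_intoI:
  assumes "m \<in> hom C y x"
    and "\<And>w f g. f \<in> hom C w y \<Longrightarrow> g \<in> hom C w y \<Longrightarrow> m \<bullet> f = m \<bullet> g \<Longrightarrow> f = g"
  shows "m \<in> monos_into C x"
  using assms by (simp add: monos_into_def is_mono_def hom_def)

lemma Id_mono: "x \<in> Ob C \<Longrightarrow> Id C x \<in> monos_into C x"
  by (rule monos_intoI[OF Id_hom]) (auto simp: Comp_Id_left)

lemma sub_le_Id: "m \<in> monos_into C x \<Longrightarrow> sub_le C m (Id C x)"
  by (metis monos_into_hom hom_Ob Id_hom factors_through_iff Comp_Id_left)

lemma is_pullbackI:
  assumes "f \<in> hom C x z" "g \<in> hom C y z" "p \<in> hom C P x" "q \<in> hom C P y" "f \<bullet> p = g \<bullet> q"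
    and "\<And>w p' q'. p' \<in> hom C w x \<Longrightarrow> q' \<in> hom C w y \<Longrightarrow> f \<bullet> p' = g \<bullet> q' \<Longrightarrow>
        \<exists>!h. h \<in> hom C w P \<and> p \<bullet> h = p' \<and> q \<bullet> h = q'"
  shows "is_pullback C f g p q"
proof -
  have eqs: "Dom C f = x" "Cod C f = z" "Dom C g = y" "Cod C g = z" "Dom C p = P"
    "f \<in> Ar C" "g \<in> Ar C"
    using assms(1-4) by (auto simp: hom_def)
  show ?thesis unfolding is_pullback_def eqs using assms(3-6) eqs by blast
qed

lemma is_pullbackD:
  assumes "is_pullback C f g p q" "f \<in> hom C x z" "g \<in> hom C y z"
  obtains P where "p \<in> hom C P x" "q \<in> hom C P y" "f \<bullet> p = g \<bullet> q"
    "\<And>w p' q'. p' \<in> hom C w x \<Longrightarrow> q' \<in> hom C w y \<Longrightarrow> f \<bullet> p' = g \<bullet> q' \<Longrightarrow>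
        \<exists>!h. h \<in> hom C w P \<and> p \<bullet> h = p' \<and> q \<bullet> h = q'"
proof -
  have "Dom C f = x" "Cod C f = z" "Dom C g = y" "Cod C g = z"
    using assms(2-3) by (auto simp: hom_def)
  with assms(1) show ?thesis
    by (intro that[of "Dom C p"]) (simp_all add: is_pullback_def)
qed

text \<open>
  The lifting property is stated for arbitrary arrows \<open>k\<close>, not only for monomorphisms: \<open>m'\<close> classifies
  the arrows that \<open>g\<close> takes into \<open>m\<close>.
\<close>

lemma is_inv_imageD:
  assumes "is_inv_image C g m m'" "g \<in> hom C y x" "m \<in> monos_into C x"
  shows "m' \<in> monos_into C y" "factors_through C (g \<bullet> m') m"
    "\<And>k w. k \<in> hom C w y \<Longrightarrow> factors_through C (g \<bullet> k) m \<Longrightarrow> factors_through C k m'"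
proof -
  note m = monos_into_hom[OF assms(3)]
  obtain q where "is_pullback C g m m' q" using assms(1) by (auto simp: is_inv_image_def)
  from is_pullbackD[OF this assms(2) m] obtain P where
    P: "m' \<in> hom C P y" "q \<in> hom C P (Dom C m)" "g \<bullet> m' = m \<bullet> q"
    "\<And>w p' q'. p' \<in> hom C w y \<Longrightarrow> q' \<in> hom C w (Dom C m) \<Longrightarrow> g \<bullet> p' = m \<bullet> q' \<Longrightarrow>
        \<exists>!h. h \<in> hom C w P \<and> m' \<bullet> h = p' \<and> q \<bullet> h = q'" by blast
  show "m' \<in> monos_into C y"
  proof (rule monos_intoI[OF P(1)])
    fix w h k assume hk: "h \<in> hom C w P" "k \<in> hom C w P" "m' \<bullet> h = m' \<bullet> k"
    note mh = comp_eq_comp[OF assms(2) P(1) m P(2,3) hk(1)]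
      and mk = comp_eq_comp[OF assms(2) P(1) m P(2,3) hk(2)]
    have "m \<bullet> (q \<bullet> h) = m \<bullet> (q \<bullet> k)" using mh mk hk(3) by simp
    then have "q \<bullet> h = q \<bullet> k"
      using monos_into_cancel[OF assms(3) Comp_hom[OF hk(1) P(2)] Comp_hom[OF hk(2) P(2)]] by simp
    moreover note P(4)[OF Comp_hom[OF hk(1) P(1)] Comp_hom[OF hk(1) P(2)] mh]
    ultimately show "h = k" using hk by metis
  qed
  show "factors_through C (g \<bullet> m') m"
    using factors_through_iff[OF Comp_hom[OF P(1) assms(2)] m] P(2,3) by metis
  show "factors_through C k m'" if k: "k \<in> hom C w y" and "factors_through C (g \<bullet> k) m" for k w
  proof -
    have "\<exists>h\<in>hom C w (Dom C m). m \<bullet> h = g \<bullet> k"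
      using that factors_through_iff[OF Comp_hom[OF k assms(2)] m] by blast
    then obtain h where "h \<in> hom C w (Dom C m)" "g \<bullet> k = m \<bullet> h" by metis
    then show ?thesis using P(4)[OF k] factors_through_iff[OF k P(1)] by blast
  qed
qed

text \<open>
  The regular epimorphisms of a coherent category, characterised by their image.
\<close>

definition cover :: "'m \<Rightarrow> bool" where
  "cover q \<longleftrightarrow> q \<in> Ar C \<and> is_image C q (Id C (Cod C q))"

lemma coverI:
  assumes "q \<in> hom C y x"
    and "\<And>n. n \<in> monos_into C x \<Longrightarrow> factors_through C q n \<Longrightarrow> sub_le C (Id C x) n"
  shows "cover q"
  unfolding cover_def is_image_def
  using assms Id_mono hom_Ob[OF assms(1)] homD[OF assms(1)]
    factors_through_iff[OF assms(1) Id_hom] Comp_Id_left[OF assms(1)] by auto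

lemma coverD:
  "cover q \<Longrightarrow> q \<in> hom C y x \<Longrightarrow> n \<in> monos_into C x \<Longrightarrow> factors_through C q n \<Longrightarrow>
    sub_le C (Id C x) n"
  by (auto simp: cover_def is_image_def hom_def)

lemma cover_Id: "x \<in> Ob C \<Longrightarrow> cover (Id C x)"
  by (rule coverI[OF Id_hom])

text \<open>
  If \<open>e\<close> factors through a subobject \<open>n\<close> of the image, then \<open>f\<close> factors through \<open>m \<bullet> n\<close>, and
  minimality of \<open>m\<close> makes \<open>n\<close> total.
\<close>

lemma image_cover:
  assumes im: "is_image C f m" and f: "f \<in> hom C y x"
  obtains e where "e \<in> hom C y (Dom C m)" "m \<bullet> e = f" "cover e"
proof -
  have m: "m \<in> monos_into C x"
    and fac: "factors_through C f m"
    and least: "\<And>n. n \<in> monos_into C x \<Longrightarrow> factors_through C f n \<Longrightarrow> sub_le C m n"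
    using im homD[OF f] by (auto simp: is_image_def)
  note mh = monos_into_hom[OF m]
  obtain e where e: "e \<in> hom C y (Dom C m)" "m \<bullet> e = f"
    using fac factors_through_iff[OF f mh] by blast
  have "cover e"
  proof (rule coverI[OF e(1)])
    fix n assume n: "n \<in> monos_into C (Dom C m)" and en: "factors_through C e n"
    note nh = monos_into_hom[OF n]
    obtain k where k: "k \<in> hom C y (Dom C n)" "n \<bullet> k = e"
      using en factors_through_iff[OF e(1) nh] by blast
    have mn: "m \<bullet> n \<in> hom C (Dom C n) x" using Comp_hom[OF nh mh] .
    have mono: "m \<bullet> n \<in> monos_into C x"
    proof (rule monos_intoI[OF mn])
      fix w s t assume st: "s \<in> hom C w (Dom C n)" "t \<in> hom C w (Dom C n)"
        "(m \<bullet> n) \<bullet> s = (m \<bullet> n) \<bullet> t"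
      then have "m \<bullet> (n \<bullet> s) = m \<bullet> (n \<bullet> t)" by (metis Comp_assoc mh nh)
      then have "n \<bullet> s = n \<bullet> t"
        using monos_into_cancel[OF m] Comp_hom nh st by blast
      then show "s = t" using monos_into_cancel[OF n] st by blast
    qed
    have "(m \<bullet> n) \<bullet> k = f" by (metis Comp_assoc k e(2) mh nh)
    then have "factors_through C f (m \<bullet> n)"
      using factors_through_iff[OF f mn] k by blast
    from least[OF mono this] obtain h where h: "h \<in> hom C (Dom C m) (Dom C n)" "(m \<bullet> n) \<bullet> h = m"
      using factors_through_iff[OF mh mn] by blast
    then have "m \<bullet> (n \<bullet> h) = m \<bullet> Id C (Dom C m)"
      by (metis Comp_assoc mh nh Comp_Id_right)
    then have "n \<bullet> h = Id C (Dom C m)"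
      using monos_into_cancel[OF m] Comp_hom[OF h(1) nh] Id_hom hom_Ob[OF mh] by blast
    then show "sub_le C (Id C (Dom C m)) n"
      using factors_through_iff[OF Id_hom nh] h hom_Ob[OF mh] by blast
  qed
  then show ?thesis using that e by blast
qed

end

context coherent_category
begin

lemma ex_terminal: "\<exists>t. is_terminal C t"
proof -
  have "finite_diagram C {} (\<lambda>_. undefined) {}" by (simp add: finite_diagram_def)
  from finite_limits[OF this] obtain c p where l: "is_limit C {} (\<lambda>_. undefined) {} c p" by blast
  have "\<exists>!f. f \<in> hom C x c" if "x \<in> Ob C" for x
  proof -
    have "is_cone C {} (\<lambda>_. undefined) {} x p" using that by (simp add: is_cone_def)
    with l show ?thesis by (auto simp: is_limit_def)
  qed
  moreover have "c \<in> Ob C" using l by (simp add: is_limit_def is_cone_def)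
  ultimately show ?thesis unfolding is_terminal_def by blast
qed

lemma ex_equalizer:
  assumes f: "f \<in> hom C x y" and g: "g \<in> hom C x y"
  obtains m where "m \<in> monos_into C x" "f \<bullet> m = g \<bullet> m"
proof -
  define X where "X = (\<lambda>i::nat. if i = 0 then x else y)"
  define E where "E = {(0::nat, f, 1::nat), (0, g, 1)}"
  have "finite_diagram C {0,1} X E"
    using hom_Ob[OF f] f g by (auto simp: finite_diagram_def X_def E_def)
  from finite_limits[OF this] obtain c p where l: "is_limit C {0,1} X E c p" by blast
  then have p: "p 0 \<in> hom C c x" "f \<bullet> p 0 = p 1" "g \<bullet> p 0 = p 1"
    by (auto simp: is_limit_def is_cone_def X_def E_def)
  have uni: "\<exists>!h. h \<in> hom C w c \<and> p 0 \<bullet> h = k" if k: "k \<in> hom C w x" "f \<bullet> k = g \<bullet> k" for w k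
  proof -
    have "is_cone C {0,1} X E w (\<lambda>i. if i = 0 then k else f \<bullet> k)"
      using k hom_Ob[OF k(1)] Comp_hom[OF k(1) f] by (auto simp: is_cone_def X_def E_def)
    then have "\<exists>!h. h \<in> hom C w c \<and> (\<forall>i\<in>{0,1}. p i \<bullet> h = (if i = 0 then k else f \<bullet> k))"
      using l unfolding is_limit_def by blast
    moreover have "p 1 \<bullet> h = f \<bullet> k" if "h \<in> hom C w c" "p 0 \<bullet> h = k" for h
      using that p f Comp_assoc by metis
    ultimately show ?thesis by auto
  qed
  have m: "p 0 \<in> monos_into C x"
  proof (rule monos_intoI[OF p(1)])
    fix w s t assume st: "s \<in> hom C w c" "t \<in> hom C w c" "p 0 \<bullet> s = p 0 \<bullet> t"
    have "f \<bullet> (p 0 \<bullet> s) = g \<bullet> (p 0 \<bullet> s)" using Comp_assoc[OF st(1) p(1)] f g p(2,3) by metis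
    then show "s = t" using uni[of "p 0 \<bullet> s" w] st Comp_hom p(1) by metis
  qed
  show ?thesis
    using that[OF m] p(2,3) by simp
qed

lemma ex_pullback:
  assumes f: "f \<in> hom C x z" and g: "g \<in> hom C y z"
  obtains P p q where "p \<in> hom C P x" "q \<in> hom C P y" "f \<bullet> p = g \<bullet> q" "is_pullback C f g p q"
    "\<And>w p' q'. p' \<in> hom C w x \<Longrightarrow> q' \<in> hom C w y \<Longrightarrow> f \<bullet> p' = g \<bullet> q' \<Longrightarrow>
        \<exists>h\<in>hom C w P. p \<bullet> h = p' \<and> q \<bullet> h = q'"
proof -
  define X where "X = (\<lambda>i::nat. if i = 0 then x else if i = 1 then y else z)"
  define E where "E = {(0::nat, f, 2::nat), (1, g, 2)}"
  have "finite_diagram C {0,1,2} X E"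
    using hom_Ob[OF f] hom_Ob[OF g] f g by (auto simp: finite_diagram_def X_def E_def)
  from finite_limits[OF this] obtain c p where l: "is_limit C {0,1,2} X E c p" by blast
  then have p: "p 0 \<in> hom C c x" "p 1 \<in> hom C c y" "f \<bullet> p 0 = p 2" "g \<bullet> p 1 = p 2"
    by (auto simp: is_limit_def is_cone_def X_def E_def)
  have uni: "\<exists>!h. h \<in> hom C w c \<and> p 0 \<bullet> h = p' \<and> p 1 \<bullet> h = q'"
    if k: "p' \<in> hom C w x" "q' \<in> hom C w y" "f \<bullet> p' = g \<bullet> q'" for w p' q'
  proof -
    have "is_cone C {0,1,2} X E w (\<lambda>i. if i = 0 then p' else if i = 1 then q' else f \<bullet> p')"
      using k hom_Ob[OF k(1)] Comp_hom[OF k(1) f] by (auto simp: is_cone_def X_def E_def)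
    then have "\<exists>!h. h \<in> hom C w c \<and>
        (\<forall>i\<in>{0,1,2}. p i \<bullet> h = (if i = 0 then p' else if i = 1 then q' else f \<bullet> p'))"
      using l unfolding is_limit_def by blast
    moreover have "p 2 \<bullet> h = f \<bullet> p'" if "h \<in> hom C w c" "p 0 \<bullet> h = p'" for h
      using that p f Comp_assoc by metis
    ultimately show ?thesis by auto
  qed
  have e: "f \<bullet> p 0 = g \<bullet> p 1" using p by simp
  have "is_pullback C f g (p 0) (p 1)"
    by (rule is_pullbackI[OF f g p(1,2) e uni])
  then show ?thesis using that[OF p(1,2) e] uni by metis
qed

text \<open>
  The pullback of the arrows to a terminal object; its projections are jointly monic.
\<close>

lemma ex_product:
  assumes x: "x \<in> Ob C" and y: "y \<in> Ob C"
  obtains P p q where "p \<in> hom C P x" "q \<in> hom C P y"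
    "\<And>w f g. f \<in> hom C w P \<Longrightarrow> g \<in> hom C w P \<Longrightarrow> p \<bullet> f = p \<bullet> g \<Longrightarrow> q \<bullet> f = q \<bullet> g \<Longrightarrow> f = g"
proof -
  obtain t where "is_terminal C t" using ex_terminal by blast
  then obtain f g where f: "f \<in> hom C x t" and g: "g \<in> hom C y t"
    and t: "\<And>w h k. h \<in> hom C w t \<Longrightarrow> k \<in> hom C w t \<Longrightarrow> h = k"
    using x y hom_Ob unfolding is_terminal_def by metis
  obtain P p q where P: "p \<in> hom C P x" "q \<in> hom C P y" "is_pullback C f g p q"
    using ex_pullback[OF f g] by metis
  show ?thesis
  proof (rule that[OF P(1,2)])
    fix w h k assume hk: "h \<in> hom C w P" "k \<in> hom C w P" "p \<bullet> h = p \<bullet> k" "q \<bullet> h = q \<bullet> k"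
    note ph = Comp_hom[OF hk(1) P(1)] and qh = Comp_hom[OF hk(1) P(2)]
    have "f \<bullet> (p \<bullet> h) = g \<bullet> (q \<bullet> h)"
      using t[OF Comp_hom[OF ph f] Comp_hom[OF qh g]] .
    moreover have "p \<in> hom C (Dom C p) x" using homD[OF P(1)] P(1) by simp
    ultimately have "\<exists>!l. l \<in> hom C w P \<and> p \<bullet> l = p \<bullet> h \<and> q \<bullet> l = q \<bullet> h"
      using P(3) ph qh homD[OF f] homD[OF g] homD[OF P(1)] unfolding is_pullback_def by simp
    then show "h = k" using hk by metis
  qed
qed

lemma ex_inv_image:
  assumes g: "g \<in> hom C y x" and m: "m \<in> monos_into C x"
  obtains m' where "is_inv_image C g m m'"
  using ex_pullback[OF g monos_into_hom[OF m]] unfolding is_inv_image_def by metis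

text \<open>
  This is stability of images for the image \<open>Id C x\<close>, whose inverse images are identities.
\<close>

lemma pullback_cover:
  assumes q: "cover q" and g: "g \<in> hom C y x" "q \<in> hom C z x" and pb: "is_pullback C g q r p"
  shows "cover r"
proof -
  obtain P where r: "r \<in> hom C P y" using is_pullbackD[OF pb g] by metis
  have im: "is_image C q (Id C x)" using q homD[OF g(2)] by (simp add: cover_def)
  have Ob: "x \<in> Ob C" "y \<in> Ob C" using hom_Ob[OF g(1)] by auto
  have "is_pullback C g (Id C x) (Id C y) g"
  proof (rule is_pullbackI[OF g(1) Id_hom[OF Ob(1)] Id_hom[OF Ob(2)] g(1)])
    show "g \<bullet> Id C y = Id C x \<bullet> g" by (simp add: Comp_Id_left[OF g(1)] Comp_Id_right[OF g(1)])
    fix w p' q' assume a: "p' \<in> hom C w y" "q' \<in> hom C w x" "g \<bullet> p' = Id C x \<bullet> q'"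
    then show "\<exists>!h. h \<in> hom C w y \<and> Id C y \<bullet> h = p' \<and> g \<bullet> h = q'"
      by (metis Comp_Id_left)
  qed
  then have "is_image C r (Id C y)"
    using images_stable[OF im pb] by (auto simp: is_inv_image_def)
  then show ?thesis using homD[OF r] by (simp add: cover_def)
qed

lemma ex_cover_pullback:
  assumes e: "e \<in> hom C y z" "cover e" and f: "f \<in> hom C x z"
  obtains P q g where "q \<in> hom C P x" "cover q" "g \<in> hom C P y" "f \<bullet> q = e \<bullet> g"
proof -
  obtain P p q where "p \<in> hom C P x" "q \<in> hom C P y" "f \<bullet> p = e \<bullet> q" "is_pullback C f e p q"
    using ex_pullback[OF f e(1)] by metis
  then show ?thesis using that pullback_cover[OF e(2) f e(1)] by metis
qed

lemma factors_through_if_total_inv_image: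
  assumes n: "is_inv_image C f b n" and f: "f \<in> hom C x z" and b: "b \<in> monos_into C z"
    and tot: "sub_le C (Id C x) n"
  shows "factors_through C f b"
proof -
  note n' = is_inv_imageD(1,2)[OF n f b]
  have nh: "n \<in> hom C (Dom C n) x" using monos_into_hom[OF n'(1)] .
  obtain h where h: "h \<in> hom C x (Dom C n)" "n \<bullet> h = Id C x"
    using tot factors_through_iff[OF Id_hom nh] hom_Ob[OF f] by blast
  have "f \<bullet> n \<bullet> h = f" using h(2) f Comp_Id_right by simp
  then have "(f \<bullet> n) \<bullet> h = f" using Comp_assoc[OF h(1) nh f] by simp
  then show ?thesis
    using factors_through_precomp[OF n'(2) Comp_hom[OF nh f] monos_into_hom[OF b] h(1)] by simp
qed

text \<open>
  The inverse image of \<open>b\<close> along \<open>f\<close> is a subobject through which the cover \<open>q\<close> factors, so it is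
  total.
\<close>

lemma factors_through_cover:
  assumes q: "q \<in> hom C y x" "cover q" and f: "f \<in> hom C x z" and b: "b \<in> monos_into C z"
    and fac: "factors_through C (f \<bullet> q) b"
  shows "factors_through C f b"
proof -
  obtain n where n: "is_inv_image C f b n" using ex_inv_image[OF f b] .
  note n' = is_inv_imageD[OF n f b]
  have "sub_le C (Id C x) n" using coverD[OF q(2,1) n'(1)] n'(3)[OF q(1) fac] by blast
  then show ?thesis using factors_through_if_total_inv_image[OF n f b] by blast
qed

section \<open>The strict initial object\<close>

text \<open>
  An object all of whose subobjects are total. In a coherent category this means being initial
  (\<open>initial_iff_void\<close>); unlike the universal property, this form is visibly inherited along arrows,
  because it says that the identity is an empty union and empty unions are stable under pullback.
\<close>

definition void :: "'o \<Rightarrow> bool" where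
  "void z \<longleftrightarrow> z \<in> Ob C \<and> (\<forall>n\<in>monos_into C z. sub_le C (Id C z) n)"

lemma void_iff_union: "void z \<longleftrightarrow> z \<in> Ob C \<and> is_union C z {} (Id C z)"
  using Id_mono by (auto simp: void_def is_union_def)

text \<open>
  The inverse image of the monomorphism \<open>m\<close> along \<open>m \<bullet> f\<close> is the identity of \<open>y\<close>, and it is the
  empty union by stability.
\<close>

lemma void_if_arrow_to_bottom:
  assumes m: "is_union C x {} m" and f: "f \<in> hom C y (Dom C m)"
  shows "void y"
proof -
  have mono: "m \<in> monos_into C x" using m by (simp add: is_union_def)
  note mh = monos_into_hom[OF mono]
  have y: "y \<in> Ob C" using hom_Ob[OF f] by simp
  note mf = Comp_hom[OF f mh]
  have "is_pullback C (m \<bullet> f) m (Id C y) f"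
  proof (rule is_pullbackI[OF mf mh Id_hom[OF y] f])
    show "(m \<bullet> f) \<bullet> Id C y = m \<bullet> f" using Comp_Id_right[OF mf] .
    fix w p' q' assume a: "p' \<in> hom C w y" "q' \<in> hom C w (Dom C m)" "(m \<bullet> f) \<bullet> p' = m \<bullet> q'"
    have "m \<bullet> (f \<bullet> p') = m \<bullet> q'" using Comp_assoc[OF a(1) f mh] a(3) by simp
    then have "f \<bullet> p' = q'" using monos_into_cancel[OF mono Comp_hom[OF a(1) f] a(2)] by simp
    then show "\<exists>!h. h \<in> hom C w y \<and> Id C y \<bullet> h = p' \<and> f \<bullet> h = q'"
      using a(1) Comp_Id_left by metis
  qed
  then have "is_inv_image C (m \<bullet> f) m (Id C y)" by (auto simp: is_inv_image_def)
  \<comment> \<open>The family of inverse images of the members of the empty set is arbitrary.\<close>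
  from finite_unions_stable[OF _ _ m mf _ this] have "is_union C y ((\<lambda>_. undefined) ` {}) (Id C y)"
    by simp
  then show ?thesis using y by (simp add: void_iff_union)
qed

lemma void_strict:
  assumes z: "void z" and f: "f \<in> hom C y z"
  shows "void y"
proof (rule void_if_arrow_to_bottom)
  show "is_union C z {} (Id C z)" using z by (simp add: void_iff_union)
  show "f \<in> hom C y (Dom C (Id C z))" using f homD[OF Id_hom] hom_Ob[OF f] by simp
qed

text \<open>
  The equalizer of \<open>f\<close> and \<open>g\<close> is a subobject of a void object, hence total.
\<close>

lemma void_unique:
  assumes z: "void z" and fg: "f \<in> hom C z x" "g \<in> hom C z x"
  shows "f = g"
proof -
  obtain m where m: "m \<in> monos_into C z" "f \<bullet> m = g \<bullet> m" using ex_equalizer[OF fg] by metis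
  note mh = monos_into_hom[OF m(1)]
  obtain h where h: "h \<in> hom C z (Dom C m)" "m \<bullet> h = Id C z"
    using z m(1) factors_through_iff[OF Id_hom mh] unfolding void_def by metis
  have "f \<bullet> (m \<bullet> h) = g \<bullet> (m \<bullet> h)" using comp_eq_comp[OF fg(1) mh fg(2) mh m(2) h(1)] .
  then show ?thesis using h(2) Comp_Id_right[OF fg(1)] Comp_Id_right[OF fg(2)] by simp
qed

text \<open>
  Objects over a void object are void, so any two parallel arrows into \<open>z \<times> x\<close> agree. Thus the
  projection to \<open>z\<close> is monic, hence total, and a section of it followed by the other projection is
  an arrow to \<open>x\<close>.
\<close>

lemma void_initial:
  assumes z: "void z" shows "is_initial C z"
proof -
  have zO: "z \<in> Ob C" using z by (simp add: void_def)
  have "\<exists>!f. f \<in> hom C z x" if x: "x \<in> Ob C" for x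
  proof -
    obtain P p q where P: "p \<in> hom C P z" "q \<in> hom C P x"
      using ex_product[OF zO x] by metis
    have "p \<in> monos_into C z"
    proof (rule monos_intoI[OF P(1)])
      fix w f g assume "f \<in> hom C w P" "g \<in> hom C w P" "p \<bullet> f = p \<bullet> g"
      then show "f = g" using void_unique void_strict[OF z] Comp_hom P(1) by blast
    qed
    then obtain h where "h \<in> hom C z P"
      using z factors_through_iff[OF Id_hom[OF zO] P(1)] by (auto simp: void_def)
    then have "q \<bullet> h \<in> hom C z x" using Comp_hom P(2) by blast
    then show ?thesis using void_unique[OF z] by blast
  qed
  then show ?thesis using zO by (simp add: is_initial_def)
qed

lemma initial_iff_void: "is_initial C z \<longleftrightarrow> void z"
proof
  assume z: "is_initial C z"
  then have zO: "z \<in> Ob C" and ex: "\<And>x. x \<in> Ob C \<Longrightarrow> \<exists>!f. f \<in> hom C z x"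
    by (auto simp: is_initial_def)
  have "sub_le C (Id C z) n" if n: "n \<in> monos_into C z" for n
  proof -
    note nh = monos_into_hom[OF n]
    obtain h where h: "h \<in> hom C z (Dom C n)" using ex hom_Ob[OF nh] by blast
    then have "n \<bullet> h = Id C z" using ex[OF zO] Comp_hom[OF h nh] Id_hom[OF zO] by blast
    then show ?thesis using h factors_through_iff[OF Id_hom[OF zO] nh] by blast
  qed
  then show "void z" using zO by (simp add: void_def)
qed (rule void_initial)

lemma initial_strict: "is_initial C z \<Longrightarrow> f \<in> hom C y z \<Longrightarrow> is_initial C y"
  using void_strict initial_iff_void by blast

lemma ex_bottom:
  assumes "x \<in> Ob C"
  obtains m where "m \<in> monos_into C x" "is_initial C (Dom C m)"
    "\<And>n. n \<in> monos_into C x \<Longrightarrow> sub_le C m n"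
proof -
  obtain m where m: "is_union C x {} m" using finite_unions[OF assms] by blast
  then have mono: "m \<in> monos_into C x" by (simp add: is_union_def)
  then have "void (Dom C m)"
    using void_if_arrow_to_bottom[OF m Id_hom] hom_Ob[OF monos_into_hom] by blast
  then show ?thesis using that[OF mono] m initial_iff_void by (auto simp: is_union_def)
qed

text \<open>
  An arrow from an initial object factors through the bottom subobject of its codomain; a cover that
  does so makes the bottom subobject total.
\<close>

lemma cover_from_initial:
  assumes q: "q \<in> hom C y x" "cover q" and y: "is_initial C y"
  shows "is_initial C x"
proof -
  have xO: "x \<in> Ob C" using hom_Ob[OF q(1)] by simp
  obtain m where m: "m \<in> monos_into C x" "is_initial C (Dom C m)" using ex_bottom[OF xO] .
  note mh = monos_into_hom[OF m(1)]
  obtain h where h: "h \<in> hom C y (Dom C m)" using y hom_Ob[OF mh] by (auto simp: is_initial_def)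
  have "m \<bullet> h = q" using y xO Comp_hom[OF h mh] q(1) unfolding is_initial_def by blast
  then have "sub_le C (Id C x) m"
    using coverD[OF q(2,1) m(1)] factors_through_iff[OF q(1) mh] h by blast
  then obtain k where "k \<in> hom C x (Dom C m)"
    using factors_through_iff[OF Id_hom[OF xO] mh] by blast
  then show ?thesis using initial_strict[OF m(2)] by blast
qed

end

section \<open>The category of sets\<close>

abbreviation app :: "'u set_map \<Rightarrow> 'u \<Rightarrow> 'u" where
  "app F \<equiv> fst (snd F)"

lemma hom_set_cat: "F \<in> hom set_cat A B \<longleftrightarrow> (\<exists>f\<in>A \<rightarrow>\<^sub>E B. F = (A, f, B))"
  by (cases F) (auto simp: hom_def set_cat_def)

lemma app_mem: "F \<in> hom set_cat A B \<Longrightarrow> \<xi> \<in> A \<Longrightarrow> app F \<xi> \<in> B"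
  by (auto simp: hom_set_cat)

lemma set_map_eqI:
  "F \<in> hom set_cat A B \<Longrightarrow> G \<in> hom set_cat A B \<Longrightarrow> (\<And>\<xi>. \<xi> \<in> A \<Longrightarrow> app F \<xi> = app G \<xi>) \<Longrightarrow> F = G"
  by (auto simp: hom_set_cat intro: PiE_ext)

lemma app_Comp:
  "F \<in> hom set_cat A B \<Longrightarrow> G \<in> hom set_cat B B' \<Longrightarrow> \<xi> \<in> A \<Longrightarrow>
    app (Comp set_cat G F) \<xi> = app G (app F \<xi>)"
  by (auto simp: hom_set_cat) (simp add: set_cat_def compose_def)

lemma map_range_eq: "F \<in> hom set_cat A B \<Longrightarrow> map_range F = app F ` A"
  by (auto simp: hom_set_cat map_range_def)

lemma restrict_hom_set_cat: "f \<in> A \<rightarrow> B \<Longrightarrow> (A, restrict f A, B) \<in> hom set_cat A B"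
  by (simp add: hom_set_cat)

lemma monos_into_set_cat_iff:
  fixes F :: "'u set_map"
  assumes F: "F \<in> hom set_cat A B"
  shows "F \<in> monos_into set_cat B \<longleftrightarrow> inj_on (app F) A"
proof -
  interpret S: category set_cat by (rule category_set_cat)
  show ?thesis
  proof
    assume m: "F \<in> monos_into set_cat B"
    show "inj_on (app F) A"
    proof (rule inj_onI)
      fix \<xi> \<zeta> assume xz: "\<xi> \<in> A" "\<zeta> \<in> A" "app F \<xi> = app F \<zeta>"
      define k where "k = (\<lambda>\<alpha>::'u. ({\<xi>}, restrict (\<lambda>_. \<alpha>) {\<xi>}, A))"
      have k: "k \<xi> \<in> hom set_cat {\<xi>} A" "k \<zeta> \<in> hom set_cat {\<xi>} A"
        using xz by (auto simp: k_def intro!: restrict_hom_set_cat)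
      have "Comp set_cat F (k \<xi>) = Comp set_cat F (k \<zeta>)"
        by (rule set_map_eqI[OF S.Comp_hom[OF k(1) F] S.Comp_hom[OF k(2) F]])
          (use xz app_Comp[OF k(1) F] app_Comp[OF k(2) F] in \<open>auto simp: k_def\<close>)
      then have "k \<xi> = k \<zeta>"
        using S.monos_into_cancel[OF m] k F S.homD by metis
      then have "app (k \<xi>) \<xi> = app (k \<zeta>) \<xi>" by simp
      then show "\<xi> = \<zeta>" by (simp add: k_def)
    qed
  next
    assume inj: "inj_on (app F) A"
    show "F \<in> monos_into set_cat B"
    proof (rule S.monos_intoI[OF F])
      fix W f g assume fg: "f \<in> hom set_cat W A" "g \<in> hom set_cat W A"
        "Comp set_cat F f = Comp set_cat F g"
      show "f = g"
      proof (rule set_map_eqI[OF fg(1,2)])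
        fix \<xi> assume \<xi>: "\<xi> \<in> W"
        have "app F (app f \<xi>) = app F (app g \<xi>)"
          using app_Comp[OF fg(1) F \<xi>] app_Comp[OF fg(2) F \<xi>] fg(3) by simp
        then show "app f \<xi> = app g \<xi>"
          using inj app_mem[OF fg(1) \<xi>] app_mem[OF fg(2) \<xi>] by (auto dest: inj_onD)
      qed
    qed
  qed
qed

lemma factors_through_set_cat_iff:
  assumes F: "F \<in> hom set_cat A B" and G: "G \<in> hom set_cat A' B"
  shows "factors_through set_cat F G \<longleftrightarrow> app F ` A \<subseteq> app G ` A'"
proof -
  interpret S: category set_cat by (rule category_set_cat)
  show ?thesis
  proof
    assume "factors_through set_cat F G"
    then obtain h where h: "h \<in> hom set_cat A A'" "Comp set_cat G h = F"
      using S.factors_through_iff[OF F G] by blast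
    then show "app F ` A \<subseteq> app G ` A'"
      using app_Comp[OF h(1) G] app_mem[OF h(1)] by auto
  next
    assume sub: "app F ` A \<subseteq> app G ` A'"
    define k where "k = (\<lambda>\<xi>. SOME \<zeta>. \<zeta> \<in> A' \<and> app G \<zeta> = app F \<xi>)"
    have k: "k \<xi> \<in> A' \<and> app G (k \<xi>) = app F \<xi>" if "\<xi> \<in> A" for \<xi>
      unfolding k_def by (rule someI_ex) (use sub that in force)
    then have h: "(A, restrict k A, A') \<in> hom set_cat A A'"
      by (auto intro!: restrict_hom_set_cat)
    have "Comp set_cat G (A, restrict k A, A') = F"
      by (rule set_map_eqI[OF S.Comp_hom[OF h G] F]) (use k app_Comp[OF h G] in auto)
    then show "factors_through set_cat F G"
      using S.factors_through_iff[OF F G] h by blast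
  qed
qed

text \<open>
  Limits of sets are recognised elementwise: points of \<open>L\<close> correspond to compatible families.
\<close>

lemma set_limitI:
  assumes P: "\<And>i. i \<in> V \<Longrightarrow> P i \<in> hom set_cat L (Y i)"
    and comm: "\<And>i F j. (i, F, j) \<in> E \<Longrightarrow> i \<in> V \<and> j \<in> V \<and> F \<in> hom set_cat (Y i) (Y j) \<and>
        (\<forall>l\<in>L. app F (app (P i) l) = app (P j) l)"
    and ex: "\<And>y. (\<And>i. i \<in> V \<Longrightarrow> y i \<in> Y i) \<Longrightarrow>
        (\<And>i F j. (i, F, j) \<in> E \<Longrightarrow> app F (y i) = y j) \<Longrightarrow>
        \<exists>l\<in>L. \<forall>i\<in>V. app (P i) l = y i"
    and uniq: "\<And>l l'. l \<in> L \<Longrightarrow> l' \<in> L \<Longrightarrow> (\<And>i. i \<in> V \<Longrightarrow> app (P i) l = app (P i) l') \<Longrightarrow> l = l'"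
  shows "is_limit set_cat V Y E L P"
proof -
  interpret S: category set_cat by (rule category_set_cat)
  have "Comp set_cat F (P i) = P j" if e: "(i, F, j) \<in> E" for i F j
  proof -
    note c = comm[OF e]
    have F: "F \<in> hom set_cat (Y i) (Y j)" and i: "i \<in> V" and j: "j \<in> V" using c by auto
    show ?thesis
      by (rule set_map_eqI[OF S.Comp_hom[OF P[OF i] F] P[OF j]])
        (use c app_Comp[OF P[OF i] F] in auto)
  qed
  then have cone: "is_cone set_cat V Y E L P"
    using P by (auto simp: is_cone_def set_cat_def)
  have "\<exists>!h. h \<in> hom set_cat W L \<and> (\<forall>i\<in>V. Comp set_cat (P i) h = Q i)"
    if Q: "is_cone set_cat V Y E W Q" for W Q
  proof -
    have Qh: "Q i \<in> hom set_cat W (Y i)" if "i \<in> V" for i using Q that by (simp add: is_cone_def)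
    have Qc: "Comp set_cat F (Q i) = Q j" if "(i, F, j) \<in> E" for i F j
      using Q that by (auto simp: is_cone_def)
    have ex1: "\<exists>l. l \<in> L \<and> (\<forall>i\<in>V. app (P i) l = app (Q i) w)" if w: "w \<in> W" for w
    proof -
      have "app F (app (Q i) w) = app (Q j) w" if e: "(i, F, j) \<in> E" for i F j
        using app_Comp[OF Qh _ w, of i F "Y j"] comm[OF e] Qc[OF e] by simp
      with ex[of "\<lambda>i. app (Q i) w"] app_mem[OF Qh w] show ?thesis by blast
    qed
    define k where "k = (\<lambda>w. SOME l. l \<in> L \<and> (\<forall>i\<in>V. app (P i) l = app (Q i) w))"
    have k: "k w \<in> L \<and> (\<forall>i\<in>V. app (P i) (k w) = app (Q i) w)" if "w \<in> W" for w
      unfolding k_def by (rule someI_ex[OF ex1[OF that]])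
    have h: "(W, restrict k W, L) \<in> hom set_cat W L"
      by (intro restrict_hom_set_cat) (use k in auto)
    have h2: "Comp set_cat (P i) (W, restrict k W, L) = Q i" if i: "i \<in> V" for i
      by (rule set_map_eqI[OF S.Comp_hom[OF h P[OF i]] Qh[OF i]])
        (use k i app_Comp[OF h P[OF i]] in auto)
    show ?thesis
    proof (intro ex1I[of _ "(W, restrict k W, L)"] conjI ballI h h2)
      fix g assume g: "g \<in> hom set_cat W L \<and> (\<forall>i\<in>V. Comp set_cat (P i) g = Q i)"
      then have gh: "g \<in> hom set_cat W L" by simp
      show "g = (W, restrict k W, L)"
      proof (rule set_map_eqI[OF gh h])
        fix w assume w: "w \<in> W"
        have "app (P i) (app g w) = app (P i) (k w)" if i: "i \<in> V" for i
          using app_Comp[OF gh P[OF i] w] g k[OF w] i by auto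
        then have "app g w = k w"
          using uniq app_mem[OF gh w] k[OF w] by blast
        then show "app g w = app (W, restrict k W, L) w" using w by simp
      qed
    qed
  qed
  with cone show ?thesis by (simp add: is_limit_def)
qed

text \<open>
  A compatible family is a cone whose vertex is a singleton.
\<close>

lemma set_limitD:
  assumes lim: "is_limit set_cat V Y E L P"
    and Ehom: "\<And>i F j. (i, F, j) \<in> E \<Longrightarrow> i \<in> V \<and> j \<in> V \<and> F \<in> hom set_cat (Y i) (Y j)"
    and y: "\<And>i. i \<in> V \<Longrightarrow> y i \<in> Y i" "\<And>i F j. (i, F, j) \<in> E \<Longrightarrow> app F (y i) = y j"
  shows "\<exists>!l. l \<in> L \<and> (\<forall>i\<in>V. app (P i) l = y i)"
proof -
  interpret S: category set_cat by (rule category_set_cat)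
  have P: "P i \<in> hom set_cat L (Y i)" if "i \<in> V" for i
    using lim that by (auto simp: is_limit_def is_cone_def)
  define W where "W = {undefined :: 'a}"
  define Q where "Q = (\<lambda>i. (W, restrict (\<lambda>_. y i) W, Y i))"
  have Q: "Q i \<in> hom set_cat W (Y i)" if "i \<in> V" for i
    unfolding Q_def by (rule restrict_hom_set_cat) (use y(1)[OF that] in auto)
  have "Comp set_cat F (Q i) = Q j" if e: "(i, F, j) \<in> E" for i F j
  proof -
    have F: "F \<in> hom set_cat (Y i) (Y j)" and i: "i \<in> V" and j: "j \<in> V" using Ehom[OF e] by auto
    show ?thesis
      by (rule set_map_eqI[OF S.Comp_hom[OF Q[OF i] F] Q[OF j]])
        (use y(2)[OF e] app_Comp[OF Q[OF i] F] in \<open>auto simp: Q_def\<close>)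
  qed
  then have "is_cone set_cat V Y E W Q"
    using Q by (auto simp: is_cone_def set_cat_def)
  then obtain h where h: "h \<in> hom set_cat W L" "\<And>i. i \<in> V \<Longrightarrow> Comp set_cat (P i) h = Q i"
    and hu: "\<And>g. g \<in> hom set_cat W L \<Longrightarrow> (\<And>i. i \<in> V \<Longrightarrow> Comp set_cat (P i) g = Q i) \<Longrightarrow> g = h"
    using lim unfolding is_limit_def by metis
  have u: "undefined \<in> W" by (simp add: W_def)
  show ?thesis
  proof (intro ex1I[of _ "app h undefined"] conjI ballI)
    show "app h undefined \<in> L" using app_mem[OF h(1) u] .
    show "app (P i) (app h undefined) = y i" if i: "i \<in> V" for i
      using app_Comp[OF h(1) P[OF i] u] h(2)[OF i] by (simp add: Q_def W_def)
    fix l assume l: "l \<in> L \<and> (\<forall>i\<in>V. app (P i) l = y i)"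
    have g: "(W, restrict (\<lambda>_. l) W, L) \<in> hom set_cat W L"
      by (rule restrict_hom_set_cat) (use l in auto)
    have "Comp set_cat (P i) (W, restrict (\<lambda>_. l) W, L) = Q i" if i: "i \<in> V" for i
      by (rule set_map_eqI[OF S.Comp_hom[OF g P[OF i]] Q[OF i]])
        (use l i app_Comp[OF g P[OF i]] in \<open>auto simp: Q_def\<close>)
    from hu[OF g this] show "l = app h undefined" by (auto simp: W_def)
  qed
qed

section \<open>Diagrams of named generic elements\<close>

text \<open>
  A node names a generic element of an object. An edge \<open>(f, v)\<close> of \<open>w\<close> is the requirement that \<open>f\<close>
  takes the element named \<open>w\<close> to the one named \<open>v\<close>. All requirements on \<open>w\<close> concerning earlier nodes
  are part of its name; hence a set of nodes determines a diagram, and a node outside the set is not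
  yet subject to any condition coming from the set.
\<close>

datatype ('o, 'm) node = Node (ob: 'o) (edges: "('m \<times> ('o, 'm) node) list")

text \<open>
  The nodes that an element of \<open>s\<close> refers to are in \<open>s\<close>, and all edges are well typed.
\<close>

definition node_closed :: "('o, 'm) cat \<Rightarrow> ('o, 'm) node set \<Rightarrow> bool" where
  "node_closed C s \<longleftrightarrow>
     (\<forall>w\<in>s. ob w \<in> Ob C \<and> (\<forall>(f, v)\<in>set (edges w). v \<in> s \<and> f \<in> hom C (ob w) (ob v)))"

text \<open>
  A cone with vertex \<open>c\<close> is an interpretation of the names in \<open>s\<close> by generalised elements at stage
  \<open>c\<close>.
\<close>

definition cone_on :: "('o, 'm) cat \<Rightarrow> ('o, 'm) node set \<Rightarrow> 'o \<Rightarrow> (('o, 'm) node \<Rightarrow> 'm) \<Rightarrow> bool"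
  where
  "cone_on C s c p \<longleftrightarrow> c \<in> Ob C \<and>
     (\<forall>w\<in>s. p w \<in> hom C c (ob w) \<and> (\<forall>(f, v)\<in>set (edges w). Comp C f (p w) = p v))"

text \<open>
  The requirements in \<open>s\<close> entail that the image under \<open>a\<close> of the element named by the root \<open>r\<close>
  belongs to the subobject \<open>b\<close>. Quantifying over all cones avoids a choice of limit.
\<close>

definition forces ::
  "('o, 'm) cat \<Rightarrow> 'm \<Rightarrow> 'm \<Rightarrow> ('o, 'm) node \<Rightarrow> ('o, 'm) node set \<Rightarrow> bool" where
  "forces C a b r s \<longleftrightarrow> (\<forall>c p. cone_on C s c p \<longrightarrow> factors_through C (Comp C a (p r)) b)"

definition consistent ::
  "('o, 'm) cat \<Rightarrow> 'm \<Rightarrow> 'm \<Rightarrow> ('o, 'm) node \<Rightarrow> ('o, 'm) node set \<Rightarrow> bool" where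
  "consistent C a b r D \<longleftrightarrow> node_closed C D \<and> r \<in> D \<and>
     (\<forall>s. finite s \<and> node_closed C s \<and> r \<in> s \<and> s \<subseteq> D \<longrightarrow> \<not> forces C a b r s)"

lemma node_closed_edge:
  "node_closed C s \<Longrightarrow> w \<in> s \<Longrightarrow> (f, v) \<in> set (edges w) \<Longrightarrow> v \<in> s \<and> f \<in> hom C (ob w) (ob v)"
  by (auto simp: node_closed_def)

lemma node_closed_Ob: "node_closed C s \<Longrightarrow> w \<in> s \<Longrightarrow> ob w \<in> Ob C"
  by (auto simp: node_closed_def)

lemma node_closed_Union: "(\<And>s. s \<in> S \<Longrightarrow> node_closed C s) \<Longrightarrow> node_closed C (\<Union>S)"
  unfolding node_closed_def by fast

lemma node_closed_Un: "node_closed C s \<Longrightarrow> node_closed C t \<Longrightarrow> node_closed C (s \<union> t)"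
  unfolding node_closed_def by fast

lemma node_closed_insert:
  "node_closed C s \<Longrightarrow> ob w \<in> Ob C \<Longrightarrow>
    (\<And>f v. (f, v) \<in> set (edges w) \<Longrightarrow> v \<in> s \<and> f \<in> hom C (ob w) (ob v)) \<Longrightarrow>
    node_closed C (insert w s)"
  unfolding node_closed_def by fast

lemma finite_node_closure:
  assumes D: "node_closed C D"
  shows "v \<in> D \<Longrightarrow> \<exists>s. finite s \<and> node_closed C s \<and> v \<in> s \<and> s \<subseteq> D"
proof (induction v)
  case (Node y es)
  have "\<exists>s. finite s \<and> node_closed C s \<and> u \<in> s \<and> s \<subseteq> D" if u: "u \<in> snd ` set es" for u
  proof -
    obtain f where fu: "(f, u) \<in> set es" using u by force
    moreover have "u \<in> D" using node_closed_edge[OF D Node.prems, of f u] fu by simp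
    ultimately show ?thesis using Node.IH[of "(f, u)" u] by simp
  qed
  then obtain S where S: "\<And>u. u \<in> snd ` set es \<Longrightarrow> finite (S u) \<and> node_closed C (S u) \<and> u \<in> S u \<and> S u \<subseteq> D"
    by metis
  let ?U = "\<Union>(S ` snd ` set es)"
  have "node_closed C ?U" by (rule node_closed_Union) (use S in auto)
  then have "node_closed C (insert (Node y es) ?U)"
  proof (rule node_closed_insert)
    show "ob (Node y es) \<in> Ob C" using node_closed_Ob[OF D Node.prems] .
    fix f v assume fv: "(f, v) \<in> set (edges (Node y es))"
    then have "v \<in> snd ` set es" by force
    with S have "v \<in> ?U" by blast
    then show "v \<in> ?U \<and> f \<in> hom C (ob (Node y es)) (ob v)"
      using node_closed_edge[OF D Node.prems fv] by blast
  qed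
  moreover have "finite (insert (Node y es) ?U)" using S by auto
  moreover have "insert (Node y es) ?U \<subseteq> D" using S Node.prems by auto
  ultimately show ?case by blast
qed

lemma cone_on_hom: "cone_on C s c p \<Longrightarrow> w \<in> s \<Longrightarrow> p w \<in> hom C c (ob w)"
  by (simp add: cone_on_def)

lemma cone_on_edge: "cone_on C s c p \<Longrightarrow> w \<in> s \<Longrightarrow> (f, v) \<in> set (edges w) \<Longrightarrow> Comp C f (p w) = p v"
  by (auto simp: cone_on_def)

lemma cone_on_subset: "cone_on C s c p \<Longrightarrow> t \<subseteq> s \<Longrightarrow> cone_on C t c p"
  by (auto simp: cone_on_def)

text \<open>
  Freshness of \<open>w\<close> is essential: no edge of a node of \<open>s\<close> points to \<open>w\<close>, so only the edges of \<open>w\<close>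
  itself have to be checked.
\<close>

lemma cone_on_insert:
  assumes s: "node_closed C s" and p: "cone_on C s c p" and w: "w \<notin> s" and g: "g \<in> hom C c (ob w)"
    and e: "\<And>f v. (f, v) \<in> set (edges w) \<Longrightarrow> v \<in> s \<and> Comp C f g = p v"
  shows "cone_on C (insert w s) c (p(w := g))"
proof -
  have "Comp C f ((p(w := g)) u) = (p(w := g)) v"
    if u: "u \<in> insert w s" and fv: "(f, v) \<in> set (edges u)" for u f v
  proof (cases "u = w")
    case True
    with e fv have "v \<in> s" "Comp C f g = p v" by auto
    with True w show ?thesis by auto
  next
    case False
    with u have "u \<in> s" by simp
    then have "v \<in> s" using node_closed_edge[OF s _ fv] by simp
    with False w cone_on_edge[OF p \<open>u \<in> s\<close> fv] show ?thesis by auto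
  qed
  then have "\<forall>(f, v)\<in>set (edges u). Comp C f ((p(w := g)) u) = (p(w := g)) v" if "u \<in> insert w s" for u
    using that by blast
  moreover have "(p(w := g)) u \<in> hom C c (ob u)" if "u \<in> insert w s" for u
    using that g cone_on_hom[OF p] by auto
  ultimately show ?thesis using p unfolding cone_on_def by blast
qed

lemma (in category) cone_on_precomp:
  assumes s: "node_closed C s" and p: "cone_on C s c p" and q: "q \<in> hom C d c"
  shows "cone_on C s d (\<lambda>w. p w \<bullet> q)"
proof -
  have "f \<bullet> (p w \<bullet> q) = p v \<bullet> q" if "w \<in> s" "(f, v) \<in> set (edges w)" for w f v
  proof -
    have "f \<in> hom C (ob w) (ob v)" using node_closed_edge[OF s that] by simp
    from Comp_assoc[OF q cone_on_hom[OF p that(1)] this] show ?thesis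
      using cone_on_edge[OF p that] by simp
  qed
  moreover have "p w \<bullet> q \<in> hom C d (ob w)" if "w \<in> s" for w
    using Comp_hom[OF q cone_on_hom[OF p that]] .
  ultimately show ?thesis using hom_Ob[OF q] by (auto simp: cone_on_def)
qed

lemma forces_mono: "forces C a b r s \<Longrightarrow> s \<subseteq> t \<Longrightarrow> forces C a b r t"
  unfolding forces_def by (auto dest: cone_on_subset)

lemma (in coherent_category) ex_limit_on:
  fixes s :: "('o, 'm) node set"
  assumes fin: "finite s" and s: "node_closed C s"
  obtains L P where "cone_on C s L P"
    "\<And>c p. cone_on C s c p \<Longrightarrow> \<exists>h\<in>hom C c L. \<forall>v\<in>s. P v \<bullet> h = p v"
proof -
  obtain n and k :: "nat \<Rightarrow> ('o, 'm) node" where k: "bij_betw k {..<n} s"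
    using ex_bij_betw_nat_finite[OF fin] atLeast0LessThan by metis
  define i where "i = inv_into {..<n} k"
  have i: "i v < n" "k (i v) = v" if "v \<in> s" for v
    using that k by (auto simp: i_def bij_betw_def f_inv_into_f dest: inv_into_into)
  have ks: "k j \<in> s" if "j < n" for j using that k by (auto simp: bij_betw_def)
  define E where "E = (\<Union>w\<in>s. (\<lambda>(f, v). (i w, f, i v)) ` set (edges w))"
  have E: "(j, f, j') \<in> E \<longleftrightarrow> (\<exists>w\<in>s. \<exists>v. (f, v) \<in> set (edges w) \<and> j = i w \<and> j' = i v)" for j f j'
    by (auto simp: E_def)
  have "finite_diagram C {..<n} (\<lambda>j. ob (k j)) E"
    unfolding finite_diagram_def
  proof (intro conjI ballI)
    show "finite E" using fin by (auto simp: E_def)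
    show "ob (k j) \<in> Ob C" if "j \<in> {..<n}" for j
      using node_closed_Ob[OF s ks] that by simp
    fix e assume "e \<in> E"
    then obtain w f v where w: "w \<in> s" "(f, v) \<in> set (edges w)" "e = (i w, f, i v)"
      by (auto simp: E_def)
    then show "case e of (i, f, j) \<Rightarrow> i \<in> {..<n} \<and> j \<in> {..<n} \<and> f \<in> hom C (ob (k i)) (ob (k j))"
      using node_closed_edge[OF s w(1,2)] i by simp
  qed simp
  from finite_limits[OF this] obtain L P where
    lim: "is_limit C {..<n} (\<lambda>j. ob (k j)) E L P" by blast
  have cone: "cone_on C s L (\<lambda>v. P (i v))"
    unfolding cone_on_def
  proof (intro conjI ballI)
    show "L \<in> Ob C" using lim by (simp add: is_limit_def is_cone_def)
    fix w assume w: "w \<in> s"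
    have "\<forall>j\<in>{..<n}. P j \<in> hom C L (ob (k j))"
      using lim by (simp add: is_limit_def is_cone_def)
    then have "P (i w) \<in> hom C L (ob (k (i w)))" using i[OF w] by blast
    then show "P (i w) \<in> hom C L (ob w)" using i[OF w] by simp
    fix e assume "e \<in> set (edges w)"
    moreover obtain f v where "e = (f, v)" by fastforce
    ultimately have "(i w, f, i v) \<in> E" using E w by blast
    then have "f \<bullet> P (i w) = P (i v)" using lim by (auto simp: is_limit_def is_cone_def)
    then show "case e of (f, v) \<Rightarrow> f \<bullet> P (i w) = P (i v)" using \<open>e = (f, v)\<close> by simp
  qed
  have "\<exists>h\<in>hom C c L. \<forall>v\<in>s. P (i v) \<bullet> h = p v" if p: "cone_on C s c p" for c p
  proof -
    have "is_cone C {..<n} (\<lambda>j. ob (k j)) E c (\<lambda>j. p (k j))"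
      unfolding is_cone_def
    proof (intro conjI ballI)
      show "c \<in> Ob C" using p by (simp add: cone_on_def)
      show "p (k j) \<in> hom C c (ob (k j))" if "j \<in> {..<n}" for j
        using cone_on_hom[OF p ks] that by simp
      fix e assume "e \<in> E"
      then obtain w f v where w: "w \<in> s" "(f, v) \<in> set (edges w)" "e = (i w, f, i v)"
        by (auto simp: E_def)
      then show "case e of (i, f, j) \<Rightarrow> f \<bullet> p (k i) = p (k j)"
        using node_closed_edge[OF s w(1,2)] cone_on_edge[OF p w(1,2)] i by simp
    qed
    then obtain h where "h \<in> hom C c L" "\<forall>j\<in>{..<n}. P j \<bullet> h = p (k j)"
      using lim unfolding is_limit_def by blast
    then show ?thesis using i by (intro bexI[of _ h]) auto
  qed
  with cone show ?thesis using that by blast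
qed

text \<open>
  Consistency refers to finite subdiagrams only, so it passes to unions of chains and Zorn's lemma
  applies. The single root without edges is consistent: on the cone given by the identity of \<open>y\<close>,
  being forced would mean that \<open>a\<close> factors through \<open>b\<close>.
\<close>

lemma (in category) ex_maximal_consistent:
  assumes a: "a \<in> hom C y x" and "b \<in> monos_into C x" and ab: "\<not> factors_through C a b"
  obtains r D where "ob r = y" "consistent C a b r D"
    "\<And>D'. consistent C a b r D' \<Longrightarrow> D \<subseteq> D' \<Longrightarrow> D' = D"
proof -
  define r :: "('o, 'm) node" where "r = Node y []"
  have yO: "y \<in> Ob C" using hom_Ob[OF a] by simp
  have "\<not> forces C a b r s" if "s \<subseteq> {r}" for s
  proof
    assume "forces C a b r s"
    moreover have "cone_on C s y (\<lambda>_. Id C y)"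
      using that Id_hom yO by (auto simp: cone_on_def r_def)
    ultimately have "factors_through C (a \<bullet> Id C y) b" by (auto simp: forces_def)
    then show False using ab Comp_Id_right[OF a] by simp
  qed
  then have "consistent C a b r {r}"
    using yO by (auto simp: consistent_def node_closed_def r_def)
  then have ne: "Collect (consistent C a b r) \<noteq> {}" by auto
  have "\<Union>K \<in> Collect (consistent C a b r)"
    if K: "K \<noteq> {}" "subset.chain (Collect (consistent C a b r)) K" for K
  proof -
    have Kc: "consistent C a b r D" if "D \<in> K" for D
      using K(2) that by (auto simp: subset.chain_def)
    have "node_closed C (\<Union>K)" using Kc by (intro node_closed_Union) (simp add: consistent_def)
    moreover have "r \<in> \<Union>K" using K(1) Kc by (auto simp: consistent_def)
    moreover have "\<not> forces C a b r s"
      if s: "finite s" "node_closed C s" "r \<in> s" "s \<subseteq> \<Union>K" for s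
    proof -
      obtain D where "D \<in> K" "s \<subseteq> D" using finite_subset_Union_chain[OF s(1,4) K] by blast
      then show ?thesis using Kc s by (auto simp: consistent_def)
    qed
    ultimately show ?thesis by (auto simp: consistent_def)
  qed
  then obtain D where "consistent C a b r D"
    "\<And>D'. consistent C a b r D' \<Longrightarrow> D \<subseteq> D' \<Longrightarrow> D' = D"
    using subset_Zorn_nonempty[OF ne] by blast
  then show ?thesis using that[of r D] by (simp add: r_def)
qed

section \<open>Saturation of a maximal consistent diagram\<close>

locale generic_diagram = coherent_category C for C :: "('o, 'm) cat" +
  fixes a b :: 'm and x :: 'o and r :: "('o, 'm) node" and D :: "('o, 'm) node set"
  assumes a: "a \<in> hom C (ob r) x" and b: "b \<in> monos_into C x"
    and consistent: "consistent C a b r D"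
    and maximal: "consistent C a b r D' \<Longrightarrow> D \<subseteq> D' \<Longrightarrow> D' = D"
begin

lemma D_closed: "node_closed C D" and r_D: "r \<in> D"
  using consistent by (auto simp: consistent_def)

text \<open>
  The finite approximations to \<open>D\<close>; they form a directed family with union \<open>D\<close>.
\<close>

definition stage :: "('o, 'm) node set \<Rightarrow> bool" where
  "stage s \<longleftrightarrow> finite s \<and> node_closed C s \<and> r \<in> s \<and> s \<subseteq> D"

lemma stageD: "stage s \<Longrightarrow> finite s" "stage s \<Longrightarrow> node_closed C s" "stage s \<Longrightarrow> r \<in> s"
  "stage s \<Longrightarrow> s \<subseteq> D"
  by (auto simp: stage_def)

lemma stage_Un: "stage s \<Longrightarrow> stage t \<Longrightarrow> stage (s \<union> t)"
  by (auto simp: stage_def node_closed_Un)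

lemma not_forced: "stage s \<Longrightarrow> \<not> forces C a b r s"
  using consistent by (auto simp: stage_def consistent_def)

lemma ex_stage: "finite F \<Longrightarrow> F \<subseteq> D \<Longrightarrow> \<exists>s. stage s \<and> F \<subseteq> s"
proof (induction F rule: finite_induct)
  case empty
  then show ?case using finite_node_closure[OF D_closed r_D] by (auto simp: stage_def)
next
  case (insert v F)
  then obtain s where s: "stage s" "F \<subseteq> s" by auto
  obtain t where t: "finite t" "node_closed C t" "v \<in> t" "t \<subseteq> D"
    using finite_node_closure[OF D_closed, of v] insert.prems by auto
  have "stage (s \<union> t)" using s t by (auto simp: stage_def node_closed_Un)
  then show ?case using s t by blast
qed

text \<open>
  By maximality, the only reason for a well-formed node to be missing is that it is inconsistent with
  some stage.
\<close>

lemma absent_node: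
  assumes w: "w \<notin> D" "ob w \<in> Ob C"
    and e: "\<And>f v. (f, v) \<in> set (edges w) \<Longrightarrow> v \<in> D \<and> f \<in> hom C (ob w) (ob v)"
  obtains s where "stage s" "forces C a b r (insert w s)" "\<And>f v. (f, v) \<in> set (edges w) \<Longrightarrow> v \<in> s"
proof -
  have "\<not> consistent C a b r (insert w D)" using maximal[of "insert w D"] w(1) by blast
  moreover have "node_closed C (insert w D)" by (rule node_closed_insert[OF D_closed w(2) e])
  ultimately obtain s where s: "finite s" "node_closed C s" "r \<in> s" "s \<subseteq> insert w D" "forces C a b r s"
    using r_D unfolding consistent_def by blast
  \<comment> \<open>Nodes of \<open>D\<close> refer only to nodes of \<open>D\<close>, and \<open>w\<close> is not one of them.\<close>
  have "node_closed C (s - {w})"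
    unfolding node_closed_def
  proof (intro ballI conjI)
    fix u assume u: "u \<in> s - {w}"
    then have uD: "u \<in> D" using s by auto
    show "ob u \<in> Ob C" using node_closed_Ob[OF D_closed uD] .
    fix d assume d: "d \<in> set (edges u)"
    obtain f v where fv: "d = (f, v)" by fastforce
    have "v \<in> D" using node_closed_edge[OF D_closed uD] d fv by blast
    then have "v \<noteq> w" using w(1) by blast
    then show "case d of (f, v) \<Rightarrow> v \<in> s - {w} \<and> f \<in> hom C (ob u) (ob v)"
      using node_closed_edge[OF s(2), of u f v] u d fv by auto
  qed
  then have "stage (s - {w})" using s w(1) r_D by (auto simp: stage_def)
  moreover obtain t where t: "stage t" "snd ` set (edges w) \<subseteq> t"
    using ex_stage[of "snd ` set (edges w)"] e by force
  ultimately have "stage (s - {w} \<union> t)" using stage_Un by blast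
  moreover have "forces C a b r (insert w (s - {w} \<union> t))"
    by (rule forces_mono[OF s(5)]) auto
  moreover have "v \<in> s - {w} \<union> t" if "(f, v) \<in> set (edges w)" for f v
    using t(2) that by force
  ultimately show ?thesis using that by blast
qed

text \<open>
  The generalised element \<open>g\<close> interprets the missing node \<open>w\<close> over the change of stage \<open>q\<close>, so the
  inconsistency of \<open>w\<close> with \<open>s\<close> takes effect there.
\<close>

lemma forced_if_covered:
  assumes s: "stage s" and w: "w \<notin> D" and fo: "forces C a b r (insert w s)"
    and e: "\<And>f v. (f, v) \<in> set (edges w) \<Longrightarrow> v \<in> s"
    and p: "cone_on C s c p" and q: "q \<in> hom C d c"
    and g: "g \<in> hom C d (ob w)" "\<And>f v. (f, v) \<in> set (edges w) \<Longrightarrow> f \<bullet> g = p v \<bullet> q"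
  shows "factors_through C ((a \<bullet> p r) \<bullet> q) b"
proof -
  note cl = stageD(2)[OF s]
  have ws: "w \<notin> s" using w stageD(4)[OF s] by blast
  have "cone_on C (insert w s) d ((\<lambda>u. p u \<bullet> q)(w := g))"
    by (rule cone_on_insert[OF cl cone_on_precomp[OF cl p q] ws g(1)]) (use e g(2) in blast)
  with fo have "factors_through C (a \<bullet> ((\<lambda>u. p u \<bullet> q)(w := g)) r) b"
    unfolding forces_def by blast
  moreover have "r \<noteq> w" using w r_D by blast
  ultimately have "factors_through C (a \<bullet> (p r \<bullet> q)) b" by simp
  then show ?thesis
    using Comp_assoc[OF q cone_on_hom[OF p stageD(3)[OF s]] a] by simp
qed

text \<open>
  The Henkin property: a node that can be interpreted locally, that is after passing to a cover, in
  every cone over some stage is in \<open>D\<close>. Otherwise its inconsistency would force the root into \<open>b\<close>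
  after passing to a cover, hence outright, at a stage of \<open>D\<close> itself.
\<close>

lemma node_present:
  assumes w: "ob w \<in> Ob C"
    and e: "\<And>f v. (f, v) \<in> set (edges w) \<Longrightarrow> v \<in> D \<and> f \<in> hom C (ob w) (ob v)"
    and s: "stage s"
    and ext: "\<And>c p. cone_on C s c p \<Longrightarrow> (\<And>f v. (f, v) \<in> set (edges w) \<Longrightarrow> p v \<in> hom C c (ob v)) \<Longrightarrow>
      \<exists>d q. q \<in> hom C d c \<and> cover q \<and>
        (\<exists>g\<in>hom C d (ob w). \<forall>(f, v)\<in>set (edges w). f \<bullet> g = p v \<bullet> q)"
  shows "w \<in> D"
proof (rule ccontr)
  assume wD: "w \<notin> D"
  obtain t where t: "stage t" "forces C a b r (insert w t)"
    "\<And>f v. (f, v) \<in> set (edges w) \<Longrightarrow> v \<in> t"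
    using absent_node[OF wD w e] by blast
  let ?u = "s \<union> t"
  have u: "stage ?u" using stage_Un[OF s t(1)] .
  have fu: "forces C a b r (insert w ?u)" by (rule forces_mono[OF t(2)]) auto
  have "forces C a b r ?u"
    unfolding forces_def
  proof (intro allI impI)
    fix c p assume p: "cone_on C ?u c p"
    have ps: "cone_on C s c p" using cone_on_subset[OF p] by blast
    have "\<exists>d q. q \<in> hom C d c \<and> cover q \<and>
        (\<exists>g\<in>hom C d (ob w). \<forall>(f, v)\<in>set (edges w). f \<bullet> g = p v \<bullet> q)"
      by (rule ext[OF ps]) (use cone_on_hom[OF p] t(3) in blast)
    then obtain d q g where
      q: "q \<in> hom C d c" "cover q" and g: "g \<in> hom C d (ob w)"
      "\<And>f v. (f, v) \<in> set (edges w) \<Longrightarrow> f \<bullet> g = p v \<bullet> q" by blast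
    have "factors_through C ((a \<bullet> p r) \<bullet> q) b"
      by (rule forced_if_covered[OF u wD fu _ p q(1) g]) (use t(3) in auto)
    then show "factors_through C (a \<bullet> p r) b"
      using factors_through_cover[OF q Comp_hom[OF cone_on_hom[OF p stageD(3)[OF u]] a] b] by blast
  qed
  then show False using not_forced[OF u] by blast
qed

text \<open>
  Truth in the generic interpretation: a statement about cones holds if some stage guarantees it.
\<close>

definition holds :: "((('o, 'm) node \<Rightarrow> 'm) \<Rightarrow> bool) \<Rightarrow> bool" where
  "holds \<Phi> \<longleftrightarrow> (\<exists>s. stage s \<and> (\<forall>c p. cone_on C s c p \<longrightarrow> \<Phi> p))"

lemma holdsI:
  assumes "finite F" "F \<subseteq> D"
    and "\<And>s c p. stage s \<Longrightarrow> F \<subseteq> s \<Longrightarrow> cone_on C s c p \<Longrightarrow> \<Phi> p"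
  shows "holds \<Phi>"
  using ex_stage[OF assms(1,2)] assms(3) unfolding holds_def by blast

lemma holdsE:
  assumes "holds \<Phi>" "finite F" "F \<subseteq> D"
  obtains s where "stage s" "F \<subseteq> s" "\<And>c p. cone_on C s c p \<Longrightarrow> \<Phi> p"
proof -
  obtain s t where "stage s" "\<And>c p. cone_on C s c p \<Longrightarrow> \<Phi> p" "stage t" "F \<subseteq> t"
    using assms(1) ex_stage[OF assms(2,3)] unfolding holds_def by blast
  then show ?thesis
    using that[of "s \<union> t"] stage_Un cone_on_subset[of C "s \<union> t" _ _ s] by blast
qed

lemma holds_mp:
  assumes "holds \<Phi>" "finite F" "F \<subseteq> D"
    and "\<And>s c p. stage s \<Longrightarrow> F \<subseteq> s \<Longrightarrow> cone_on C s c p \<Longrightarrow> \<Phi> p \<Longrightarrow> \<Psi> p"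
  shows "holds \<Psi>"
proof -
  obtain s where "stage s" "F \<subseteq> s" "\<And>c p. cone_on C s c p \<Longrightarrow> \<Phi> p"
    using holdsE[OF assms(1-3)] by blast
  then show ?thesis using assms(4) unfolding holds_def by blast
qed

lemma holds_conj: 
  assumes "holds \<Phi>" "holds \<Psi>" shows "holds (\<lambda>p. \<Phi> p \<and> \<Psi> p)"
proof -
  obtain s t where "stage s" "\<And>c p. cone_on C s c p \<Longrightarrow> \<Phi> p" "stage t" "\<And>c p. cone_on C t c p \<Longrightarrow> \<Psi> p"
    using assms unfolding holds_def by blast
  then show ?thesis unfolding holds_def
    using stage_Un cone_on_subset[of C "s \<union> t"] by (intro exI[of _ "s \<union> t"]) blast
qed

lemma holds_Ball:
  "finite I \<Longrightarrow> (\<And>i. i \<in> I \<Longrightarrow> holds (\<Phi> i)) \<Longrightarrow> holds (\<lambda>p. \<forall>i\<in>I. \<Phi> i p)"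
proof (induction I rule: finite_induct)
  case empty
  then show ?case by (auto intro: holdsI[of "{}"])
next
  case (insert i I)
  have "holds (\<lambda>p. \<Phi> i p \<and> (\<forall>i\<in>I. \<Phi> i p))"
    by (rule holds_conj) (use insert in auto)
  then show ?case by simp
qed

lemma not_holds_root: "\<not> holds (\<lambda>p. factors_through C (a \<bullet> p r) b)"
  using not_forced unfolding holds_def forces_def by blast

lemma holds_edge: "w \<in> D \<Longrightarrow> (f, v) \<in> set (edges w) \<Longrightarrow> holds (\<lambda>p. f \<bullet> p w = p v)"
  by (rule holdsI[of "{w}"]) (auto intro: cone_on_edge)

text \<open>
  The limit of a stage is itself represented by a node of \<open>D\<close>, so that finitely many elements of the
  model can be replaced by elements carried by one node, and finitely many facts that hold become
  equations between arrows of \<open>C\<close>.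
\<close>

lemma stage_node:
  assumes s: "stage s"
  obtains w P where "w \<in> D" "cone_on C s (ob w) P" "holds (\<lambda>p. \<forall>v\<in>s. P v \<bullet> p w = p v)"
proof -
  obtain L P where P: "cone_on C s L P"
    "\<And>c p. cone_on C s c p \<Longrightarrow> \<exists>h\<in>hom C c L. \<forall>v\<in>s. P v \<bullet> h = p v"
    using ex_limit_on[OF stageD(1,2)[OF s]] by blast
  obtain vs where vs: "set vs = s" using finite_list[OF stageD(1)[OF s]] by blast
  define w where "w = Node L (map (\<lambda>v. (P v, v)) vs)"
  have e: "(f, v) \<in> set (edges w) \<longleftrightarrow> v \<in> s \<and> f = P v" for f v
    using vs by (auto simp: w_def)
  have LO: "L \<in> Ob C" using P(1) by (simp add: cone_on_def)
  have wD: "w \<in> D"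
  proof (rule node_present[OF _ _ s])
    show "ob w \<in> Ob C" using LO by (simp add: w_def)
    show "v \<in> D \<and> f \<in> hom C (ob w) (ob v)" if "(f, v) \<in> set (edges w)" for f v
      using that e cone_on_hom[OF P(1)] stageD(4)[OF s] by (auto simp: w_def)
    fix c p assume p: "cone_on C s c p"
    have cO: "c \<in> Ob C" using p by (simp add: cone_on_def)
    obtain h where h: "h \<in> hom C c L" "\<forall>v\<in>s. P v \<bullet> h = p v" using P(2)[OF p] by blast
    have "\<forall>(f, v)\<in>set (edges w). f \<bullet> h = p v \<bullet> Id C c"
      using e h(2) Comp_Id_right[OF cone_on_hom[OF p]] by auto
    then show "\<exists>d q. q \<in> hom C d c \<and> cover q \<and>
        (\<exists>g\<in>hom C d (ob w). \<forall>(f, v)\<in>set (edges w). f \<bullet> g = p v \<bullet> q)"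
      using h(1) Id_hom[OF cO] cover_Id[OF cO] by (auto simp: w_def)
  qed
  have "holds (\<lambda>p. \<forall>v\<in>s. P v \<bullet> p w = p v)"
    by (rule holds_Ball[OF stageD(1)[OF s]], rule holds_edge[OF wD]) (simp add: e)
  then show ?thesis using that[OF wD] P by (simp add: w_def)
qed

section \<open>Elements of the generic diagram\<close>

text \<open>
  The pair \<open>(v, f)\<close> stands for the value of \<open>f\<close> at the element named \<open>v\<close>. Up to \<open>eqv\<close> below, \<open>El y\<close>
  is the filtered colimit of the sets of arrows from the limits of the stages to \<open>y\<close>.
\<close>

definition El :: "'o \<Rightarrow> (('o, 'm) node \<times> 'm) set" where
  "El y = {(v, f). v \<in> D \<and> f \<in> hom C (ob v) y}"

definition val :: "(('o, 'm) node \<Rightarrow> 'm) \<Rightarrow> ('o, 'm) node \<times> 'm \<Rightarrow> 'm" where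
  "val p = (\<lambda>(v, f). f \<bullet> p v)"

definition eqv :: "('o, 'm) node \<times> 'm \<Rightarrow> ('o, 'm) node \<times> 'm \<Rightarrow> bool" where
  "eqv \<xi> \<zeta> \<longleftrightarrow> holds (\<lambda>p. val p \<xi> = val p \<zeta>)"

definition act :: "'m \<Rightarrow> ('o, 'm) node \<times> 'm \<Rightarrow> ('o, 'm) node \<times> 'm" where
  "act g = (\<lambda>(v, f). (v, g \<bullet> f))"

lemma El_D: "\<xi> \<in> El y \<Longrightarrow> fst \<xi> \<in> D" by (auto simp: El_def)

lemma val_hom:
  assumes "\<xi> \<in> El y" "cone_on C s c p" "fst \<xi> \<in> s"
  shows "val p \<xi> \<in> hom C c y"
proof -
  obtain v f where \<xi>: "\<xi> = (v, f)" by fastforce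
  then have "f \<in> hom C (ob v) y" "v \<in> s" using assms by (auto simp: El_def)
  then show ?thesis using Comp_hom[OF cone_on_hom[OF assms(2)]] by (simp add: \<xi> val_def)
qed

lemma act_El: "\<xi> \<in> El y \<Longrightarrow> g \<in> hom C y z \<Longrightarrow> act g \<xi> \<in> El z"
  using Comp_hom by (auto simp: El_def act_def)

lemma fst_act [simp]: "fst (act g \<xi>) = fst \<xi>"
  by (simp add: act_def split_beta)

lemma val_act:
  assumes "\<xi> \<in> El y" "g \<in> hom C y z" "cone_on C s c p" "fst \<xi> \<in> s"
  shows "val p (act g \<xi>) = g \<bullet> val p \<xi>"
proof -
  obtain v f where \<xi>: "\<xi> = (v, f)" by fastforce
  then have "f \<in> hom C (ob v) y" "v \<in> s" using assms by (auto simp: El_def)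
  then show ?thesis
    using Comp_assoc[OF cone_on_hom[OF assms(3)] _ assms(2)] by (simp add: \<xi> val_def act_def)
qed

lemma eqv_refl: "eqv \<xi> \<xi>"
  unfolding eqv_def by (rule holdsI[of "{}"]) auto

lemma eqv_sym: "eqv \<xi> \<zeta> \<Longrightarrow> eqv \<zeta> \<xi>"
  by (simp add: eqv_def eq_commute)

lemma eqv_trans: "eqv \<xi> \<zeta> \<Longrightarrow> eqv \<zeta> \<theta> \<Longrightarrow> eqv \<xi> \<theta>"
  unfolding eqv_def by (drule (1) holds_conj, erule holds_mp[of _ "{}"]) auto

lemma eqv_act_iff:
  assumes "\<xi> \<in> El y" "\<zeta> \<in> El z" "f \<in> hom C y w" "g \<in> hom C z w"
  shows "eqv (act f \<xi>) (act g \<zeta>) \<longleftrightarrow> holds (\<lambda>p. f \<bullet> val p \<xi> = g \<bullet> val p \<zeta>)"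
proof -
  let ?F = "{fst \<xi>, fst \<zeta>}"
  have F: "finite ?F" "?F \<subseteq> D" using El_D assms by auto
  have "f \<bullet> val p \<xi> = g \<bullet> val p \<zeta> \<longleftrightarrow> val p (act f \<xi>) = val p (act g \<zeta>)"
    if "?F \<subseteq> s" "cone_on C s c p" for s c p
    using val_act[OF assms(1,3) that(2)] val_act[OF assms(2,4) that(2)] that(1) by simp
  then show ?thesis unfolding eqv_def
    using holds_mp[OF _ F, of "\<lambda>p. f \<bullet> val p \<xi> = g \<bullet> val p \<zeta>"
        "\<lambda>p. val p (act f \<xi>) = val p (act g \<zeta>)"]
      holds_mp[OF _ F, of "\<lambda>p. val p (act f \<xi>) = val p (act g \<zeta>)"
        "\<lambda>p. f \<bullet> val p \<xi> = g \<bullet> val p \<zeta>"] by blast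
qed

lemma act_eqv:
  assumes "eqv \<xi> \<zeta>" "\<xi> \<in> El y" "\<zeta> \<in> El y" "g \<in> hom C y z"
  shows "eqv (act g \<xi>) (act g \<zeta>)"
  unfolding eqv_act_iff[OF assms(2,3,4,4)]
  by (rule holds_mp[OF assms(1)[unfolded eqv_def], of "{}"]) auto

end

context generic_diagram
begin

lemma eqv_via_edge:
  assumes w: "w \<in> D" and e: "(q, v) \<in> set (edges w)"
    and f: "f \<in> hom C (ob v) z" and g: "g \<in> hom C (ob w) y" and h: "h \<in> hom C y z"
    and sq: "f \<bullet> q = h \<bullet> g"
  shows "eqv (act h (w, g)) (v, f)"
proof -
  have vq: "v \<in> D" "q \<in> hom C (ob w) (ob v)" using node_closed_edge[OF D_closed w e] by auto
  show ?thesis unfolding eqv_def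
  proof (rule holdsI[of "{w}"])
    fix s c p assume s: "stage s" "{w} \<subseteq> s" and p: "cone_on C s c p"
    have ws: "w \<in> s" using s by simp
    note pw = cone_on_hom[OF p ws]
    have "(h \<bullet> g) \<bullet> p w = f \<bullet> (q \<bullet> p w)" using Comp_assoc[OF pw vq(2) f] sq by simp
    then show "val p (act h (w, g)) = val p (v, f)"
      using cone_on_edge[OF p ws e] by (simp add: val_def act_def)
  qed (use w in auto)
qed

text \<open>
  The pullback \<open>q\<close> of the cover \<open>e\<close> along \<open>f\<close> is a cover. The node over \<open>v\<close> along \<open>q\<close> is present, as
  in any cone it can be interpreted after pulling \<open>q\<close> back along the interpretation of \<open>v\<close>.
\<close>

lemma El_lift_cover:
  assumes \<xi>: "\<xi> \<in> El z" and e: "e \<in> hom C y z" "cover e"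
  shows "\<exists>\<zeta>\<in>El y. eqv (act e \<zeta>) \<xi>"
proof -
  obtain v f where vf: "\<xi> = (v, f)" by fastforce
  then have v: "v \<in> D" and f: "f \<in> hom C (ob v) z" using \<xi> by (auto simp: El_def)
  obtain P q g where q: "q \<in> hom C P (ob v)" "cover q" and g: "g \<in> hom C P y" and sq: "f \<bullet> q = e \<bullet> g"
    using ex_cover_pullback[OF e f] by metis
  define w where "w = Node P [(q, v)]"
  obtain s where s: "stage s" using ex_stage[of "{}"] by auto
  have w: "w \<in> D"
  proof (rule node_present[OF _ _ s])
    show "ob w \<in> Ob C" using hom_Ob[OF q(1)] by (simp add: w_def)
    show "u \<in> D \<and> k \<in> hom C (ob w) (ob u)" if "(k, u) \<in> set (edges w)" for k u
      using that v q by (simp add: w_def)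
    fix c p assume "\<And>k u. (k, u) \<in> set (edges w) \<Longrightarrow> p u \<in> hom C c (ob u)"
    then have "p v \<in> hom C c (ob v)" by (simp add: w_def)
    then obtain d q' g' where d: "q' \<in> hom C d c" "cover q'" "g' \<in> hom C d P" "p v \<bullet> q' = q \<bullet> g'"
      using ex_cover_pullback[OF q] by metis
    show "\<exists>d q. q \<in> hom C d c \<and> cover q \<and>
        (\<exists>g\<in>hom C d (ob w). \<forall>(k, u)\<in>set (edges w). k \<bullet> g = p u \<bullet> q)"
      by (intro exI[of _ d] exI[of _ q'] conjI bexI[of _ g']) (use d in \<open>auto simp: w_def\<close>)
  qed
  have "eqv (act e (w, g)) \<xi>"
    unfolding vf by (rule eqv_via_edge[OF w _ f _ e(1) sq]) (use g in \<open>auto simp: w_def\<close>)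
  then show ?thesis using w g by (intro bexI[of _ "(w, g)"]) (auto simp: El_def w_def)
qed

text \<open>
  The model turns unions into unions. For each \<open>\<alpha>\<close> in \<open>S\<close> the node \<open>w \<alpha>\<close> asserts that the element
  \<open>\<xi>\<close> belongs to \<open>\<alpha>\<close>. If all of these were missing, then over a common stage the root would be forced
  into \<open>b\<close> on each of the subobjects on which \<open>\<xi>\<close> is in some \<open>\<alpha>\<close>. By stability of unions these
  subobjects cover the stage, so the root would be forced into \<open>b\<close> there.
\<close>

lemma El_union:
  assumes S: "finite S" "S \<subseteq> monos_into C y" and m: "is_union C y S m"
    and \<xi>: "\<xi> \<in> El y" and mem: "holds (\<lambda>p. factors_through C (val p \<xi>) m)"
  shows "\<exists>\<alpha>\<in>S. \<exists>\<zeta>\<in>El (Dom C \<alpha>). eqv (act \<alpha> \<zeta>) \<xi>"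
proof (rule ccontr)
  assume none: "\<not> ?thesis"
  obtain v f where vf: "\<xi> = (v, f)" by fastforce
  then have v: "v \<in> D" and f: "f \<in> hom C (ob v) y" using \<xi> by (auto simp: El_def)
  have mm: "m \<in> monos_into C y" using m by (simp add: is_union_def)
  have "\<exists>P g. P \<in> hom C (Dom C P) (ob v) \<and> g \<in> hom C (Dom C P) (Dom C \<alpha>) \<and> f \<bullet> P = \<alpha> \<bullet> g \<and>
      is_inv_image C f \<alpha> P" if "\<alpha> \<in> S" for \<alpha>
  proof -
    have \<alpha>: "\<alpha> \<in> monos_into C y" using S that by blast
    obtain U P g where P: "P \<in> hom C U (ob v)" "g \<in> hom C U (Dom C \<alpha>)" "f \<bullet> P = \<alpha> \<bullet> g"
      "is_pullback C f \<alpha> P g"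
      using ex_pullback[OF f monos_into_hom[OF \<alpha>]] by metis
    moreover have "Dom C P = U" using homD[OF P(1)] by simp
    ultimately show ?thesis unfolding is_inv_image_def by metis
  qed
  then obtain P g where P: "\<And>\<alpha>. \<alpha> \<in> S \<Longrightarrow> P \<alpha> \<in> hom C (Dom C (P \<alpha>)) (ob v)"
    and g: "\<And>\<alpha>. \<alpha> \<in> S \<Longrightarrow> g \<alpha> \<in> hom C (Dom C (P \<alpha>)) (Dom C \<alpha>)"
    and sq: "\<And>\<alpha>. \<alpha> \<in> S \<Longrightarrow> f \<bullet> P \<alpha> = \<alpha> \<bullet> g \<alpha>"
    and inv: "\<And>\<alpha>. \<alpha> \<in> S \<Longrightarrow> is_inv_image C f \<alpha> (P \<alpha>)" by metis
  define w where "w = (\<lambda>\<alpha>. Node (Dom C (P \<alpha>)) [(P \<alpha>, v)])"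
  have w: "w \<alpha> \<notin> D" if "\<alpha> \<in> S" for \<alpha>
  proof
    assume wD: "w \<alpha> \<in> D"
    have \<alpha>: "\<alpha> \<in> hom C (Dom C \<alpha>) y" using monos_into_hom S that by blast
    have "eqv (act \<alpha> (w \<alpha>, g \<alpha>)) \<xi>"
      unfolding vf
      by (rule eqv_via_edge[OF wD _ f _ \<alpha> sq[OF that]]) (use g[OF that] in \<open>auto simp: w_def\<close>)
    moreover have "(w \<alpha>, g \<alpha>) \<in> El (Dom C \<alpha>)" using wD g[OF that] by (simp add: El_def w_def)
    ultimately show False using none that by blast
  qed
  have "\<exists>t. stage t \<and> forces C a b r (insert (w \<alpha>) t) \<and> v \<in> t" if "\<alpha> \<in> S" for \<alpha>
  proof (rule absent_node[OF w[OF that]])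
    show "ob (w \<alpha>) \<in> Ob C" using hom_Ob[OF P[OF that]] by (simp add: w_def)
    show "u \<in> D \<and> k \<in> hom C (ob (w \<alpha>)) (ob u)" if "(k, u) \<in> set (edges (w \<alpha>))" for k u
      using that v P[OF \<open>\<alpha> \<in> S\<close>] by (simp add: w_def)
    fix s assume s: "stage s" "forces C a b r (insert (w \<alpha>) s)"
      "\<And>k u. (k, u) \<in> set (edges (w \<alpha>)) \<Longrightarrow> u \<in> s"
    moreover have "v \<in> s" using s(3)[of "P \<alpha>" v] by (simp add: w_def)
    ultimately show ?thesis by blast
  qed
  then obtain t where t: "\<And>\<alpha>. \<alpha> \<in> S \<Longrightarrow> stage (t \<alpha>)"
    "\<And>\<alpha>. \<alpha> \<in> S \<Longrightarrow> forces C a b r (insert (w \<alpha>) (t \<alpha>))" by metis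
  obtain s0 where s0: "stage s0" "{v} \<subseteq> s0"
    "\<And>c p. cone_on C s0 c p \<Longrightarrow> factors_through C (val p \<xi>) m"
    using holdsE[OF mem, of "{v}"] v by auto
  define s where "s = s0 \<union> \<Union>(t ` S)"
  have s: "stage s"
    unfolding stage_def
  proof (intro conjI)
    have "node_closed C (\<Union>(t ` S))" by (rule node_closed_Union) (use t stageD in blast)
    then show "node_closed C s" using stageD[OF s0(1)] by (simp add: s_def node_closed_Un)
    show "finite s" using S(1) stageD[OF s0(1)] stageD[OF t(1)] by (simp add: s_def)
    show "r \<in> s" using stageD(3)[OF s0(1)] by (simp add: s_def)
    show "s \<subseteq> D" unfolding s_def using stageD(4)[OF s0(1)] stageD(4)[OF t(1)] by blast
  qed
  have fo: "forces C a b r (insert (w \<alpha>) s)" if "\<alpha> \<in> S" for \<alpha>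
    by (rule forces_mono[OF t(2)[OF that]]) (use that in \<open>auto simp: s_def\<close>)
  have vs: "v \<in> s" using s0(2) by (simp add: s_def)
  \<comment> \<open>The union is pulled back in two steps, along \<open>f\<close> and then along the interpretation of \<open>v\<close>.\<close>
  obtain m' where m': "is_inv_image C f m m'" using ex_inv_image[OF f mm] .
  have um': "is_union C (ob v) (P ` S) m'"
    by (rule finite_unions_stable[OF S m f inv m'])
  have m'm: "m' \<in> monos_into C (ob v)" using um' by (simp add: is_union_def)
  have PS: "P ` S \<subseteq> monos_into C (ob v)"
  proof
    fix \<beta> assume "\<beta> \<in> P ` S"
    then obtain \<alpha> where "\<alpha> \<in> S" "\<beta> = P \<alpha>" by blast
    then show "\<beta> \<in> monos_into C (ob v)"
      using is_inv_imageD(1)[OF inv f, of \<alpha>] S(2) by blast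
  qed
  have "forces C a b r s"
    unfolding forces_def
  proof (intro allI impI)
    fix c p assume p: "cone_on C s c p"
    have pv: "p v \<in> hom C c (ob v)" using cone_on_hom[OF p vs] .
    have cO: "c \<in> Ob C" using hom_Ob[OF pv] by simp
    have ap: "a \<bullet> p r \<in> hom C c x" using Comp_hom[OF cone_on_hom[OF p stageD(3)[OF s]] a] .
    have "cone_on C s0 c p" by (rule cone_on_subset[OF p]) (simp add: s_def)
    then have "factors_through C (f \<bullet> p v) m" using s0(3) by (fastforce simp: vf val_def)
    then have pm': "factors_through C (p v) m'" using is_inv_imageD(3)[OF m' f mm pv] by blast
    obtain m'' where m'': "is_inv_image C (p v) m' m''" using ex_inv_image[OF pv m'm] .
    have Id_m'': "sub_le C (Id C c) m''"
      using is_inv_imageD(3)[OF m'' pv m'm Id_hom[OF cO]] pm' Comp_Id_right[OF pv] by simp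
    have "\<exists>k. is_inv_image C (p v) \<beta> k" if "\<beta> \<in> P ` S" for \<beta>
      using ex_inv_image[OF pv, of \<beta>] PS that by blast
    then obtain Q where Q: "\<And>\<beta>. \<beta> \<in> P ` S \<Longrightarrow> is_inv_image C (p v) \<beta> (Q \<beta>)" by metis
    have um'': "is_union C c (Q ` P ` S) m''"
      by (rule finite_unions_stable[OF _ PS um' pv Q m'']) (use S(1) in auto)
    obtain n where n: "is_inv_image C (a \<bullet> p r) b n" using ex_inv_image[OF ap b] .
    have nm: "n \<in> monos_into C c" using is_inv_imageD(1)[OF n ap b] .
    have "sub_le C (Q (P \<alpha>)) n" if \<alpha>: "\<alpha> \<in> S" for \<alpha>
    proof -
      have Pm: "P \<alpha> \<in> monos_into C (ob v)" using PS \<alpha> by blast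
      note QD = is_inv_imageD(1,2)[OF Q[OF imageI[OF \<alpha>]] pv Pm]
      note Qh = monos_into_hom[OF QD(1)]
      obtain k where k: "k \<in> hom C (Dom C (Q (P \<alpha>))) (Dom C (P \<alpha>))" "P \<alpha> \<bullet> k = p v \<bullet> Q (P \<alpha>)"
        using QD(2) factors_through_iff[OF Comp_hom[OF Qh pv] monos_into_hom[OF Pm]] by blast
      have "factors_through C ((a \<bullet> p r) \<bullet> Q (P \<alpha>)) b"
        by (rule forced_if_covered[OF s w[OF \<alpha>] fo[OF \<alpha>] _ p Qh]) (use k vs in \<open>auto simp: w_def\<close>)
      then show ?thesis using is_inv_imageD(3)[OF n ap b Qh] by blast
    qed
    then have m''n: "sub_le C m'' n" using um'' nm by (auto simp: is_union_def)
    have m''m: "m'' \<in> monos_into C c" using um'' by (simp add: is_union_def)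
    have "sub_le C (Id C c) n"
      using factors_through_trans[OF Id_m'' m''n Id_hom[OF cO] monos_into_hom[OF m''m] monos_into_hom[OF nm]] .
    then show "factors_through C (a \<bullet> p r) b"
      using factors_through_if_total_inv_image[OF n ap b] by blast
  qed
  then show False using not_forced[OF s] by blast
qed

lemma El_mono:
  assumes m: "m \<in> monos_into C z" and \<xi>: "\<xi> \<in> El (Dom C m)" and \<zeta>: "\<zeta> \<in> El (Dom C m)"
    and eq: "eqv (act m \<xi>) (act m \<zeta>)"
  shows "eqv \<xi> \<zeta>"
proof -
  note mh = monos_into_hom[OF m]
  have "holds (\<lambda>p. m \<bullet> val p \<xi> = m \<bullet> val p \<zeta>)" using eq eqv_act_iff[OF \<xi> \<zeta> mh mh] by simp
  then show ?thesis unfolding eqv_def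
  proof (rule holds_mp)
    show "finite {fst \<xi>, fst \<zeta>}" "{fst \<xi>, fst \<zeta>} \<subseteq> D" using El_D \<xi> \<zeta> by auto
    fix s c p assume s: "{fst \<xi>, fst \<zeta>} \<subseteq> s" "cone_on C s c p" "m \<bullet> val p \<xi> = m \<bullet> val p \<zeta>"
    show "val p \<xi> = val p \<zeta>"
      by (rule monos_into_cancel[OF m val_hom[OF \<xi> s(2)] val_hom[OF \<zeta> s(2)] s(3)]) (use s(1) in auto)
  qed
qed

text \<open>
  Over a suitable stage the given compatible family consists of arrows from the limit of the stage
  that form an actual cone in \<open>C\<close>; the induced arrow into \<open>c\<close> is the required element.
\<close>

lemma El_limit_exists:
  assumes fd: "finite_diagram C V X E" and lim: "is_limit C V X E c l"
    and \<xi>: "\<And>i. i \<in> V \<Longrightarrow> \<xi> i \<in> El (X i)"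
    and comm: "\<And>i f j. (i, f, j) \<in> E \<Longrightarrow> eqv (act f (\<xi> i)) (\<xi> j)"
  shows "\<exists>\<zeta>\<in>El c. \<forall>i\<in>V. eqv (act (l i) \<zeta>) (\<xi> i)"
proof -
  have l: "l i \<in> hom C c (X i)" if "i \<in> V" for i using lim that by (auto simp: is_limit_def is_cone_def)
  have E: "i \<in> V \<and> j \<in> V \<and> f \<in> hom C (X i) (X j)" if "(i, f, j) \<in> E" for i f j
    using fd that by (auto simp: finite_diagram_def)
  let ?F = "fst ` \<xi> ` V"
  have F: "finite ?F" "?F \<subseteq> D" using fd El_D[OF \<xi>] by (auto simp: finite_diagram_def)
  have "holds (\<lambda>p. \<forall>e\<in>E. case e of (i, f, j) \<Rightarrow> val p (act f (\<xi> i)) = val p (\<xi> j))"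
    by (rule holds_Ball) (use fd comm in \<open>auto simp: finite_diagram_def eqv_def\<close>)
  then obtain s where s: "stage s" "?F \<subseteq> s" and sE:
    "\<And>d p. cone_on C s d p \<Longrightarrow> \<forall>e\<in>E. case e of (i, f, j) \<Rightarrow> val p (act f (\<xi> i)) = val p (\<xi> j)"
    using holdsE[OF _ F] by blast
  obtain w P where w: "w \<in> D" "cone_on C s (ob w) P" and wP: "holds (\<lambda>p. \<forall>v\<in>s. P v \<bullet> p w = p v)"
    by (rule stage_node[OF s(1)])
  have vP: "val P (\<xi> i) \<in> hom C (ob w) (X i)" if "i \<in> V" for i
    using val_hom[OF \<xi>[OF that] w(2)] s(2) that by blast
  have "f \<bullet> val P (\<xi> i) = val P (\<xi> j)" if e: "(i, f, j) \<in> E" for i f j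
  proof -
    have i: "i \<in> V" and f: "f \<in> hom C (X i) (X j)" using E[OF e] by auto
    have "val P (act f (\<xi> i)) = f \<bullet> val P (\<xi> i)"
      by (rule val_act[OF \<xi>[OF i] f w(2)]) (use s(2) i in blast)
    then show ?thesis using sE[OF w(2)] e by auto
  qed
  then have "is_cone C V X E (ob w) (\<lambda>i. val P (\<xi> i))"
    using vP node_closed_Ob[OF D_closed w(1)] by (auto simp: is_cone_def)
  then obtain h where h: "h \<in> hom C (ob w) c" "\<And>i. i \<in> V \<Longrightarrow> l i \<bullet> h = val P (\<xi> i)"
    using lim unfolding is_limit_def by blast
  have "eqv (act (l i) (w, h)) (\<xi> i)" if i: "i \<in> V" for i
    unfolding eqv_def
  proof (rule holds_mp[OF wP])
    obtain v f where vf: "\<xi> i = (v, f)" by fastforce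
    have f: "f \<in> hom C (ob v) (X i)" using \<xi>[OF i] by (simp add: vf El_def)
    have vs: "v \<in> s" using s(2) i vf by force
    show "finite {w}" "{w} \<subseteq> D" using w by auto
    fix t d p assume t: "{w} \<subseteq> t" "cone_on C t d p" "\<forall>v\<in>s. P v \<bullet> p w = p v"
    have "p w \<in> hom C d (ob w)" using cone_on_hom[OF t(2)] t(1) by simp
    then have "(f \<bullet> P v) \<bullet> p w = f \<bullet> (P v \<bullet> p w)"
      using Comp_assoc[OF _ cone_on_hom[OF w(2) vs] f] by simp
    then show "val p (act (l i) (w, h)) = val p (\<xi> i)"
      using h(2)[OF i] t(3) vs by (simp add: act_def val_def vf)
  qed
  moreover have "(w, h) \<in> El c" using w(1) h(1) by (simp add: El_def)
  ultimately show ?thesis by blast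
qed

lemma El_limit_unique:
  assumes fd: "finite_diagram C V X E" and lim: "is_limit C V X E c l"
    and \<xi>: "\<xi> \<in> El c" and \<zeta>: "\<zeta> \<in> El c"
    and eq: "\<And>i. i \<in> V \<Longrightarrow> eqv (act (l i) \<xi>) (act (l i) \<zeta>)"
  shows "eqv \<xi> \<zeta>"
proof -
  have l: "l i \<in> hom C c (X i)" if "i \<in> V" for i using lim that by (auto simp: is_limit_def is_cone_def)
  have le: "f \<bullet> l i = l j" if "(i, f, j) \<in> E" for i f j using lim that by (auto simp: is_limit_def is_cone_def)
  have E: "i \<in> V \<and> j \<in> V \<and> f \<in> hom C (X i) (X j)" if "(i, f, j) \<in> E" for i f j
    using fd that by (auto simp: finite_diagram_def)
  have "holds (\<lambda>p. \<forall>i\<in>V. l i \<bullet> val p \<xi> = l i \<bullet> val p \<zeta>)"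
    by (rule holds_Ball) (use fd eq eqv_act_iff[OF \<xi> \<zeta> l l] in \<open>auto simp: finite_diagram_def\<close>)
  then show ?thesis unfolding eqv_def
  proof (rule holds_mp)
    show "finite {fst \<xi>, fst \<zeta>}" "{fst \<xi>, fst \<zeta>} \<subseteq> D" using El_D \<xi> \<zeta> by auto
    fix s d p assume s: "{fst \<xi>, fst \<zeta>} \<subseteq> s" "cone_on C s d p"
      "\<forall>i\<in>V. l i \<bullet> val p \<xi> = l i \<bullet> val p \<zeta>"
    have h: "val p \<xi> \<in> hom C d c" "val p \<zeta> \<in> hom C d c" using val_hom \<xi> \<zeta> s by auto
    have "f \<bullet> (l i \<bullet> val p \<xi>) = l j \<bullet> val p \<xi>" if e: "(i, f, j) \<in> E" for i f j
    proof -
      have "i \<in> V" "f \<in> hom C (X i) (X j)" using E[OF e] by auto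
      then show ?thesis using Comp_assoc[OF h(1) l] le[OF e] by simp
    qed
    then have "is_cone C V X E d (\<lambda>i. l i \<bullet> val p \<xi>)"
      using hom_Ob[OF h(1)] Comp_hom[OF h(1) l] by (auto simp: is_cone_def)
    then have "\<exists>!k. k \<in> hom C d c \<and> (\<forall>i\<in>V. l i \<bullet> k = l i \<bullet> val p \<xi>)"
      using lim unfolding is_limit_def by blast
    then show "val p \<xi> = val p \<zeta>" using h s(3) by metis
  qed
qed

text \<open>
  The root is an element of the domain of \<open>a\<close>, and by consistency its image under \<open>a\<close> does not belong
  to \<open>b\<close>.
\<close>

lemma root_El: "(r, Id C (ob r)) \<in> El (ob r)"
  using r_D node_closed_Ob[OF D_closed] Id_hom by (simp add: El_def)

lemma root_not_El:
  assumes \<zeta>: "\<zeta> \<in> El (Dom C b)"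
  shows "\<not> eqv (act b \<zeta>) (act a (r, Id C (ob r)))"
proof
  note bh = monos_into_hom[OF b]
  assume "eqv (act b \<zeta>) (act a (r, Id C (ob r)))"
  then have "holds (\<lambda>p. b \<bullet> val p \<zeta> = a \<bullet> val p (r, Id C (ob r)))"
    using eqv_act_iff[OF \<zeta> root_El bh a] by simp
  then have "holds (\<lambda>p. factors_through C (a \<bullet> p r) b)"
  proof (rule holds_mp)
    show "finite {fst \<zeta>, r}" "{fst \<zeta>, r} \<subseteq> D" using El_D \<zeta> r_D by auto
    fix s c p assume s: "{fst \<zeta>, r} \<subseteq> s" "cone_on C s c p"
      "b \<bullet> val p \<zeta> = a \<bullet> val p (r, Id C (ob r))"
    have pr: "p r \<in> hom C c (ob r)" using cone_on_hom[OF s(2)] s(1) by simp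
    have "val p \<zeta> \<in> hom C c (Dom C b)" using val_hom[OF \<zeta> s(2)] s(1) by simp
    moreover have "b \<bullet> val p \<zeta> = a \<bullet> p r"
      using s(3) Comp_Id_left[OF pr] by (simp add: val_def)
    ultimately show "factors_through C (a \<bullet> p r) b"
      using factors_through_iff[OF Comp_hom[OF pr a] bh] by blast
  qed
  then show False using not_holds_root by blast
qed

text \<open>
  If \<open>\<xi>\<close> does not belong to \<open>e\<close>, then the node asserting that it does is inconsistent with some stage
  \<open>s\<close>. Let \<open>u\<close> be the image of the limit of \<open>s\<close> under \<open>\<xi>\<close>. An object over both \<open>u\<close> and \<open>e\<close> has a cover
  that maps to this limit and on which the inconsistent node can be interpreted; hence this cover
  maps to the initial domain of \<open>b\<close>.
\<close>

lemma El_separate: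
  assumes b0: "is_initial C (Dom C b)" and e: "e \<in> monos_into C y" and \<xi>: "\<xi> \<in> El y"
    and none: "\<And>\<zeta>. \<zeta> \<in> El (Dom C e) \<Longrightarrow> \<not> eqv (act e \<zeta>) \<xi>"
  obtains u \<zeta> where "u \<in> monos_into C y" "\<zeta> \<in> El (Dom C u)" "eqv (act u \<zeta>) \<xi>"
    "\<And>T j k. j \<in> hom C T (Dom C u) \<Longrightarrow> k \<in> hom C T (Dom C e) \<Longrightarrow> u \<bullet> j = e \<bullet> k \<Longrightarrow> is_initial C T"
proof -
  note eh = monos_into_hom[OF e]
  obtain v f where vf: "\<xi> = (v, f)" by fastforce
  then have v: "v \<in> D" and f: "f \<in> hom C (ob v) y" using \<xi> by (auto simp: El_def)
  obtain U q g where q: "q \<in> hom C U (ob v)" "g \<in> hom C U (Dom C e)" "f \<bullet> q = e \<bullet> g"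
    and qu: "\<And>w p' q'. p' \<in> hom C w (ob v) \<Longrightarrow> q' \<in> hom C w (Dom C e) \<Longrightarrow> f \<bullet> p' = e \<bullet> q' \<Longrightarrow>
        \<exists>h\<in>hom C w U. q \<bullet> h = p' \<and> g \<bullet> h = q'"
    using ex_pullback[OF f eh] by metis
  define w where "w = Node U [(q, v)]"
  have wD: "w \<notin> D"
  proof
    assume wD: "w \<in> D"
    have "eqv (act e (w, g)) \<xi>"
      unfolding vf by (rule eqv_via_edge[OF wD _ f _ eh q(3)]) (use q in \<open>auto simp: w_def\<close>)
    moreover have "(w, g) \<in> El (Dom C e)" using wD q by (simp add: El_def w_def)
    ultimately show False using none by blast
  qed
  obtain s where s: "stage s" "forces C a b r (insert w s)" "\<And>k u. (k, u) \<in> set (edges w) \<Longrightarrow> u \<in> s"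
  proof (rule absent_node[OF wD])
    show "ob w \<in> Ob C" using hom_Ob[OF q(1)] by (simp add: w_def)
    show "u \<in> D \<and> k \<in> hom C (ob w) (ob u)" if "(k, u) \<in> set (edges w)" for k u
      using that v q by (simp add: w_def)
  qed blast
  have vs: "v \<in> s" using s(3)[of q v] by (simp add: w_def)
  obtain w' P where w': "w' \<in> D" "cone_on C s (ob w') P" "holds (\<lambda>p. \<forall>v\<in>s. P v \<bullet> p w' = p v)"
    by (rule stage_node[OF s(1)])
  note Pv = cone_on_hom[OF w'(2) vs]
  have fP: "f \<bullet> P v \<in> hom C (ob w') y" using Comp_hom[OF Pv f] .
  obtain u where im: "is_image C (f \<bullet> P v) u" using images fP homD by metis
  have u: "u \<in> monos_into C y" using im homD[OF fP] by (simp add: is_image_def)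
  note uh = monos_into_hom[OF u]
  obtain k where k: "k \<in> hom C (ob w') (Dom C u)" "u \<bullet> k = f \<bullet> P v" "cover k"
    using image_cover[OF im fP] by metis
  have "eqv (act u (w', k)) \<xi>"
    unfolding eqv_def
  proof (rule holds_mp[OF w'(3)])
    show "finite {w'}" "{w'} \<subseteq> D" using w' by auto
    fix t d p assume t: "{w'} \<subseteq> t" "cone_on C t d p" "\<forall>v\<in>s. P v \<bullet> p w' = p v"
    have "p w' \<in> hom C d (ob w')" using cone_on_hom[OF t(2)] t(1) by simp
    then have "(f \<bullet> P v) \<bullet> p w' = f \<bullet> (P v \<bullet> p w')" using Comp_assoc[OF _ Pv f] by simp
    then show "val p (act u (w', k)) = val p \<xi>"
      using k(2) t(3) vs by (simp add: act_def val_def vf)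
  qed
  moreover have "(w', k) \<in> El (Dom C u)" using w'(1) k(1) by (simp add: El_def)
  moreover have "is_initial C T"
    if j: "j \<in> hom C T (Dom C u)" and j': "j' \<in> hom C T (Dom C e)" and jj: "u \<bullet> j = e \<bullet> j'" for T j j'
  proof -
    obtain T' t l where t: "t \<in> hom C T' T" "cover t" and l: "l \<in> hom C T' (ob w')" and tl: "j \<bullet> t = k \<bullet> l"
      using ex_cover_pullback[OF k(1,3) j] by metis
    note Pl = Comp_hom[OF l Pv]
    note jt = Comp_hom[OF t(1) j']
    have "f \<bullet> (P v \<bullet> l) = u \<bullet> (k \<bullet> l)" using comp_eq_comp[OF f Pv uh k(1) _ l] k(2) by simp
    also have "\<dots> = u \<bullet> (j \<bullet> t)" using tl by simp
    also have "\<dots> = e \<bullet> (j' \<bullet> t)" using comp_eq_comp[OF uh j eh j' jj t(1)] .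
    finally obtain h where h: "h \<in> hom C T' U" "q \<bullet> h = P v \<bullet> l" using qu[OF Pl jt] by blast
    have "factors_through C ((a \<bullet> P r) \<bullet> l) b"
      by (rule forced_if_covered[OF s(1) wD s(2,3) w'(2) l]) (use h in \<open>auto simp: w_def\<close>)
    moreover have "(a \<bullet> P r) \<bullet> l \<in> hom C T' x"
      using Comp_hom[OF l Comp_hom[OF cone_on_hom[OF w'(2) stageD(3)[OF s(1)]] a]] .
    ultimately obtain h' where "h' \<in> hom C T' (Dom C b)"
      using factors_through_iff[OF _ monos_into_hom[OF b]] by blast
    then have "is_initial C T'" using initial_strict[OF b0] by blast
    then show ?thesis using cover_from_initial[OF t] by blast
  qed
  ultimately show ?thesis using that[OF u] by blast
qed

end

section \<open>The coherent functor of a generic diagram\<close>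

locale coded_generic_diagram = generic_diagram C a b x r D
  for C :: "('o, 'm) cat" and a b :: 'm and x :: 'o and r :: "('o, 'm) node"
    and D :: "('o, 'm) node set" +
  fixes enc :: "('o, 'm) node \<times> 'm \<Rightarrow> 'u"
  assumes enc: "inj_on enc (D \<times> Ar C)"
begin

text \<open>
  Members of the universe are not sets of elements, so an equivalence class is represented by the
  code of a chosen member.
\<close>

definition cls :: "('o, 'm) node \<times> 'm \<Rightarrow> 'u" where
  "cls \<xi> = enc (SOME \<zeta>. \<zeta> \<in> El (Cod C (snd \<xi>)) \<and> eqv \<zeta> \<xi>)"

lemma cls_eq_iff:
  assumes \<xi>: "\<xi> \<in> El y" and \<zeta>: "\<zeta> \<in> El y"
  shows "cls \<xi> = cls \<zeta> \<longleftrightarrow> eqv \<xi> \<zeta>"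
proof -
  have cod: "Cod C (snd \<theta>) = y" if "\<theta> \<in> El y" for \<theta> using that by (auto simp: El_def hom_def)
  define c where "c = (\<lambda>\<theta>. SOME \<eta>. \<eta> \<in> El y \<and> eqv \<eta> \<theta>)"
  have cls: "cls \<theta> = enc (c \<theta>)" if "\<theta> \<in> El y" for \<theta>
    using cod[OF that] by (simp add: cls_def c_def)
  have c: "c \<theta> \<in> El y \<and> eqv (c \<theta>) \<theta>" if "\<theta> \<in> El y" for \<theta>
    unfolding c_def by (rule someI[of _ \<theta>]) (use that eqv_refl in blast)
  have sub: "El y \<subseteq> D \<times> Ar C" by (auto simp: El_def hom_def)
  show ?thesis
  proof
    assume "cls \<xi> = cls \<zeta>"
    then have "enc (c \<xi>) = enc (c \<zeta>)" using cls[OF \<xi>] cls[OF \<zeta>] by simp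
    moreover have "c \<xi> \<in> D \<times> Ar C" "c \<zeta> \<in> D \<times> Ar C" using c[OF \<xi>] c[OF \<zeta>] sub by auto
    ultimately have "c \<xi> = c \<zeta>" by (rule inj_onD[OF enc])
    moreover have "eqv \<xi> (c \<xi>)" "eqv (c \<zeta>) \<zeta>" using c[OF \<xi>] c[OF \<zeta>] eqv_sym by auto
    ultimately show "eqv \<xi> \<zeta>" by (auto intro: eqv_trans)
  next
    assume e: "eqv \<xi> \<zeta>"
    have "eqv \<eta> \<xi> \<longleftrightarrow> eqv \<eta> \<zeta>" for \<eta> using e eqv_sym eqv_trans by blast
    then show "cls \<xi> = cls \<zeta>" using cls \<xi> \<zeta> by (simp add: c_def)
  qed
qed

definition carrier :: "'o \<Rightarrow> 'u set" where
  "carrier y = cls ` El y"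

definition model :: "('o, 'm, 'u set, 'u set_map) cat_functor" where
  "model = \<lparr>Fo = carrier,
     Fa = (\<lambda>f. (carrier (Dom C f),
       restrict (\<lambda>\<alpha>. cls (act f (inv_into (El (Dom C f)) cls \<alpha>))) (carrier (Dom C f)),
       carrier (Cod C f)))\<rparr>"

lemma Fo_model [simp]: "Fo model = carrier"
  by (simp add: model_def)

lemma app_model:
  assumes f: "f \<in> hom C y z" and \<xi>: "\<xi> \<in> El y"
  shows "app (Fa model f) (cls \<xi>) = cls (act f \<xi>)"
proof -
  let ?\<zeta> = "inv_into (El y) cls (cls \<xi>)"
  have mem: "cls \<xi> \<in> cls ` El y" using \<xi> by blast
  have \<zeta>: "?\<zeta> \<in> El y" "cls ?\<zeta> = cls \<xi>" using inv_into_into[OF mem] f_inv_into_f[OF mem] by auto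
  then have "eqv ?\<zeta> \<xi>" using cls_eq_iff[OF \<zeta>(1) \<xi>] by simp
  then have "cls (act f ?\<zeta>) = cls (act f \<xi>)"
    using act_eqv[OF _ \<zeta>(1) \<xi> f] cls_eq_iff[OF act_El[OF \<zeta>(1) f] act_El[OF \<xi> f]] by simp
  then show ?thesis using mem homD[OF f] by (simp add: model_def carrier_def)
qed

lemma model_hom:
  assumes f: "f \<in> hom C y z"
  shows "Fa model f \<in> hom set_cat (carrier y) (carrier z)"
proof -
  have "cls (act f (inv_into (El y) cls \<alpha>)) \<in> carrier z" if "\<alpha> \<in> carrier y" for \<alpha>
    unfolding carrier_def
    by (intro imageI act_El[OF inv_into_into f]) (use that in \<open>simp add: carrier_def\<close>)
  then show ?thesis using homD[OF f] by (auto simp: model_def intro!: restrict_hom_set_cat)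
qed

lemma act_Id: "\<xi> \<in> El y \<Longrightarrow> act (Id C y) \<xi> = \<xi>"
  using Comp_Id_left by (auto simp: El_def act_def)

lemma act_comp:
  assumes "f \<in> hom C y z" "g \<in> hom C z w" "\<xi> \<in> El y"
  shows "act (g \<bullet> f) \<xi> = act g (act f \<xi>)"
  using Comp_assoc[OF _ assms(1,2)] assms(3) by (auto simp: El_def act_def)

lemma model_functor: "is_functor C set_cat model"
proof -
  interpret S: category "set_cat :: ('u set, 'u set_map) cat" by (rule category_set_cat)
  have "Fa model (Id C y) = Id set_cat (carrier y)" if y: "y \<in> Ob C" for y
  proof (rule set_map_eqI[OF model_hom[OF Id_hom[OF y]] S.Id_hom])
    show "carrier y \<in> Ob set_cat" by (simp add: set_cat_def)
    fix \<alpha> assume "\<alpha> \<in> carrier y"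
    then show "app (Fa model (Id C y)) \<alpha> = app (Id set_cat (carrier y)) \<alpha>"
      using app_model[OF Id_hom[OF y]] act_Id by (auto simp: carrier_def set_cat_def)
  qed
  moreover have "Fa model (g \<bullet> f) = Comp set_cat (Fa model g) (Fa model f)"
    if f: "f \<in> hom C y z" and g: "g \<in> hom C z w" for f g y z w
  proof (rule set_map_eqI[OF model_hom[OF Comp_hom[OF f g]] S.Comp_hom[OF model_hom[OF f] model_hom[OF g]]])
    fix \<alpha> assume \<alpha>: "\<alpha> \<in> carrier y"
    then obtain \<xi> where \<xi>: "\<xi> \<in> El y" "\<alpha> = cls \<xi>" by (auto simp: carrier_def)
    show "app (Fa model (g \<bullet> f)) \<alpha> = app (Comp set_cat (Fa model g) (Fa model f)) \<alpha>"
      using app_Comp[OF model_hom[OF f] model_hom[OF g] \<alpha>] app_model[OF Comp_hom[OF f g] \<xi>(1)]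
        app_model[OF f \<xi>(1)] app_model[OF g act_El[OF \<xi>(1) f]] act_comp[OF f g \<xi>(1)] \<xi>(2) by simp
  qed
  ultimately show ?thesis
    using model_hom by (auto simp: is_functor_def set_cat_def[THEN arg_cong, of Ob])
qed

lemma map_range_model_iff:
  assumes f: "f \<in> hom C y z" and \<zeta>: "\<zeta> \<in> El z"
  shows "cls \<zeta> \<in> map_range (Fa model f) \<longleftrightarrow> (\<exists>\<xi>\<in>El y. eqv (act f \<xi>) \<zeta>)"
proof -
  have "cls \<zeta> \<in> map_range (Fa model f) \<longleftrightarrow> (\<exists>\<xi>\<in>El y. app (Fa model f) (cls \<xi>) = cls \<zeta>)"
    unfolding map_range_eq[OF model_hom[OF f]] carrier_def image_image image_iff by metis
  also have "\<dots> \<longleftrightarrow> (\<exists>\<xi>\<in>El y. eqv (act f \<xi>) \<zeta>)"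
    using app_model[OF f] cls_eq_iff[OF act_El[OF _ f] \<zeta>] by auto
  finally show ?thesis .
qed

lemma model_mono:
  assumes m: "m \<in> monos_into C z"
  shows "Fa model m \<in> monos_into set_cat (carrier z)"
proof -
  note mh = monos_into_hom[OF m]
  have "inj_on (app (Fa model m)) (carrier (Dom C m))"
  proof (rule inj_onI)
    fix \<alpha> \<beta> assume "\<alpha> \<in> carrier (Dom C m)" "\<beta> \<in> carrier (Dom C m)"
      and eq: "app (Fa model m) \<alpha> = app (Fa model m) \<beta>"
    then obtain \<xi> \<zeta> where \<xi>: "\<xi> \<in> El (Dom C m)" "\<alpha> = cls \<xi>" and \<zeta>: "\<zeta> \<in> El (Dom C m)" "\<beta> = cls \<zeta>"
      by (auto simp: carrier_def)
    have "eqv (act m \<xi>) (act m \<zeta>)"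
      using eq app_model[OF mh] \<xi> \<zeta> cls_eq_iff[OF act_El[OF \<xi>(1) mh] act_El[OF \<zeta>(1) mh]] by simp
    then show "\<alpha> = \<beta>" using El_mono[OF m \<xi>(1) \<zeta>(1)] cls_eq_iff[OF \<xi>(1) \<zeta>(1)] \<xi>(2) \<zeta>(2) by simp
  qed
  then show ?thesis using monos_into_set_cat_iff[OF model_hom[OF mh]] by simp
qed

lemma model_range_mono:
  assumes f: "f \<in> hom C y z" and g: "g \<in> hom C w z" and fac: "factors_through C f g"
  shows "map_range (Fa model f) \<subseteq> map_range (Fa model g)"
proof
  fix \<alpha> assume "\<alpha> \<in> map_range (Fa model f)"
  then obtain \<xi> where \<xi>: "\<xi> \<in> El y" "\<alpha> = cls (act f \<xi>)"
    using map_range_eq[OF model_hom[OF f]] app_model[OF f] by (auto simp: carrier_def)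
  obtain h where h: "h \<in> hom C y w" "g \<bullet> h = f" using fac factors_through_iff[OF f g] by blast
  have "act f \<xi> = act g (act h \<xi>)" using act_comp[OF h(1) g \<xi>(1)] h(2) by simp
  then show "\<alpha> \<in> map_range (Fa model g)"
    using map_range_model_iff[OF g act_El[OF \<xi>(1) f]] act_El[OF \<xi>(1) h(1)] eqv_refl \<xi>(2) by metis
qed

lemma model_limit:
  assumes fd: "finite_diagram C V X E" and lim: "is_limit C V X E c l"
  shows "is_limit set_cat V (\<lambda>i. carrier (X i)) ((\<lambda>(i, f, j). (i, Fa model f, j)) ` E)
    (carrier c) (\<lambda>i. Fa model (l i))"
proof -
  have l: "l i \<in> hom C c (X i)" if "i \<in> V" for i using lim that by (auto simp: is_limit_def is_cone_def)
  have le: "f \<bullet> l i = l j" if "(i, f, j) \<in> E" for i f j using lim that by (auto simp: is_limit_def is_cone_def)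
  have E: "i \<in> V \<and> j \<in> V \<and> f \<in> hom C (X i) (X j)" if "(i, f, j) \<in> E" for i f j
    using fd that by (auto simp: finite_diagram_def)
  show ?thesis
  proof (rule set_limitI)
    show "Fa model (l i) \<in> hom set_cat (carrier c) (carrier (X i))" if "i \<in> V" for i
      using model_hom[OF l[OF that]] .
  next
    fix i F j assume "(i, F, j) \<in> (\<lambda>(i, f, j). (i, Fa model f, j)) ` E"
    then obtain f where e: "(i, f, j) \<in> E" and F: "F = Fa model f" by auto
    have i: "i \<in> V" and j: "j \<in> V" and f: "f \<in> hom C (X i) (X j)" using E[OF e] by auto
    have "app F (app (Fa model (l i)) \<alpha>) = app (Fa model (l j)) \<alpha>" if \<alpha>: "\<alpha> \<in> carrier c" for \<alpha>
    proof -
      obtain \<xi> where \<xi>: "\<xi> \<in> El c" "\<alpha> = cls \<xi>" using \<alpha> unfolding carrier_def by blast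
      show ?thesis
        using app_model[OF l[OF i] \<xi>(1)] app_model[OF l[OF j] \<xi>(1)] app_model[OF f act_El[OF \<xi>(1) l[OF i]]]
          act_comp[OF l[OF i] f \<xi>(1)] le[OF e] F \<xi>(2) by simp
    qed
    then show "i \<in> V \<and> j \<in> V \<and> F \<in> hom set_cat (carrier (X i)) (carrier (X j)) \<and>
        (\<forall>\<alpha>\<in>carrier c. app F (app (Fa model (l i)) \<alpha>) = app (Fa model (l j)) \<alpha>)"
      using i j model_hom[OF f] F by blast
  next
    fix y assume y: "\<And>i. i \<in> V \<Longrightarrow> y i \<in> carrier (X i)"
      and comm: "\<And>i F j. (i, F, j) \<in> (\<lambda>(i, f, j). (i, Fa model f, j)) ` E \<Longrightarrow> app F (y i) = y j"
    have "\<exists>\<xi>. \<xi> \<in> El (X i) \<and> y i = cls \<xi>" if "i \<in> V" for i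
      using y[OF that] by (auto simp: carrier_def)
    then obtain \<xi> where \<xi>: "\<And>i. i \<in> V \<Longrightarrow> \<xi> i \<in> El (X i)" "\<And>i. i \<in> V \<Longrightarrow> y i = cls (\<xi> i)" by metis
    have "eqv (act f (\<xi> i)) (\<xi> j)" if e: "(i, f, j) \<in> E" for i f j
    proof -
      have i: "i \<in> V" and j: "j \<in> V" and f: "f \<in> hom C (X i) (X j)" using E[OF e] by auto
      have "app (Fa model f) (y i) = y j" by (rule comm) (use e in force)
      then show ?thesis
        using app_model[OF f \<xi>(1)[OF i]] \<xi>(2)[OF i] \<xi>(2)[OF j]
          cls_eq_iff[OF act_El[OF \<xi>(1)[OF i] f] \<xi>(1)[OF j]] by simp
    qed
    then obtain \<zeta> where \<zeta>: "\<zeta> \<in> El c" "\<And>i. i \<in> V \<Longrightarrow> eqv (act (l i) \<zeta>) (\<xi> i)"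
      using El_limit_exists[OF fd lim, of \<xi>] \<xi>(1) by blast
    have "app (Fa model (l i)) (cls \<zeta>) = y i" if i: "i \<in> V" for i
      using app_model[OF l[OF i] \<zeta>(1)] \<zeta>(2)[OF i] \<xi>(2)[OF i]
        cls_eq_iff[OF act_El[OF \<zeta>(1) l[OF i]] \<xi>(1)[OF i]] by simp
    then show "\<exists>\<alpha>\<in>carrier c. \<forall>i\<in>V. app (Fa model (l i)) \<alpha> = y i"
      using \<zeta>(1) by (intro bexI[of _ "cls \<zeta>"]) (auto simp: carrier_def)
  next
    fix \<alpha> \<beta> assume "\<alpha> \<in> carrier c" "\<beta> \<in> carrier c"
      and eq: "\<And>i. i \<in> V \<Longrightarrow> app (Fa model (l i)) \<alpha> = app (Fa model (l i)) \<beta>"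
    then obtain \<xi> \<zeta> where \<xi>: "\<xi> \<in> El c" "\<alpha> = cls \<xi>" and \<zeta>: "\<zeta> \<in> El c" "\<beta> = cls \<zeta>"
      by (auto simp: carrier_def)
    have "eqv (act (l i) \<xi>) (act (l i) \<zeta>)" if i: "i \<in> V" for i
      using eq[OF i] app_model[OF l[OF i]] \<xi> \<zeta>
        cls_eq_iff[OF act_El[OF \<xi>(1) l[OF i]] act_El[OF \<zeta>(1) l[OF i]]] by simp
    then have "eqv \<xi> \<zeta>" using El_limit_unique[OF fd lim \<xi>(1) \<zeta>(1)] by blast
    then show "\<alpha> = \<beta>" using cls_eq_iff[OF \<xi>(1) \<zeta>(1)] \<xi>(2) \<zeta>(2) by simp
  qed
qed

lemma factors_through_model_iff:
  assumes f: "f \<in> hom C y z" and F: "F \<in> hom set_cat A (carrier z)"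
  shows "factors_through set_cat (Fa model f) F \<longleftrightarrow> map_range (Fa model f) \<subseteq> map_range F"
  using factors_through_set_cat_iff[OF model_hom[OF f] F] map_range_eq[OF F] map_range_eq[OF model_hom[OF f]]
  by simp

text \<open>
  Covers become surjections by \<open>El_lift_cover\<close>, so the range of \<open>f\<close> equals that of its image.
\<close>

lemma model_image:
  assumes f: "f \<in> Ar C" and im: "is_image C f m"
  shows "is_image set_cat (Fa model f) (Fa model m)"
proof -
  interpret S: category "set_cat :: ('u set, 'u set_map) cat" by (rule category_set_cat)
  note fh = Ar_hom[OF f]
  have m: "m \<in> monos_into C (Cod C f)" and fac: "factors_through C f m"
    using im by (auto simp: is_image_def)
  note mh = monos_into_hom[OF m]
  obtain e where e: "e \<in> hom C (Dom C f) (Dom C m)" "m \<bullet> e = f" "cover e"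
    using image_cover[OF im fh] by blast
  have "map_range (Fa model m) \<subseteq> map_range (Fa model f)"
  proof
    fix \<alpha> assume "\<alpha> \<in> map_range (Fa model m)"
    then obtain \<xi> where \<xi>: "\<xi> \<in> El (Dom C m)" "\<alpha> = cls (act m \<xi>)"
      using map_range_eq[OF model_hom[OF mh]] app_model[OF mh] by (auto simp: carrier_def)
    obtain \<zeta> where \<zeta>: "\<zeta> \<in> El (Dom C f)" "eqv (act e \<zeta>) \<xi>"
      using El_lift_cover[OF \<xi>(1) e(1,3)] by blast
    have "eqv (act f \<zeta>) (act m \<xi>)"
      using act_eqv[OF \<zeta>(2) act_El[OF \<zeta>(1) e(1)] \<xi>(1) mh] act_comp[OF e(1) mh \<zeta>(1)] e(2) by simp
    then show "\<alpha> \<in> map_range (Fa model f)"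
      using map_range_model_iff[OF fh act_El[OF \<xi>(1) mh]] \<zeta>(1) \<xi>(2) by blast
  qed
  then have least: "factors_through set_cat (Fa model m) N"
    if N: "N \<in> monos_into set_cat (carrier (Cod C f))" "factors_through set_cat (Fa model f) N" for N
    using factors_through_model_iff[OF fh S.monos_into_hom[OF N(1)]] N(2)
      factors_through_model_iff[OF mh S.monos_into_hom[OF N(1)]] by blast
  have "factors_through set_cat (Fa model f) (Fa model m)"
    using factors_through_model_iff[OF fh model_hom[OF mh]] model_range_mono[OF fh mh fac] by blast
  then show ?thesis
    unfolding is_image_def using least model_mono[OF m] S.homD[OF model_hom[OF fh]] by auto
qed

lemma model_union:
  assumes S: "finite S" "S \<subseteq> monos_into C y" and m: "is_union C y S m"
  shows "is_union set_cat (carrier y) (Fa model ` S) (Fa model m)"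
proof -
  interpret S: category "set_cat :: ('u set, 'u set_map) cat" by (rule category_set_cat)
  have mm: "m \<in> monos_into C y" using m by (simp add: is_union_def)
  note mh = monos_into_hom[OF mm]
  have up: "factors_through set_cat (Fa model \<alpha>) (Fa model m)" if "\<alpha> \<in> S" for \<alpha>
  proof -
    have \<alpha>: "\<alpha> \<in> hom C (Dom C \<alpha>) y" using monos_into_hom S(2) that by blast
    have "sub_le C \<alpha> m" using m that by (simp add: is_union_def)
    then show ?thesis
      using factors_through_model_iff[OF \<alpha> model_hom[OF mh]] model_range_mono[OF \<alpha> mh] by blast
  qed
  have cov: "map_range (Fa model m) \<subseteq> (\<Union>\<alpha>\<in>S. map_range (Fa model \<alpha>))"
  proof
    fix \<beta> assume "\<beta> \<in> map_range (Fa model m)"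
    then obtain \<xi> where \<xi>: "\<xi> \<in> El (Dom C m)" "\<beta> = cls (act m \<xi>)"
      using map_range_eq[OF model_hom[OF mh]] app_model[OF mh] by (auto simp: carrier_def)
    note m\<xi> = act_El[OF \<xi>(1) mh]
    have "holds (\<lambda>p. factors_through C (val p (act m \<xi>)) m)"
    proof (rule holdsI[of "{fst \<xi>}"])
      show "{fst \<xi>} \<subseteq> D" using El_D \<xi> by auto
      fix s c p assume s: "{fst \<xi>} \<subseteq> s" "cone_on C s c p"
      have v: "val p \<xi> \<in> hom C c (Dom C m)" using val_hom[OF \<xi>(1) s(2)] s(1) by simp
      have "val p (act m \<xi>) = m \<bullet> val p \<xi>" using val_act[OF \<xi>(1) mh s(2)] s(1) by simp
      then show "factors_through C (val p (act m \<xi>)) m"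
        using v factors_through_iff[OF Comp_hom[OF v mh] mh] by auto
    qed simp
    then obtain \<alpha> \<zeta> where \<alpha>: "\<alpha> \<in> S" "\<zeta> \<in> El (Dom C \<alpha>)" "eqv (act \<alpha> \<zeta>) (act m \<xi>)"
      using El_union[OF S m m\<xi>] by blast
    then have "\<beta> \<in> map_range (Fa model \<alpha>)"
      using map_range_model_iff[OF monos_into_hom m\<xi>, of \<alpha>] S(2) \<xi>(2) by blast
    then show "\<beta> \<in> (\<Union>\<alpha>\<in>S. map_range (Fa model \<alpha>))" using \<alpha>(1) by blast
  qed
  have least: "factors_through set_cat (Fa model m) N"
    if N: "N \<in> monos_into set_cat (carrier y)" "\<forall>A\<in>Fa model ` S. factors_through set_cat A N" for N
  proof -
    note Nh = S.monos_into_hom[OF N(1)]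
    have "map_range (Fa model \<alpha>) \<subseteq> map_range N" if "\<alpha> \<in> S" for \<alpha>
      using factors_through_model_iff[OF monos_into_hom Nh, of \<alpha>] S(2) N(2) that by blast
    then show ?thesis using cov factors_through_model_iff[OF mh Nh] by blast
  qed
  show ?thesis unfolding is_union_def using model_mono[OF mm] up least by auto
qed

theorem model_coherent: "coherent_functor C set_cat model"
  unfolding coherent_functor_def
  using model_functor model_limit model_image model_union by auto

lemma model_root: "\<exists>\<alpha>\<in>carrier (ob r). app (Fa model a) \<alpha> \<notin> map_range (Fa model b)"
proof
  show "cls (r, Id C (ob r)) \<in> carrier (ob r)" using root_El by (simp add: carrier_def)
  show "app (Fa model a) (cls (r, Id C (ob r))) \<notin> map_range (Fa model b)"
    using app_model[OF a root_El] map_range_model_iff[OF monos_into_hom[OF b] act_El[OF root_El a]]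
      root_not_El by auto
qed

text \<open>
  When \<open>b\<close> is the empty subobject, the model is positively closed.
\<close>

lemma model_separate:
  assumes "is_initial C (Dom C b)" "e \<in> monos_into C y" "\<alpha> \<in> carrier y" "\<alpha> \<notin> map_range (Fa model e)"
  shows "\<exists>u\<in>monos_into C y. \<alpha> \<in> map_range (Fa model u) \<and>
    (\<forall>T j k. j \<in> hom C T (Dom C u) \<and> k \<in> hom C T (Dom C e) \<and> u \<bullet> j = e \<bullet> k \<longrightarrow> is_initial C T)"
proof -
  obtain \<xi> where \<xi>: "\<xi> \<in> El y" "\<alpha> = cls \<xi>" using assms(3) by (auto simp: carrier_def)
  have "\<not> eqv (act e \<zeta>) \<xi>" if "\<zeta> \<in> El (Dom C e)" for \<zeta>
    using map_range_model_iff[OF monos_into_hom[OF assms(2)] \<xi>(1)] assms(4) that \<xi>(2) by blast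
  from El_separate[OF assms(1,2) \<xi>(1) this] obtain u \<zeta> where
    u: "u \<in> monos_into C y" "\<zeta> \<in> El (Dom C u)" "eqv (act u \<zeta>) \<xi>"
    "\<And>T j k. j \<in> hom C T (Dom C u) \<Longrightarrow> k \<in> hom C T (Dom C e) \<Longrightarrow> u \<bullet> j = e \<bullet> k \<Longrightarrow> is_initial C T"
    by blast
  then have "\<alpha> \<in> map_range (Fa model u)"
    using map_range_model_iff[OF monos_into_hom[OF u(1)] \<xi>(1)] \<xi>(2) by blast
  then show ?thesis using u(1,4) by blast
qed

end

section \<open>Existence of coherent functors\<close>

lemma infinite_pairing:
  assumes "infinite (UNIV :: 'u set)"
  obtains pr :: "'u \<times> 'u \<Rightarrow> 'u" where "inj pr"
proof -
  have "(card_of ((UNIV :: 'u set) \<times> (UNIV :: 'u set)), card_of (UNIV :: 'u set)) \<in> ordIso"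
    using card_of_Times_same_infinite[OF assms] .
  then obtain pr :: "'u \<times> 'u \<Rightarrow> 'u" where "bij_betw pr (UNIV \<times> UNIV) UNIV"
    using card_of_ordIso by blast
  then have "inj pr" by (simp add: bij_betw_def)
  then show ?thesis using that by blast
qed

lemma infinite_list_code:
  assumes inf: "infinite (UNIV :: 'u set)"
  obtains lc :: "'u list \<Rightarrow> 'u" where "inj lc"
proof -
  obtain pr :: "'u \<times> 'u \<Rightarrow> 'u" where pr: "inj pr" using infinite_pairing[OF inf] .
  obtain n :: "nat \<Rightarrow> 'u" where n: "inj n" using infinite_countable_subset[OF inf] by metis
  define fd where "fd = (\<lambda>xs. foldr (\<lambda>x y. pr (x, y)) xs undefined)"
  have fd: "fd xs = fd ys \<Longrightarrow> xs = ys" if "length xs = length ys" for xs ys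
    using that by (induction xs ys rule: list_induct2) (auto simp: fd_def dest: injD[OF pr])
  have "inj (\<lambda>xs. pr (n (length xs), fd xs))"
    by (rule injI) (auto dest!: injD[OF pr] injD[OF n] fd)
  then show ?thesis using that by blast
qed

text \<open>
  Nodes are well-founded trees labelled by objects and arrows; \<open>pr\<close> and \<open>lc\<close> code pairs and lists of
  members of the universe by members of the universe.
\<close>

primrec node_code :: "('o \<Rightarrow> 'u) \<Rightarrow> ('m \<Rightarrow> 'u) \<Rightarrow> ('u \<times> 'u \<Rightarrow> 'u) \<Rightarrow> ('u list \<Rightarrow> 'u) \<Rightarrow>
    ('o, 'm) node \<Rightarrow> 'u" where
  "node_code io ia pr lc (Node y es) =
     pr (io y, lc (map (\<lambda>(f, k). pr (ia f, k)) (map (map_prod id (node_code io ia pr lc)) es)))"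

lemma inj_on_node_code:
  assumes inj: "inj_on io (Ob C)" "inj_on ia (Ar C)" "inj pr" "inj lc" and s: "node_closed C s"
  shows "inj_on (node_code io ia pr lc) s"
proof -
  let ?c = "node_code io ia pr lc"
  have "\<forall>v'\<in>s. ?c v = ?c v' \<longrightarrow> v = v'" if "v \<in> s" for v
    using that
  proof (induction v)
    case (Node y es)
    show ?case
    proof (intro ballI impI)
      fix v' assume v': "v' \<in> s" and eq: "?c (Node y es) = ?c v'"
      obtain y' es' where n': "v' = Node y' es'" by (cases v')
      have "pr (io y, lc (map (\<lambda>(f, k). pr (ia f, ?c k)) es)) =
          pr (io y', lc (map (\<lambda>(f, k). pr (ia f, ?c k)) es'))"
        using eq n' by (simp add: comp_def case_prod_unfold)
      then have io: "io y = io y'"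
        and m: "map (\<lambda>(f, k). pr (ia f, ?c k)) es = map (\<lambda>(f, k). pr (ia f, ?c k)) es'"
        using inj(3,4) by (simp_all add: inj_eq)
      have "y = y'"
        using inj_onD[OF inj(1) io] node_closed_Ob[OF s Node.prems] node_closed_Ob[OF s v'] n' by simp
      moreover have "es = es'"
      proof (rule nth_equalityI)
        show len: "length es = length es'" using m map_eq_imp_length_eq by blast
        fix i assume i: "i < length es"
        obtain f k f' k' where e: "es ! i = (f, k)" "es' ! i = (f', k')" by fastforce
        have fk: "(f, k) \<in> set es" "(f', k') \<in> set es'" using e i len nth_mem by metis+
        have "pr (ia f, ?c k) = pr (ia f', ?c k')"
          using arg_cong[OF m, of "\<lambda>l. l ! i"] e i len by simp
        then have ia: "ia f = ia f'" and c: "?c k = ?c k'" using injD[OF inj(3)] by auto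
        have k: "k \<in> s" "f \<in> hom C y (ob k)" using node_closed_edge[OF s Node.prems, of f k] fk by auto
        have k': "k' \<in> s" "f' \<in> hom C y' (ob k')" using node_closed_edge[OF s v', of f' k'] fk n' by auto
        have "f = f'" using inj_onD[OF inj(2) ia] k k' by (auto simp: hom_def)
        moreover have "k = k'" using Node.IH[OF fk(1)] k(1) k'(1) c by simp
        ultimately show "es ! i = es' ! i" using e by simp
      qed
      ultimately show "Node y es = v'" using n' by simp
    qed
  qed
  then show ?thesis by (auto intro: inj_onI)
qed

text \<open>
  Every negative fact about an element is witnessed by a positive one that contradicts it.
  Disjointness of \<open>u\<close> and \<open>b\<close> is expressed by commutative squares over them.
\<close>

definition positively_closed ::
  "('o, 'm) cat \<Rightarrow> ('o, 'm, 'u set, 'u set_map) cat_functor \<Rightarrow> bool" where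
  "positively_closed C M \<longleftrightarrow>
     (\<forall>x. \<forall>b\<in>monos_into C x. \<forall>\<alpha>\<in>Fo M x. \<alpha> \<notin> map_range (Fa M b) \<longrightarrow>
       (\<exists>u\<in>monos_into C x. \<alpha> \<in> map_range (Fa M u) \<and>
         (\<forall>T j k. j \<in> hom C T (Dom C u) \<and> k \<in> hom C T (Dom C b) \<and> Comp C u j = Comp C b k \<longrightarrow>
           is_initial C T)))"

text \<open>
  Completeness of coherent logic. The second part rests on maximality of the generic diagram: when
  \<open>b\<close> is the empty subobject, consistency is plain non-degeneracy.
\<close>

lemma ex_separating_functor:
  fixes C :: "('o, 'm) cat"
  assumes C: "coherent_category C" and small: "small_in TYPE('u) C"
    and a: "a \<in> hom C y x" and b: "b \<in> monos_into C x" and ab: "\<not> factors_through C a b"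
  obtains M :: "('o, 'm, 'u set, 'u set_map) cat_functor" where
    "coherent_functor C set_cat M"
    "\<exists>\<alpha>\<in>Fo M y. app (Fa M a) \<alpha> \<notin> map_range (Fa M b)"
    "is_initial C (Dom C b) \<longrightarrow> positively_closed C M"
proof -
  interpret coherent_category C by (rule C)
  obtain r D where rD: "ob r = y" "consistent C a b r D"
    "\<And>D'. consistent C a b r D' \<Longrightarrow> D \<subseteq> D' \<Longrightarrow> D' = D"
    using ex_maximal_consistent[OF a b ab] by blast
  then interpret G: generic_diagram C a b x r D
    using a b by unfold_locales auto
  have inf: "infinite (UNIV :: 'u set)" using small by (simp add: small_in_def)
  obtain pr :: "'u \<times> 'u \<Rightarrow> 'u" where pr: "inj pr" using infinite_pairing[OF inf] .
  obtain lc :: "'u list \<Rightarrow> 'u" where lc: "inj lc" using infinite_list_code[OF inf] .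
  obtain ia :: "'m \<Rightarrow> 'u" where ia: "inj_on ia (Ar C)"
    using small by (auto simp: small_in_def lepoll_def)
  have "inj_on (ia \<circ> Id C) (Ob C)"
  proof (rule comp_inj_on)
    show "inj_on (Id C) (Ob C)" by (rule inj_onI) (metis Id_hom homD)
    show "inj_on ia (Id C ` Ob C)" by (rule inj_on_subset[OF ia]) (use Id_hom homD in blast)
  qed
  from inj_on_node_code[OF this ia pr lc G.D_closed]
  have nc: "inj_on (node_code (ia \<circ> Id C) ia pr lc) D" .
  have "inj_on (\<lambda>(v, f). pr (node_code (ia \<circ> Id C) ia pr lc v, ia f)) (D \<times> Ar C)"
    by (rule inj_onI) (auto dest!: injD[OF pr] dest: inj_onD[OF nc] inj_onD[OF ia])
  then interpret G: coded_generic_diagram C a b x r D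
    "\<lambda>(v, f). pr (node_code (ia \<circ> Id C) ia pr lc v, ia f)"
    by unfold_locales
  show ?thesis
    using that[OF G.model_coherent] G.model_root G.model_separate rD(1)
    by (simp add: positively_closed_def)
qed

section \<open>Properties of coherent functors to sets\<close>

locale set_model = coherent_category C for C :: "('o, 'm) cat" +
  fixes M :: "('o, 'm, 'u set, 'u set_map) cat_functor"
  assumes coherent: "coherent_functor C set_cat M"
begin

lemma M_hom: "f \<in> hom C x y \<Longrightarrow> Fa M f \<in> hom set_cat (Fo M x) (Fo M y)"
  using coherent by (auto simp: coherent_functor_def is_functor_def)

lemma M_app_mem: "f \<in> hom C x y \<Longrightarrow> \<alpha> \<in> Fo M x \<Longrightarrow> app (Fa M f) \<alpha> \<in> Fo M y"
  using M_hom app_mem by metis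

lemma M_range: "f \<in> hom C x y \<Longrightarrow> map_range (Fa M f) = app (Fa M f) ` Fo M x"
  using map_range_eq[OF M_hom] .

lemma M_app_Comp:
  assumes "f \<in> hom C x y" "g \<in> hom C y z" "\<alpha> \<in> Fo M x"
  shows "app (Fa M (g \<bullet> f)) \<alpha> = app (Fa M g) (app (Fa M f) \<alpha>)"
proof -
  have "Fa M (g \<bullet> f) = Comp set_cat (Fa M g) (Fa M f)"
    using coherent assms unfolding coherent_functor_def is_functor_def by blast
  then show ?thesis using app_Comp[OF M_hom[OF assms(1)] M_hom[OF assms(2)] assms(3)] by simp
qed

lemma M_app_Id:
  assumes "x \<in> Ob C" "\<alpha> \<in> Fo M x"
  shows "app (Fa M (Id C x)) \<alpha> = \<alpha>"
proof -
  have "Fa M (Id C x) = Id set_cat (Fo M x)"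
    using coherent assms(1) by (simp add: coherent_functor_def is_functor_def)
  then show ?thesis using assms(2) by (simp add: set_cat_def)
qed

lemma M_range_mono:
  assumes f: "f \<in> hom C y z" and g: "g \<in> hom C w z" and fac: "factors_through C f g"
  shows "map_range (Fa M f) \<subseteq> map_range (Fa M g)"
proof -
  obtain h where h: "h \<in> hom C y w" "g \<bullet> h = f" using fac factors_through_iff[OF f g] by blast
  show ?thesis unfolding M_range[OF f] M_range[OF g]
    using M_app_Comp[OF h(1) g] M_app_mem[OF h(1)] h(2) by auto
qed

text \<open>
  The identity of an initial object is an empty union of subobjects, and so is its image under \<open>M\<close>.
\<close>

lemma M_initial:
  assumes z: "is_initial C z" shows "Fo M z = {}"
proof -
  interpret S: category "set_cat :: ('u set, 'u set_map) cat" by (rule category_set_cat)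
  have zO: "z \<in> Ob C" using z by (simp add: is_initial_def)
  have "is_union C z {} (Id C z)" using z initial_iff_void void_iff_union by simp
  then have u: "is_union set_cat (Fo M z) {} (Fa M (Id C z))"
    using coherent zO unfolding coherent_functor_def by fastforce
  have N: "({}, restrict (\<lambda>x. x) {}, Fo M z) \<in> hom set_cat {} (Fo M z)"
    by (rule restrict_hom_set_cat) simp
  then have "({}, restrict (\<lambda>x. x) {}, Fo M z) \<in> monos_into set_cat (Fo M z)"
    by (simp add: monos_into_set_cat_iff)
  then have "factors_through set_cat (Fa M (Id C z)) ({}, restrict (\<lambda>x. x) {}, Fo M z)"
    using u by (simp add: is_union_def)
  then have "app (Fa M (Id C z)) ` Fo M z \<subseteq> {}"
    using factors_through_set_cat_iff[OF M_hom[OF Id_hom[OF zO]] N] by simp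
  then show ?thesis by simp
qed

lemma M_terminal:
  assumes t: "is_terminal C t" shows "\<exists>!\<alpha>. \<alpha> \<in> Fo M t"
proof -
  have fd: "finite_diagram C {} (\<lambda>_. undefined) {}" by (simp add: finite_diagram_def)
  have "is_limit C {} (\<lambda>_. undefined) {} t (\<lambda>_. undefined)"
    using t by (auto simp: is_limit_def is_cone_def is_terminal_def)
  with fd have "is_limit set_cat {} (\<lambda>i. Fo M undefined) {} (Fo M t) (\<lambda>_. Fa M undefined)"
    using coherent unfolding coherent_functor_def by fastforce
  from set_limitD[OF this] show ?thesis by simp
qed

text \<open>
  The two elements form a point of the pullback, which the functor preserves.
\<close>

lemma M_pullback_inhabited:
  assumes f: "f \<in> hom C x z" and g: "g \<in> hom C y z" and \<alpha>: "\<alpha> \<in> Fo M x" and \<beta>: "\<beta> \<in> Fo M y"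
    and eq: "app (Fa M f) \<alpha> = app (Fa M g) \<beta>"
  obtains P p q where "p \<in> hom C P x" "q \<in> hom C P y" "f \<bullet> p = g \<bullet> q" "Fo M P \<noteq> {}"
proof -
  define X where "X = (\<lambda>i::nat. if i = 0 then x else if i = 1 then y else z)"
  define E where "E = {(0::nat, f, 2::nat), (1, g, 2)}"
  have fd: "finite_diagram C {0,1,2} X E"
    using hom_Ob[OF f] hom_Ob[OF g] f g by (auto simp: finite_diagram_def X_def E_def)
  from finite_limits[OF this] obtain c p where l: "is_limit C {0,1,2} X E c p" by blast
  then have p: "p 0 \<in> hom C c x" "p 1 \<in> hom C c y" "f \<bullet> p 0 = p 2" "g \<bullet> p 1 = p 2"
    by (auto simp: is_limit_def is_cone_def X_def E_def)
  define E' where "E' = (\<lambda>(i, f, j). (i, Fa M f, j)) ` E"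
  have E': "(i, F, j) \<in> E' \<longleftrightarrow> i = 0 \<and> F = Fa M f \<and> j = 2 \<or> i = 1 \<and> F = Fa M g \<and> j = 2" for i F j
    by (auto simp: E'_def E_def)
  have sl: "is_limit set_cat {0,1,2} (\<lambda>i. Fo M (X i)) E' (Fo M c) (\<lambda>i. Fa M (p i))"
    using coherent fd l unfolding coherent_functor_def E'_def by blast
  have "\<exists>!l. l \<in> Fo M c \<and> (\<forall>i\<in>{0,1,2}. app (Fa M (p i)) l =
      (if i = 0 then \<alpha> else if i = 1 then \<beta> else app (Fa M f) \<alpha>))"
    by (rule set_limitD[OF sl])
      (use M_hom[OF f] M_hom[OF g] \<alpha> \<beta> eq M_app_mem[OF g \<beta>] in \<open>auto simp: E' X_def\<close>)
  then have "Fo M c \<noteq> {}" by blast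
  then show ?thesis using that[OF p(1,2)] p(3,4) by simp
qed

text \<open>
  The range of \<open>M f\<close> is a subset through which \<open>M f\<close> factors.
\<close>

lemma M_image:
  assumes im: "is_image C f m" and f: "f \<in> hom C x y"
  shows "map_range (Fa M m) \<subseteq> map_range (Fa M f)"
proof -
  interpret S: category "set_cat :: ('u set, 'u set_map) cat" by (rule category_set_cat)
  have mh: "m \<in> hom C (Dom C m) y" using im homD[OF f] monos_into_hom by (auto simp: is_image_def)
  have sim: "is_image set_cat (Fa M f) (Fa M m)"
    using coherent im homD[OF f] unfolding coherent_functor_def by blast
  let ?R = "map_range (Fa M f)"
  have sub: "?R \<subseteq> Fo M y" using M_range[OF f] M_app_mem[OF f] by auto
  have N: "(?R, restrict (\<lambda>\<alpha>. \<alpha>) ?R, Fo M y) \<in> hom set_cat ?R (Fo M y)"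
    by (rule restrict_hom_set_cat) (use sub in auto)
  have "(?R, restrict (\<lambda>\<alpha>. \<alpha>) ?R, Fo M y) \<in> monos_into set_cat (Fo M y)"
    unfolding monos_into_set_cat_iff[OF N] by (auto simp: inj_on_def)
  moreover have "factors_through set_cat (Fa M f) (?R, restrict (\<lambda>\<alpha>. \<alpha>) ?R, Fo M y)"
    unfolding factors_through_set_cat_iff[OF M_hom[OF f] N] using M_range[OF f] by auto
  ultimately have "factors_through set_cat (Fa M m) (?R, restrict (\<lambda>\<alpha>. \<alpha>) ?R, Fo M y)"
    using sim S.homD[OF M_hom[OF f]] by (simp add: is_image_def)
  then show ?thesis
    unfolding factors_through_set_cat_iff[OF M_hom[OF mh] N] M_range[OF mh] by auto
qed

end

section \<open>Degenerate and 2-valued categories\<close>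

context coherent_category
begin

lemma sub_equiv_equiv: "equiv (monos_into C x) (sub_equiv C x)"
proof (rule equivI)
  show "sub_equiv C x \<subseteq> monos_into C x \<times> monos_into C x" by (auto simp: sub_equiv_def)
  show "refl_on (monos_into C x) (sub_equiv C x)"
    using factors_through_refl monos_into_hom by (fastforce simp: refl_on_def sub_equiv_def)
  show "sym (sub_equiv C x)" by (auto simp: sym_def sub_equiv_def)
  show "trans (sub_equiv C x)"
  proof (rule transI)
    fix u v w assume "(u, v) \<in> sub_equiv C x" "(v, w) \<in> sub_equiv C x"
    then have m: "u \<in> monos_into C x" "v \<in> monos_into C x" "w \<in> monos_into C x"
      and le: "sub_le C u v" "sub_le C v u" "sub_le C v w" "sub_le C w v" by (auto simp: sub_equiv_def)
    note h = monos_into_hom[OF m(1)] monos_into_hom[OF m(2)] monos_into_hom[OF m(3)]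
    show "(u, w) \<in> sub_equiv C x"
      using m factors_through_trans[OF le(1,3) h] factors_through_trans[OF le(4,2) h(3,2,1)]
      by (simp add: sub_equiv_def)
  qed
qed

lemma initial_sub_le:
  assumes u: "u \<in> monos_into C x" "is_initial C (Dom C u)" and v: "v \<in> monos_into C x"
  shows "sub_le C u v"
proof -
  note uh = monos_into_hom[OF u(1)] and vh = monos_into_hom[OF v]
  obtain h where h: "h \<in> hom C (Dom C u) (Dom C v)"
    using u(2) hom_Ob[OF vh] by (auto simp: is_initial_def)
  have "v \<bullet> h = u" using u(2) hom_Ob[OF vh] Comp_hom[OF h vh] uh unfolding is_initial_def by blast
  then show ?thesis using h factors_through_iff[OF uh vh] by blast
qed

lemma initial_if_sub_le:
  assumes "sub_le C u v" "is_initial C (Dom C v)"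
  shows "is_initial C (Dom C u)"
  using assms initial_strict unfolding factors_through_def by blast

text \<open>
  The two classes have to be those of the bottom subobject and of the identity, and the subobjects in
  the class of the bottom are those with initial domain.
\<close>

lemma card_Sub_eq_2_iff:
  assumes x: "x \<in> Ob C"
  shows "card (Sub C x) = 2 \<longleftrightarrow>
    \<not> is_initial C x \<and> (\<forall>u\<in>monos_into C x. is_initial C (Dom C u) \<or> sub_le C (Id C x) u)"
proof -
  obtain m0 where m0: "m0 \<in> monos_into C x" "is_initial C (Dom C m0)" using ex_bottom[OF x] by blast
  note i = Id_mono[OF x]
  let ?R = "sub_equiv C x"
  have DI: "Dom C (Id C x) = x" using homD[OF Id_hom[OF x]] by simp
  have io: "?R `` {Id C x} = ?R `` {m0} \<longleftrightarrow> is_initial C x"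
    using eq_equiv_class_iff[OF sub_equiv_equiv i m0(1)] initial_sub_le[OF m0 i] i m0(1)
      initial_sub_le[OF i _ m0(1)] initial_if_sub_le[OF _ m0(2), of "Id C x"] DI
    by (auto simp: sub_equiv_def)
  have uo: "?R `` {u} = ?R `` {m0} \<longleftrightarrow> is_initial C (Dom C u)" if u: "u \<in> monos_into C x" for u
    using eq_equiv_class_iff[OF sub_equiv_equiv u m0(1)] initial_sub_le[OF m0 u] u m0(1)
      initial_sub_le[OF u _ m0(1)] initial_if_sub_le[OF _ m0(2), of u]
    by (auto simp: sub_equiv_def)
  have ui: "?R `` {u} = ?R `` {Id C x} \<longleftrightarrow> sub_le C (Id C x) u" if u: "u \<in> monos_into C x" for u
    using eq_equiv_class_iff[OF sub_equiv_equiv u i] sub_le_Id[OF u] u i by (auto simp: sub_equiv_def)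
  have Sub: "Sub C x = (\<lambda>u. ?R `` {u}) ` monos_into C x"
    by (auto simp: Sub_def quotient_def)
  show ?thesis
  proof
    assume c2: "card (Sub C x) = 2"
    have ne: "\<not> is_initial C x"
    proof
      assume xi: "is_initial C x"
      have "is_initial C (Dom C u)" if "u \<in> monos_into C x" for u
        using initial_strict[OF xi monos_into_hom[OF that]] .
      then have "Sub C x \<subseteq> {?R `` {m0}}" using uo by (auto simp: Sub)
      then have "card (Sub C x) \<le> 1" using card_mono[of "{?R `` {m0}}"] by simp
      then show False using c2 by simp
    qed
    have "{?R `` {Id C x}, ?R `` {m0}} \<subseteq> Sub C x" using i m0 by (auto simp: Sub)
    moreover have "card {?R `` {Id C x}, ?R `` {m0}} = 2" using io ne by simp
    ultimately have eq: "{?R `` {Id C x}, ?R `` {m0}} = Sub C x"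
      using c2 card_subset_eq[of "Sub C x"] by (metis card.infinite zero_neq_numeral)
    have "is_initial C (Dom C u) \<or> sub_le C (Id C x) u" if u: "u \<in> monos_into C x" for u
    proof -
      have "?R `` {u} \<in> {?R `` {Id C x}, ?R `` {m0}}" unfolding eq using u by (auto simp: Sub)
      then show ?thesis using uo[OF u] ui[OF u] by blast
    qed
    with ne show "\<not> is_initial C x \<and> (\<forall>u\<in>monos_into C x. is_initial C (Dom C u) \<or> sub_le C (Id C x) u)"
      by blast
  next
    assume r: "\<not> is_initial C x \<and> (\<forall>u\<in>monos_into C x. is_initial C (Dom C u) \<or> sub_le C (Id C x) u)"
    have "Sub C x = {?R `` {Id C x}, ?R `` {m0}}"
    proof
      show "Sub C x \<subseteq> {?R `` {Id C x}, ?R `` {m0}}" using r uo ui by (auto simp: Sub)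
      show "{?R `` {Id C x}, ?R `` {m0}} \<subseteq> Sub C x" using i m0 by (auto simp: Sub)
    qed
    then show "card (Sub C x) = 2" using io r by simp
  qed
qed

text \<open>
  An equivalence with the terminal category makes all objects isomorphic to a single one and, by
  naturality, all parallel arrows equal. Conversely, if \<open>t\<close> is also initial, then by strictness
  so is every object.
\<close>

lemma equivalent_terminal_cat_iff:
  assumes t: "is_terminal C t"
  shows "equivalent_categories C terminal_cat \<longleftrightarrow> is_initial C t"
proof
  have tO: "t \<in> Ob C" using t by (simp add: is_terminal_def)
  assume "equivalent_categories C terminal_cat"
  then obtain F :: "('o, 'm, unit, unit) cat_functor" and G
    where "nat_isomorphic C C (comp_functor G F) id_functor"
    unfolding equivalent_categories_def by blast
  then have "\<exists>\<eta>. (\<forall>x\<in>Ob C. \<eta> x \<in> hom C (Fo G ()) x \<and> is_iso C (\<eta> x)) \<and>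
      (\<forall>x y. \<forall>f\<in>hom C x y. f \<bullet> \<eta> x = \<eta> y \<bullet> Fa G ())"
    by (simp add: nat_isomorphic_def comp_functor_def id_functor_def)
  then obtain \<eta> where \<eta>: "\<And>x. x \<in> Ob C \<Longrightarrow> \<eta> x \<in> hom C (Fo G ()) x \<and> is_iso C (\<eta> x)"
    and nat: "\<And>x y f. f \<in> hom C x y \<Longrightarrow> f \<bullet> \<eta> x = \<eta> y \<bullet> Fa G ()"
    by blast
  have inv: "\<exists>k\<in>hom C x (Fo G ()). \<eta> x \<bullet> k = Id C x" if x: "x \<in> Ob C" for x
    using \<eta>[OF x] by (auto simp: is_iso_def hom_def)
  have thin: "f = g" if fg: "f \<in> hom C x y" "g \<in> hom C x y" for f g x y
  proof -
    have x: "x \<in> Ob C" using hom_Ob[OF fg(1)] by simp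
    obtain k where k: "k \<in> hom C x (Fo G ())" "\<eta> x \<bullet> k = Id C x" using inv[OF x] by blast
    have \<eta>x: "\<eta> x \<in> hom C (Fo G ()) x" using \<eta>[OF x] by simp
    have "f \<bullet> \<eta> x = g \<bullet> \<eta> x" using nat fg by simp
    from comp_eq_comp[OF fg(1) \<eta>x fg(2) \<eta>x this k(1)] k(2)
    show ?thesis using Comp_Id_right fg by simp
  qed
  have "\<exists>f. f \<in> hom C t x" if x: "x \<in> Ob C" for x
    using inv[OF tO] \<eta>[OF x] Comp_hom by blast
  then show "is_initial C t" using thin tO unfolding is_initial_def by blast
next
  assume ti: "is_initial C t"
  have tO: "t \<in> Ob C" using t by (simp add: is_terminal_def)
  have init: "is_initial C x" if x: "x \<in> Ob C" for x
  proof -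
    obtain f where "f \<in> hom C x t" using t x by (auto simp: is_terminal_def)
    then show ?thesis using initial_strict[OF ti] by blast
  qed
  have thin: "f = g" if fg: "f \<in> hom C x y" "g \<in> hom C x y" for f g x y
    using init hom_Ob[OF fg(1)] fg unfolding is_initial_def by blast
  define F :: "('o, 'm, unit, unit) cat_functor" where "F = \<lparr>Fo = (\<lambda>_. ()), Fa = (\<lambda>_. ())\<rparr>"
  define G :: "(unit, unit, 'o, 'm) cat_functor" where "G = \<lparr>Fo = (\<lambda>_. t), Fa = (\<lambda>_. Id C t)\<rparr>"
  have idt: "Id C t \<in> hom C t t" using Id_hom[OF tO] .
  have "is_functor C terminal_cat F"
    by (simp add: is_functor_def F_def terminal_cat_def hom_def)
  moreover have "is_functor terminal_cat C G"
    using tO idt Comp_Id_left[OF idt] by (simp add: is_functor_def G_def terminal_cat_def)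
  moreover have "nat_isomorphic C C (comp_functor G F) id_functor"
  proof -
    define \<eta> where "\<eta> = (\<lambda>x. SOME f. f \<in> hom C t x)"
    have \<eta>: "\<eta> x \<in> hom C t x" if x: "x \<in> Ob C" for x
      unfolding \<eta>_def by (rule someI_ex) (use ti x in \<open>auto simp: is_initial_def\<close>)
    have iso: "is_iso C (\<eta> x)" if x: "x \<in> Ob C" for x
    proof -
      obtain k where k: "k \<in> hom C x t" using init[OF x] tO by (auto simp: is_initial_def)
      have "k \<bullet> \<eta> x = Id C t" "\<eta> x \<bullet> k = Id C x"
        using thin[OF Comp_hom[OF \<eta>[OF x] k] idt] thin[OF Comp_hom[OF k \<eta>[OF x]] Id_hom[OF x]] by auto
      then show ?thesis using homD[OF \<eta>[OF x]] k unfolding is_iso_def by auto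
    qed
    have "f \<bullet> \<eta> x = \<eta> y \<bullet> Id C t" if f: "f \<in> hom C x y" for f x y
    proof -
      have xy: "x \<in> Ob C" "y \<in> Ob C" using hom_Ob[OF f] by auto
      show ?thesis using thin[OF Comp_hom[OF \<eta>[OF xy(1)] f] Comp_hom[OF idt \<eta>[OF xy(2)]]] .
    qed
    then show ?thesis
      unfolding nat_isomorphic_def using \<eta> iso
      by (intro exI[of _ \<eta>]) (simp add: comp_functor_def id_functor_def F_def G_def)
  qed
  moreover have "nat_isomorphic terminal_cat terminal_cat (comp_functor F G) id_functor"
    by (simp add: nat_isomorphic_def terminal_cat_def hom_def is_iso_def)
  ultimately show "equivalent_categories C terminal_cat"
    unfolding equivalent_categories_def by blast
qed

end

section \<open>Semantic completeness\<close>

text \<open>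
  For the nontrivial direction, a non-initial \<open>u \<le> a\<close> disjoint from \<open>b\<close> has full support by
  2-valuedness, so its value is inhabited, while the intersection of the values of \<open>u\<close> and \<open>b\<close> is
  empty.
\<close>

lemma (in set_model) range_subset_iff_sub_le:
  assumes wb: "weakly_boolean C" and tv: "two_valued C"
    and a: "a \<in> monos_into C x" and b: "b \<in> monos_into C x"
  shows "map_range (Fa M a) \<subseteq> map_range (Fa M b) \<longleftrightarrow> sub_le C a b"
proof
  note ah = monos_into_hom[OF a] and bh = monos_into_hom[OF b]
  show "sub_le C a b \<Longrightarrow> map_range (Fa M a) \<subseteq> map_range (Fa M b)" using M_range_mono[OF ah bh] .
  assume sub: "map_range (Fa M a) \<subseteq> map_range (Fa M b)"
  show "sub_le C a b"
  proof (rule ccontr)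
    assume "\<not> sub_le C a b"
    moreover have "x \<in> Ob C" using hom_Ob[OF ah] by simp
    ultimately obtain u w where u: "u \<in> monos_into C x" "\<not> is_initial C (Dom C u)" "sub_le C u a"
      and w: "is_inter C x u b w" "is_initial C (Dom C w)"
      using wb a b unfolding weakly_boolean_def by blast
    note uh = monos_into_hom[OF u(1)]
    obtain t where t: "is_terminal C t" "card (Sub C t) = 2" using tv by (auto simp: two_valued_def)
    have tO: "t \<in> Ob C" using t(1) by (simp add: is_terminal_def)
    obtain k where k: "k \<in> hom C (Dom C u) t" using t(1) hom_Ob[OF uh] by (auto simp: is_terminal_def)
    obtain m where im: "is_image C k m" using images homD[OF k] by blast
    have m: "m \<in> monos_into C t" using im homD[OF k] by (simp add: is_image_def)
    obtain e where "e \<in> hom C (Dom C u) (Dom C m)" by (rule image_cover[OF im k])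
    then have "\<not> is_initial C (Dom C m)" using u(2) initial_strict by blast
    then have "sub_le C (Id C t) m" using card_Sub_eq_2_iff[OF tO] t(2) m by blast
    then have "map_range (Fa M (Id C t)) \<subseteq> map_range (Fa M k)"
      using M_range_mono[OF Id_hom[OF tO] monos_into_hom[OF m]] M_image[OF im k] by blast
    moreover have "map_range (Fa M (Id C t)) \<noteq> {}"
      using M_range[OF Id_hom[OF tO]] M_terminal[OF t(1)] by auto
    ultimately obtain \<alpha> where \<alpha>: "\<alpha> \<in> Fo M (Dom C u)" using M_range[OF k] by auto
    have "app (Fa M u) \<alpha> \<in> map_range (Fa M b)"
      using M_range_mono[OF uh ah u(3)] sub M_range[OF uh] \<alpha> by blast
    then obtain \<beta> where \<beta>: "\<beta> \<in> Fo M (Dom C b)" "app (Fa M u) \<alpha> = app (Fa M b) \<beta>"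
      using M_range[OF bh] by auto
    obtain P p q where P: "p \<in> hom C P (Dom C u)" "q \<in> hom C P (Dom C b)" "u \<bullet> p = b \<bullet> q" "Fo M P \<noteq> {}"
      by (rule M_pullback_inhabited[OF uh bh \<alpha> \<beta>])
    note uph = Comp_hom[OF P(1) uh]
    obtain n where n: "is_image C (u \<bullet> p) n" using images homD[OF uph] by blast
    have nm: "n \<in> monos_into C x" using n homD[OF uph] by (simp add: is_image_def)
    \<comment> \<open>Intersections are tested on subobjects only, so the square over \<open>u\<close> and \<open>b\<close> is replaced by its image.\<close>
    have "factors_through C (u \<bullet> p) u" "factors_through C (u \<bullet> p) b"
      using factors_through_iff[OF uph uh] factors_through_iff[OF uph bh] P by auto
    then have "sub_le C n u" "sub_le C n b"
      using n u(1) b homD[OF uph] by (auto simp: is_image_def)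
    then have "sub_le C n w" using w(1) nm by (simp add: is_inter_def)
    then have ni: "is_initial C (Dom C n)" using initial_if_sub_le w(2) by blast
    obtain e where "e \<in> hom C P (Dom C n)" by (rule image_cover[OF n uph])
    then have "is_initial C P" using initial_strict[OF ni] by blast
    then show False using M_initial P(4) by blast
  qed
qed

lemma (in coherent_category) weakly_boolean_two_valued_imp_semantically_complete:
  assumes wb: "weakly_boolean C" and tv: "two_valued C"
  shows "semantically_complete TYPE('u) C"
  unfolding semantically_complete_def
proof (intro conjI allI impI)
  obtain t where t: "is_terminal C t" "card (Sub C t) = 2" using tv by (auto simp: two_valued_def)
  then show "\<not> equivalent_categories C terminal_cat"
    using card_Sub_eq_2_iff equivalent_terminal_cat_iff by (auto simp: is_terminal_def)
  fix M N :: "(_, _, 'u set, 'u set_map) cat_functor"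
  assume MN: "coherent_functor C set_cat M \<and> coherent_functor C set_cat N"
  interpret M: set_model C M using MN by unfold_locales simp
  interpret N: set_model C N using MN by unfold_locales simp
  show "elementary_equivalent C M N"
    unfolding elementary_equivalent_def
    using M.range_subset_iff_sub_le[OF wb tv] N.range_subset_iff_sub_le[OF wb tv] by blast
qed

text \<open>
  A subobject \<open>u\<close> strictly between the bottom and \<open>t\<close> would be nonempty in a functor separating it
  from the bottom, and empty in a functor separating \<open>t\<close> from \<open>u\<close>, because the value of \<open>t\<close> is a
  singleton.
\<close>

lemma semantically_complete_imp_two_valued:
  fixes C :: "('o, 'm) cat"
  assumes C: "coherent_category C" and small: "small_in TYPE('u) C"
    and sc: "semantically_complete TYPE('u) C"
  shows "two_valued C"
proof -
  interpret coherent_category C by (rule C)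
  obtain t where t: "is_terminal C t" using ex_terminal by blast
  have tO: "t \<in> Ob C" using t by (simp add: is_terminal_def)
  have ti: "\<not> is_initial C t"
    using sc equivalent_terminal_cat_iff[OF t] by (simp add: semantically_complete_def)
  have "is_initial C (Dom C u) \<or> sub_le C (Id C t) u" if u: "u \<in> monos_into C t" for u
  proof (rule ccontr)
    assume "\<not> ?thesis"
    then have ui: "\<not> is_initial C (Dom C u)" and Iu: "\<not> sub_le C (Id C t) u" by auto
    note uh = monos_into_hom[OF u]
    obtain m0 where m0: "m0 \<in> monos_into C t" "is_initial C (Dom C m0)" using ex_bottom[OF tO] by blast
    have "\<not> sub_le C u m0" using initial_if_sub_le m0(2) ui by blast
    then obtain M :: "('o, 'm, 'u set, 'u set_map) cat_functor" where
      M: "coherent_functor C set_cat M" "\<exists>\<alpha>\<in>Fo M (Dom C u). app (Fa M u) \<alpha> \<notin> map_range (Fa M m0)"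
      by (rule ex_separating_functor[OF C small uh m0(1)]) (rule that)
    obtain N :: "('o, 'm, 'u set, 'u set_map) cat_functor" where
      N: "coherent_functor C set_cat N" "\<exists>\<alpha>\<in>Fo N t. app (Fa N (Id C t)) \<alpha> \<notin> map_range (Fa N u)"
      by (rule ex_separating_functor[OF C small Id_hom[OF tO] u Iu]) (rule that)
    interpret M: set_model C M using M(1) by unfold_locales
    interpret N: set_model C N using N(1) by unfold_locales
    have "\<not> map_range (Fa M u) \<subseteq> map_range (Fa M m0)"
      using M(2) M.M_range[OF uh] by blast
    moreover have "elementary_equivalent C M N"
      using sc M(1) N(1) by (simp add: semantically_complete_def)
    ultimately have "\<not> map_range (Fa N u) \<subseteq> map_range (Fa N m0)"
      using tO u m0(1) by (auto simp: elementary_equivalent_def)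
    then obtain \<alpha> where \<alpha>: "\<alpha> \<in> map_range (Fa N u)" by blast
    then have "\<alpha> \<in> Fo N t" using N.M_range[OF uh] N.M_app_mem[OF uh] by auto
    moreover obtain \<beta> where "\<beta> \<in> Fo N t" "\<beta> \<notin> map_range (Fa N u)" using N(2) N.M_app_Id[OF tO] by auto
    ultimately show False using N.M_terminal[OF t] \<alpha> by blast
  qed
  then have "card (Sub C t) = 2" using card_Sub_eq_2_iff[OF tO] ti by blast
  then show ?thesis using t by (auto simp: two_valued_def)
qed

text \<open>
  Separation of \<open>a\<close> from \<open>b\<close> is carried from an arbitrary functor \<open>M\<close> to a fixed positively closed \<open>N\<close>.
  An element of \<open>N a\<close> outside \<open>N b\<close> lies in \<open>N u\<close> for some \<open>u\<close> disjoint from \<open>b\<close>; the sought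
  subobject of \<open>a\<close> is the intersection of \<open>a\<close> and \<open>u\<close>, whose value is inhabited.
\<close>

lemma semantically_complete_imp_weakly_boolean:
  fixes C :: "('o, 'm) cat"
  assumes C: "coherent_category C" and small: "small_in TYPE('u) C"
    and sc: "semantically_complete TYPE('u) C"
  shows "weakly_boolean C"
proof -
  interpret coherent_category C by (rule C)
  obtain t where t: "is_terminal C t" using ex_terminal by blast
  have tO: "t \<in> Ob C" using t by (simp add: is_terminal_def)
  have ti: "\<not> is_initial C t"
    using sc equivalent_terminal_cat_iff[OF t] by (simp add: semantically_complete_def)
  obtain m0 where m0: "m0 \<in> monos_into C t" "is_initial C (Dom C m0)" using ex_bottom[OF tO] by blast
  have "\<not> sub_le C (Id C t) m0" using initial_if_sub_le[OF _ m0(2)] ti homD[OF Id_hom[OF tO]] by metis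
  then obtain N :: "('o, 'm, 'u set, 'u set_map) cat_functor" where N: "coherent_functor C set_cat N"
    "\<exists>\<alpha>\<in>Fo N t. app (Fa N (Id C t)) \<alpha> \<notin> map_range (Fa N m0)"
    "is_initial C (Dom C m0) \<longrightarrow> positively_closed C N"
    by (rule ex_separating_functor[OF C small Id_hom[OF tO] m0(1)])
  interpret N: set_model C N using N(1) by unfold_locales
  have "\<exists>m\<in>monos_into C x. \<not> is_initial C (Dom C m) \<and> sub_le C m a \<and>
      (\<exists>w. is_inter C x m b w \<and> is_initial C (Dom C w))"
    if xO: "x \<in> Ob C" and a: "a \<in> monos_into C x" and b: "b \<in> monos_into C x" and ab: "\<not> sub_le C a b"
    for x a b
  proof -
    note ah = monos_into_hom[OF a] and bh = monos_into_hom[OF b]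
    obtain M :: "('o, 'm, 'u set, 'u set_map) cat_functor" where
      M: "coherent_functor C set_cat M" "\<exists>\<alpha>\<in>Fo M (Dom C a). app (Fa M a) \<alpha> \<notin> map_range (Fa M b)"
      by (rule ex_separating_functor[OF C small ah b ab]) (rule that)
    interpret M: set_model C M using M(1) by unfold_locales
    have "\<not> map_range (Fa M a) \<subseteq> map_range (Fa M b)" using M(2) M.M_range[OF ah] by blast
    moreover have "elementary_equivalent C M N"
      using sc M(1) N(1) by (simp add: semantically_complete_def)
    ultimately have "\<not> map_range (Fa N a) \<subseteq> map_range (Fa N b)"
      using xO a b by (auto simp: elementary_equivalent_def)
    then obtain \<gamma> where \<gamma>: "\<gamma> \<in> Fo N (Dom C a)" and nb: "app (Fa N a) \<gamma> \<notin> map_range (Fa N b)"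
      using N.M_range[OF ah] by auto
    obtain u where u: "u \<in> monos_into C x" "app (Fa N a) \<gamma> \<in> map_range (Fa N u)"
      and disj: "\<And>T j k. j \<in> hom C T (Dom C u) \<Longrightarrow> k \<in> hom C T (Dom C b) \<Longrightarrow> u \<bullet> j = b \<bullet> k \<Longrightarrow> is_initial C T"
      using N(3) m0(2) b N.M_app_mem[OF ah \<gamma>] nb unfolding positively_closed_def by metis
    note uh = monos_into_hom[OF u(1)]
    obtain \<beta> where \<beta>: "\<beta> \<in> Fo N (Dom C u)" "app (Fa N a) \<gamma> = app (Fa N u) \<beta>"
      using u(2) N.M_range[OF uh] by auto
    obtain P p q where P: "p \<in> hom C P (Dom C a)" "q \<in> hom C P (Dom C u)" "a \<bullet> p = u \<bullet> q" "Fo N P \<noteq> {}"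
      by (rule N.M_pullback_inhabited[OF ah uh \<gamma> \<beta>])
    note aph = Comp_hom[OF P(1) ah]
    obtain m where im: "is_image C (a \<bullet> p) m" using images homD[OF aph] by blast
    have m: "m \<in> monos_into C x" using im homD[OF aph] by (simp add: is_image_def)
    note mh = monos_into_hom[OF m]
    have "factors_through C (a \<bullet> p) a" "factors_through C (a \<bullet> p) u"
      using factors_through_iff[OF aph ah] factors_through_iff[OF aph uh] P by auto
    then have mle: "sub_le C m a" "sub_le C m u"
      using im a u(1) homD[OF aph] by (auto simp: is_image_def)
    have mi: "\<not> is_initial C (Dom C m)"
    proof
      assume "is_initial C (Dom C m)"
      moreover obtain e where "e \<in> hom C P (Dom C m)" by (rule image_cover[OF im aph])
      ultimately show False using initial_strict N.M_initial P(4) by blast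
    qed
    obtain w where w: "w \<in> monos_into C x" "is_initial C (Dom C w)" using ex_bottom[OF xO] by blast
    have "sub_le C n w" if n: "n \<in> monos_into C x" "sub_le C n m" "sub_le C n b" for n
    proof -
      note nh = monos_into_hom[OF n(1)]
      have "sub_le C n u" using factors_through_trans[OF n(2) mle(2) nh mh uh] .
      then obtain j k where "j \<in> hom C (Dom C n) (Dom C u)" "k \<in> hom C (Dom C n) (Dom C b)" "u \<bullet> j = b \<bullet> k"
        using n(3) factors_through_iff[OF nh uh] factors_through_iff[OF nh bh] by auto
      then have "is_initial C (Dom C n)" using disj by blast
      then show ?thesis using initial_sub_le[OF n(1) _ w(1)] by blast
    qed
    then have "is_inter C x m b w"
      using w initial_sub_le[OF w m] initial_sub_le[OF w b] by (simp add: is_inter_def)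
    then show ?thesis using m mi mle(1) w(2) by blast
  qed
  then show ?thesis unfolding weakly_boolean_def by blast
qed

theorem theorem6p22:
  fixes C :: "('o, 'm) cat"
  assumes "coherent_category C"
    and "small_in TYPE('u) C"
  shows "semantically_complete TYPE('u) C \<longleftrightarrow> weakly_boolean C \<and> two_valued C"
  using semantically_complete_imp_weakly_boolean[OF assms] semantically_complete_imp_two_valued[OF assms]
    coherent_category.weakly_boolean_two_valued_imp_semantically_complete[OF assms(1), where 'u = 'u] by blast

end
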